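(* Let $r\geqslant 3$ be an integer and let $F$ be a graph such that $ex(n,F)=t_r(n)+O(1)$ as $n\to\infty$. Then there exists $n_0$ such that for every $n\geqslant n_0$ we have $Ex_{ssp}(n,F)\subseteq Ex(n,F)$; that is, every $n$-vertex $F$-free graph whose signless Laplacian spectral radius is maximum among all $n$-vertex $F$-free graphs has exactly $ex(n,F)$ edges.
   Context: All graphs are finite and simple. A graph is $F$-free if it contains no subgraph isomorphic to $F$. $ex(n,F)$ is the maximum number of edges of an $n$-vertex $F$-free graph and $Ex(n,F)$ is the set of $n$-vertex $F$-free graphs with $ex(n,F)$ edges. $T_r(n)$ is the Turán graph, the complete $r$-partite graph on $n$ vertices whose part sizes differ by at most $1$, and $t_r(n)=e(T_r(n))$. For a graph $G$, $Q(G)=D(G)+A(G)$ is its signless Laplacian (degree diagonal matrix plus adjacency matrix) and $q(G)$ is the largest eigenvalue of $Q(G)$. $ex_{ssp}(n,F)$ is the maximum of $q(G)$ over all $n$-vertex $F$-free graphs $G$, and $Ex_{ssp}(n,F)$ is the set of $n$-vertex $F$-free graphs $G$ with $q(G)=ex_{ssp}(n,F)$. *)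

theory Defs
  imports
    "HOL-Library.Landau_Symbols"
    "Jordan_Normal_Form.Spectral_Radius"
begin

type_synonym 'a graph = "'a set \<times> 'a set set"

abbreviation verts :: "'a graph \<Rightarrow> 'a set" where "verts \<equiv> fst"
abbreviation edges :: "'a graph \<Rightarrow> 'a set set" where "edges \<equiv> snd"

definition simple_graph :: "'a graph \<Rightarrow> bool" where
  "simple_graph G \<longleftrightarrow> finite (verts G) \<and>
     edges G \<subseteq> {{u, v} | u v. u \<in> verts G \<and> v \<in> verts G \<and> u \<noteq> v}"

definition num_edges :: "'a graph \<Rightarrow> nat" where
  "num_edges G = card (edges G)"

definition graph_iso :: "'a graph \<Rightarrow> 'b graph \<Rightarrow> bool" where
  "graph_iso F H \<longleftrightarrow>
     (\<exists>f. bij_betw f (verts F) (verts H) \<and> (\<lambda>e. f ` e) ` edges F = edges H)"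

text \<open>Not necessarily induced, not necessarily spanning.\<close>

definition is_subgraph :: "'a graph \<Rightarrow> 'a graph \<Rightarrow> bool" where
  "is_subgraph H G \<longleftrightarrow> simple_graph H \<and> verts H \<subseteq> verts G \<and> edges H \<subseteq> edges G"

definition graph_free :: "'a graph \<Rightarrow> 'b graph \<Rightarrow> bool" where
  "graph_free F G \<longleftrightarrow> \<not> (\<exists>H. is_subgraph H G \<and> graph_iso F H)"

text \<open>The \<open>n\<close>-vertex graphs are taken on the vertex set \<open>{0..<n}\<close>; every graph with \<open>n\<close>
  vertices is isomorphic to one of these.\<close>

definition free_graphs :: "nat \<Rightarrow> 'a graph \<Rightarrow> nat graph set" where
  "free_graphs n F = {G. simple_graph G \<and> verts G = {0..<n} \<and> graph_free F G}"

text \<open>The maximum below is over a finite set. That set is empty only if \<open>F\<close> has no edges and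
  at most \<open>n\<close> vertices; \<open>ex_num n F\<close> is then \<open>Max {}\<close>, which does not depend on \<open>n\<close>, and
  \<open>ex_graphs n F\<close> is empty. The same holds for \<open>ex_ssp\<close> and \<open>ex_ssp_graphs\<close>.\<close>

definition ex_num :: "nat \<Rightarrow> 'a graph \<Rightarrow> nat" where
  "ex_num n F = Max (num_edges ` free_graphs n F)"

definition ex_graphs :: "nat \<Rightarrow> 'a graph \<Rightarrow> nat graph set" where
  "ex_graphs n F = {G \<in> free_graphs n F. num_edges G = ex_num n F}"

text \<open>The parts of the Turan graph are the residue classes modulo \<open>r\<close> in \<open>{0..<n}\<close>,
  whose sizes differ by at most one.\<close>

definition turan_graph :: "nat \<Rightarrow> nat \<Rightarrow> nat graph" where
  "turan_graph r n =
     ({0..<n}, {{u, v} | u v. u < n \<and> v < n \<and> u mod r \<noteq> v mod r})"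

definition turan_num :: "nat \<Rightarrow> nat \<Rightarrow> nat" where
  "turan_num r n = num_edges (turan_graph r n)"

definition degree_of :: "'a graph \<Rightarrow> 'a \<Rightarrow> nat" where
  "degree_of G v = card {e \<in> edges G. v \<in> e}"

text \<open>The three matrices are meant for graphs whose vertex set is an initial segment
  \<open>{0..<n}\<close> of the natural numbers: vertex \<open>i\<close> is row and column \<open>i\<close>.\<close>

definition degree_mat :: "nat graph \<Rightarrow> real mat" where
  "degree_mat G = mat (card (verts G)) (card (verts G))
     (\<lambda>(i, j). if i = j then real (degree_of G i) else 0)"

definition adjacency_mat :: "nat graph \<Rightarrow> real mat" where
  "adjacency_mat G = mat (card (verts G)) (card (verts G))
     (\<lambda>(i, j). if {i, j} \<in> edges G then 1 else 0)"

definition signless_laplacian :: "nat graph \<Rightarrow> real mat" where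
  "signless_laplacian G = degree_mat G + adjacency_mat G"

text \<open>The signless Laplacian is real symmetric, so its real eigenvalues are all its
  eigenvalues; the maximum exists as soon as \<open>G\<close> has a vertex.\<close>

definition q_radius :: "nat graph \<Rightarrow> real" where
  "q_radius G = Max (spectrum (signless_laplacian G))"

definition ex_ssp :: "nat \<Rightarrow> 'a graph \<Rightarrow> real" where
  "ex_ssp n F = Max (q_radius ` free_graphs n F)"

definition ex_ssp_graphs :: "nat \<Rightarrow> 'a graph \<Rightarrow> nat graph set" where
  "ex_ssp_graphs n F = {G \<in> free_graphs n F. q_radius G = ex_ssp n F}"

end

theory Submission
  imports Defs "HOL-Analysis.Function_Topology" "HOL-Analysis.Convex"
begin

text \<open>Write \<open>\<pi> = 2 (1 - 1/r)\<close>. Deleting the vertex of least weight in the Perron vector does not decrease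
  \<open>q / (n - 1)\<close>, and increases it substantially when that weight is well below average (this uses
  \<open>q > n\<close>, hence \<open>r \<ge> 3\<close>). Since a graph with nearly constant Perron vector satisfies \<open>q \<approx> 4 e / n\<close> and
  \<open>e \<le> ex(n, F)\<close>, this gives \<open>q \<le> (\<pi> + o(1)) n\<close>, and a \<open>q\<close>-extremal graph contains an almost spanning subgraph
  of minimum degree about \<open>(1 - 1/r) n\<close>. That subgraph contains a large complete \<open>r\<close>-partite graph, which
  partitions almost all vertices into \<open>r\<close> classes: many edges inside a class, or a vertex with many neighbours in
  every class, would yield a graph with more than \<open>t\<^sub>r + O(1)\<close> edges and hence a copy of \<open>F\<close>. Extremality,
  tested by rewiring single vertices, upgrades this to: the graph is complete \<open>r\<close>-partite up to changes inside
  a vertex set of bounded size, and its Perron vector is nearly constant.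

  For such a graph, with class sizes \<open>n/r + \<delta>\<^sub>i\<close>, \<open>D = \<Sum> \<delta>\<^sub>i\<^sup>2\<close> and surplus \<open>k\<close> inside the bounded set,
  \<open>n q / 4 \<le> (1 - 1/r) n\<^sup>2 / 2 - (1/2 - 1/r) D + k + o(1)\<close> while \<open>e = (1 - 1/r) n\<^sup>2 / 2 - D / 2 + k\<close>.
  Transplanting the bounded set into the Turan graph shows \<open>ex(n, F) \<ge> t\<^sub>r(n) + k\<close>, and \<open>n q / 4 \<ge> ex(n, F)\<close>
  by the all-ones vector. As \<open>D \<le> r/4\<close> for the Turan graph, these inequalities and integrality
  force \<open>e = ex(n, F)\<close>.\<close>

section \<open>Signless Laplacian quadratic forms\<close>

text \<open>\<open>F\<close> is known only through its edge counts: nothing is assumed about its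
  chromatic number or shape. So no copy of \<open>F\<close> is built from scratch. Forbidden
  configurations are completed to a balanced complete \<open>r\<close>-partite graph with too many
  additional edges, or a copy in a modified graph is moved back to the original one. The edge bound
  is therefore needed on small subsets as well, hence the relational setting, in which an induced
  subgraph is the same relation on a smaller set. The condition r >= 3 enters a second time through
  the coefficient 1/2 - 1/r of D, which lets q see the imbalance of the classes: a complete
  bipartite graph with two nonempty classes has q = n whatever their sizes. The final comparison is
  tightest at r = 3. With \<beta> close to 1 - 2/r, the loss 2 \<beta>, close to 2/3 there, has to
  exceed (1 - \<beta>) r/4, which is close to 1/2 for every r. All error terms are sized to fit into
  this gap.\<close>

declare sum_mult_of_bool_eq [simp del] sum_of_bool_mult_eq [simp del] sum_of_bool_eq [simp del]

definition sym_irrefl :: "(nat \<Rightarrow> nat \<Rightarrow> bool) \<Rightarrow> bool" where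
  "sym_irrefl E \<longleftrightarrow> (\<forall>u v. E u v \<longrightarrow> E v u) \<and> (\<forall>u. \<not> E u u)"

definition nbr :: "nat set \<Rightarrow> (nat \<Rightarrow> nat \<Rightarrow> bool) \<Rightarrow> nat \<Rightarrow> nat set" where
  "nbr V E v = {w \<in> V. E v w}"

definition dg :: "nat set \<Rightarrow> (nat \<Rightarrow> nat \<Rightarrow> bool) \<Rightarrow> nat \<Rightarrow> real" where
  "dg V E v = real (card (nbr V E v))"

definition deg_sum :: "nat set \<Rightarrow> (nat \<Rightarrow> nat \<Rightarrow> bool) \<Rightarrow> real" where
  "deg_sum V E = (\<Sum>v\<in>V. dg V E v)"

text \<open>This is x^T Q x, the sum of (x_u + x_v)^2 over the edges; the factor 1/2 corrects for
  ordered pairs. Adjacency enters as 0/1 weights on all pairs of \<open>V\<close>, so that double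
  sums can be swapped and split; this is why the \<open>of_bool\<close> simp rules are switched off
  above.\<close>

definition qform :: "nat set \<Rightarrow> (nat \<Rightarrow> nat \<Rightarrow> bool) \<Rightarrow> (nat \<Rightarrow> real) \<Rightarrow> real" where
  "qform V E x = (\<Sum>u\<in>V. \<Sum>v\<in>V. of_bool (E u v) * (x u + x v)^2) / 2"

definition sqnorm :: "nat set \<Rightarrow> (nat \<Rightarrow> real) \<Rightarrow> real" where
  "sqnorm V x = (\<Sum>v\<in>V. (x v)^2)"

text \<open>A Rayleigh supremum rather than an eigenvalue: it can be tested with arbitrary vectors
  on arbitrary finite vertex sets. Matrices return only in \<open>q_radius_eq_qmax\<close>.\<close>

definition qmax :: "nat set \<Rightarrow> (nat \<Rightarrow> nat \<Rightarrow> bool) \<Rightarrow> real" where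
  "qmax V E = Sup (qform V E ` {x. sqnorm V x = 1})"

lemma finite_nbr: "finite V \<Longrightarrow> finite (nbr V E v)"
  by (simp add: nbr_def)

lemma sum_nbr: "finite V \<Longrightarrow> (\<Sum>w\<in>nbr V E v. f w) = (\<Sum>w\<in>V. of_bool (E v w) * (f w :: real))"
  unfolding nbr_def sum.inter_filter by (intro sum.cong) auto

lemma dg_eq_sum: "finite V \<Longrightarrow> dg V E v = (\<Sum>w\<in>V. of_bool (E v w))"
  using sum_nbr[of V "\<lambda>_. 1" E v] by (simp add: dg_def)

lemma dg_nonneg: "dg V E v \<ge> 0"
  by (simp add: dg_def)

lemma dg_le:
  assumes "finite V" "sym_irrefl E" "v \<in> V"
  shows "dg V E v \<le> real (card V) - 1"
proof -
  have "nbr V E v \<subseteq> V - {v}" using assms by (auto simp: nbr_def sym_irrefl_def)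
  then have "card (nbr V E v) \<le> card (V - {v})" using assms by (intro card_mono) auto
  also have "\<dots> = card V - 1" using assms by simp
  finally show ?thesis
    using assms card_gt_0_iff[of V] by (auto simp: dg_def)
qed

lemma qform_expand:
  assumes "finite V" "sym_irrefl E"
  shows "qform V E x = (\<Sum>v\<in>V. dg V E v * (x v)^2 + x v * (\<Sum>w\<in>nbr V E v. x w))"
proof -
  let ?b = "\<lambda>u v. of_bool (E u v) :: real"
  have s: "?b u v = ?b v u" for u v using assms by (auto simp: sym_irrefl_def)
  have "(\<Sum>u\<in>V. \<Sum>v\<in>V. ?b u v * (x u + x v)^2) =
    (\<Sum>u\<in>V. \<Sum>v\<in>V. ?b u v * (x u)^2) + (\<Sum>u\<in>V. \<Sum>v\<in>V. ?b u v * (x v)^2)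
    + 2 * (\<Sum>u\<in>V. \<Sum>v\<in>V. ?b u v * (x u * x v))"
    by (simp add: power2_sum algebra_simps sum.distrib sum_distrib_left)
  also have "(\<Sum>u\<in>V. \<Sum>v\<in>V. ?b u v * (x v)^2) = (\<Sum>u\<in>V. \<Sum>v\<in>V. ?b u v * (x u)^2)"
    by (subst sum.swap) (simp add: s)
  also have "(\<Sum>u\<in>V. \<Sum>v\<in>V. ?b u v * (x u)^2) = (\<Sum>u\<in>V. dg V E u * (x u)^2)"
    using assms by (simp add: dg_eq_sum sum_distrib_right)
  also have "(\<Sum>u\<in>V. \<Sum>v\<in>V. ?b u v * (x u * x v)) = (\<Sum>u\<in>V. x u * (\<Sum>w\<in>nbr V E u. x w))"
    using assms by (simp add: sum_nbr sum_distrib_left mult_ac)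
  finally show ?thesis
    by (simp add: qform_def sum.distrib)
qed

lemma sqnorm_nonneg: "sqnorm V x \<ge> 0"
  by (simp add: sqnorm_def sum_nonneg)

lemma qform_nonneg: "qform V E x \<ge> 0"
  by (simp add: qform_def sum_nonneg)

lemma qform_le_deg:
  assumes "finite V" "sym_irrefl E"
  shows "qform V E x \<le> 2 * (\<Sum>v\<in>V. dg V E v * (x v)^2)"
proof -
  let ?b = "\<lambda>u v. of_bool (E u v) :: real"
  have s: "?b u v = ?b v u" for u v using assms by (auto simp: sym_irrefl_def)
  have "(\<Sum>u\<in>V. \<Sum>v\<in>V. ?b u v * (x u + x v)^2)
     \<le> (\<Sum>u\<in>V. \<Sum>v\<in>V. ?b u v * (2 * (x u)^2 + 2 * (x v)^2))"
  proof (intro sum_mono mult_left_mono)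
    show "(x u + x v)^2 \<le> 2 * (x u)^2 + 2 * (x v)^2" for u v
      using zero_le_power2[of "x u - x v"] unfolding power2_sum power2_diff by linarith
  qed auto
  also have "\<dots> = 2 * (\<Sum>u\<in>V. \<Sum>v\<in>V. ?b u v * (x u)^2) + 2 * (\<Sum>u\<in>V. \<Sum>v\<in>V. ?b u v * (x v)^2)"
    by (simp add: algebra_simps sum.distrib sum_distrib_left)
  also have "(\<Sum>u\<in>V. \<Sum>v\<in>V. ?b u v * (x v)^2) = (\<Sum>u\<in>V. \<Sum>v\<in>V. ?b u v * (x u)^2)"
    by (subst sum.swap) (simp add: s)
  also have "(\<Sum>u\<in>V. \<Sum>v\<in>V. ?b u v * (x u)^2) = (\<Sum>u\<in>V. dg V E u * (x u)^2)"
    using assms by (simp add: dg_eq_sum sum_distrib_right)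
  finally show ?thesis by (simp add: qform_def)
qed

lemma qform_le:
  assumes "finite V" "sym_irrefl E"
  shows "qform V E x \<le> 2 * (real (card V) - 1) * sqnorm V x"
proof -
  have "qform V E x \<le> 2 * (\<Sum>v\<in>V. dg V E v * (x v)^2)" by (rule qform_le_deg[OF assms])
  also have "\<dots> \<le> 2 * (\<Sum>v\<in>V. (real (card V) - 1) * (x v)^2)"
    using dg_le[OF assms] by (intro mult_left_mono sum_mono mult_right_mono) auto
  also have "\<dots> = 2 * (real (card V) - 1) * sqnorm V x"
    by (simp only: sqnorm_def sum_distrib_left mult.assoc)
  finally show ?thesis .
qed

lemma qform_scale: "qform V E (\<lambda>v. c * x v) = c^2 * qform V E x"
  by (simp add: qform_def sum_distrib_left power_mult_distrib mult_ac flip: distrib_left)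

lemma sqnorm_scale: "sqnorm V (\<lambda>v. c * x v) = c^2 * sqnorm V x"
  by (simp add: sqnorm_def sum_distrib_left power_mult_distrib)

lemma qform_bdd:
  assumes "finite V" "sym_irrefl E"
  shows "bdd_above (qform V E ` {x. sqnorm V x = 1})"
proof (rule bdd_aboveI)
  show "y \<le> 2 * (real (card V) - 1)" if "y \<in> qform V E ` {x. sqnorm V x = 1}" for y
  proof -
    from that obtain x where "y = qform V E x" "sqnorm V x = 1" by auto
    then show ?thesis using qform_le[OF assms, of x] by simp
  qed
qed

lemma qform_le_qmax:
  assumes "finite V" "sym_irrefl E"
  shows "qform V E x \<le> qmax V E * sqnorm V x"
proof (cases "sqnorm V x = 0")
  case True
  then show ?thesis using qform_le[OF assms, of x] by simp
next
  case False
  define c where "c = 1 / sqrt (sqnorm V x)"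
  have pos: "sqnorm V x > 0" using False sqnorm_nonneg[of V x] by linarith
  then have c2: "c^2 = 1 / sqnorm V x" by (simp add: c_def power_divide)
  have "sqnorm V (\<lambda>v. c * x v) = 1" using pos by (simp add: sqnorm_scale c2)
  then have "qform V E (\<lambda>v. c * x v) \<le> qmax V E"
    unfolding qmax_def by (intro cSup_upper qform_bdd assms) auto
  then show ?thesis using pos by (simp add: qform_scale c2 divide_simps mult_ac)
qed

lemma exists_unit_vector: "finite V \<Longrightarrow> V \<noteq> {} \<Longrightarrow> \<exists>x. sqnorm V x = 1"
proof -
  assume V: "finite V" "V \<noteq> {}"
  then obtain a where "a \<in> V" by auto
  then have "sqnorm V (\<lambda>v. of_bool (v = a)) = 1"
    using V by (simp add: sqnorm_def of_bool_def if_distrib[of "\<lambda>y. y^2"] cong: if_cong)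
  then show ?thesis by blast
qed

text \<open>Vectors are functions on all natural numbers, where the set of unit norm is not compact.
  Pinning the coordinates outside \<open>V\<close> to 0 and bounding the others by 1 gives a product
  of compact sets without losing any value of the form.\<close>

lemma qmax_attained:
  assumes "finite V" "V \<noteq> {}" "sym_irrefl E"
  obtains x where "sqnorm V x = 1" "qform V E x = qmax V E" "\<And>v. x v \<ge> 0"
proof -
  define K :: "(nat \<Rightarrow> real) set" where "K = PiE UNIV (\<lambda>v. if v \<in> V then {-1..1} else {0})"
  have "compact K"
  proof -
    have "compactin (product_topology (\<lambda>_. euclidean) UNIV) K"
      unfolding K_def by (subst compactin_PiE) auto
    then show ?thesis by (simp add: euclidean_product_topology)
  qed
  moreover have cn: "continuous_on UNIV (sqnorm V)" unfolding sqnorm_def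
    by (intro continuous_intros continuous_on_product_coordinates)
  have "closed {x. sqnorm V x = 1}"
    using continuous_closed_preimage_constant[OF cn, of 1] by simp
  ultimately have cK: "compact (K \<inter> {x. sqnorm V x = 1})"
    by (rule compact_Int_closed)
  have restrict_in: "(\<lambda>v. if v \<in> V then y v else 0) \<in> K \<inter> {x. sqnorm V x = 1}"
    if "sqnorm V y = 1" for y
  proof -
    have "\<bar>y v\<bar> \<le> 1" if "v \<in> V" for v
    proof -
      have "(y v)^2 \<le> sqnorm V y" unfolding sqnorm_def
        by (rule member_le_sum) (use assms that in auto)
      then show ?thesis using \<open>sqnorm V y = 1\<close> by (simp add: abs_square_le_1)
    qed
    then have "(\<lambda>v. if v \<in> V then y v else 0) \<in> K"
      by (auto simp: K_def PiE_def Pi_def abs_le_iff)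
    moreover have "sqnorm V (\<lambda>v. if v \<in> V then y v else 0) = sqnorm V y"
      by (simp add: sqnorm_def)
    ultimately show ?thesis using that by auto
  qed
  obtain y where "sqnorm V y = 1" using exists_unit_vector assms by blast
  then have ne: "K \<inter> {x. sqnorm V x = 1} \<noteq> {}" using restrict_in by blast
  have cq: "continuous_on (K \<inter> {x. sqnorm V x = 1}) (qform V E)"
    unfolding qform_def
    by (intro continuous_intros continuous_on_subset[OF continuous_on_product_coordinates]) auto
  obtain x where x: "x \<in> K" "sqnorm V x = 1"
    and xmax: "\<And>y. y \<in> K \<inter> {x. sqnorm V x = 1} \<Longrightarrow> qform V E y \<le> qform V E x"
    using continuous_attains_sup[OF cK ne cq] by auto
  have le: "qform V E y \<le> qform V E x" if "sqnorm V y = 1" for y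
  proof -
    have "qform V E y = qform V E (\<lambda>v. if v \<in> V then y v else 0)" by (simp add: qform_def)
    then show ?thesis using xmax[OF restrict_in[OF that]] by simp
  qed
  have "qmax V E = qform V E x" unfolding qmax_def
    by (rule cSup_eq_maximum) (use x le in auto)
  \<comment> \<open>Absolute values do not decrease any (x_u + x_v)^2, which yields a nonnegative
    maximiser.\<close>
  moreover have "qform V E x \<le> qform V E (\<lambda>v. \<bar>x v\<bar>)"
    unfolding qform_def
  proof (intro divide_right_mono sum_mono mult_left_mono)
    show "(x u + x v)^2 \<le> (\<bar>x u\<bar> + \<bar>x v\<bar>)^2" for u v
      using abs_triangle_ineq[of "x u" "x v"] abs_le_square_iff[of "x u + x v" "\<bar>x u\<bar> + \<bar>x v\<bar>"] by auto
  qed auto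
  moreover have n1: "sqnorm V (\<lambda>v. \<bar>x v\<bar>) = 1" using x by (simp add: sqnorm_def)
  moreover have "qform V E (\<lambda>v. \<bar>x v\<bar>) \<le> qform V E x" by (rule le[OF n1])
  ultimately show ?thesis by (intro that[of "\<lambda>v. \<bar>x v\<bar>"]) auto
qed

section \<open>First-order condition at a maximiser of the Rayleigh quotient\<close>

lemma linear_coeff_zero:
  fixes a b :: real
  assumes "\<And>t. a * t + b * t^2 \<ge> 0"
  shows "a = 0"
proof (rule ccontr)
  assume a: "a \<noteq> 0"
  define p where "p = 1 + \<bar>b\<bar>"
  define t where "t = - a / p"
  have p: "p > 0" "b < p" unfolding p_def by auto
  have "a * t + b * t^2 = a^2 / p^2 * (b - p)"
    using p by (simp add: t_def field_simps power2_eq_square)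
  also have "\<dots> < 0"
    using a p by (intro mult_pos_neg) auto
  finally show False using assms[of t] by simp
qed

lemma sum_upd:
  assumes "finite V" "a \<in> V"
  shows "(\<Sum>v\<in>V. f v ((x(a := x a + t)) v)) = (\<Sum>v\<in>V. f v (x v)) + f a (x a + t) - (f a (x a) :: real)"
proof -
  have "(\<Sum>v\<in>V. f v ((x(a := x a + t)) v)) = f a (x a + t) + (\<Sum>v\<in>V - {a}. f v ((x(a := x a + t)) v))"
    using assms by (subst sum.remove[of _ a]) auto
  also have "(\<Sum>v\<in>V - {a}. f v ((x(a := x a + t)) v)) = (\<Sum>v\<in>V - {a}. f v (x v))"
    by (intro sum.cong) auto
  finally show ?thesis using assms sum.remove[of V a "\<lambda>v. f v (x v)"] by simp
qed

text \<open>The Rayleigh quotient is stationary at a maximiser in every coordinate direction.\<close>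

lemma qmax_eigen:
  assumes V: "finite V" "sym_irrefl E" and x: "sqnorm V x = 1" "qform V E x = qmax V E" and v: "v \<in> V"
  shows "qmax V E * x v = dg V E v * x v + (\<Sum>w\<in>nbr V E v. x w)"
proof -
  let ?q = "qmax V E" and ?b = "\<lambda>u v. of_bool (E u v) :: real"
  have b: "?b u w = ?b w u" "?b u u = 0" for u w using V by (auto simp: sym_irrefl_def)
  define N where "N = (\<Sum>w\<in>nbr V E v. x w)"
  have sq: "sqnorm V (x(v := x v + t)) = 1 + 2 * t * x v + t^2" for t
    using sum_upd[OF V(1) v, of "\<lambda>_ y. y^2" x t] x
    by (simp add: sqnorm_def power2_sum)
  have qf: "qform V E (x(v := x v + t)) = ?q + 2 * t * (dg V E v * x v + N) + t^2 * dg V E v" for t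
  proof -
    define x' where "x' = x(v := x v + t)"
    \<comment> \<open>The double sum is perturbed in its inner variable first and in its outer
      variable afterwards.\<close>
    have row: "(\<Sum>w\<in>V. ?b u w * (c + x' w)^2) =
        (\<Sum>w\<in>V. ?b u w * (c + x w)^2) + ?b u v * (2 * t * (c + x v) + t^2)" for u c
      unfolding x'_def
      by (subst sum_upd[OF V(1) v, of "\<lambda>w y. ?b u w * (c + y)^2"]) (simp add: power2_eq_square algebra_simps)
    have "2 * qform V E x' = (\<Sum>u\<in>V. (\<Sum>w\<in>V. ?b u w * (x' u + x w)^2) + ?b u v * (2 * t * (x' u + x v) + t^2))"
      by (simp add: qform_def row)
    also have "\<dots> = (\<Sum>u\<in>V. (\<Sum>w\<in>V. ?b u w * (x u + x w)^2) + ?b u v * (2 * t * (x u + x v) + t^2))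
        + ((\<Sum>w\<in>V. ?b v w * (x v + t + x w)^2) - (\<Sum>w\<in>V. ?b v w * (x v + x w)^2))"
      unfolding x'_def
      by (subst sum_upd[OF V(1) v, of "\<lambda>u y. (\<Sum>w\<in>V. ?b u w * (y + x w)^2) + ?b u v * (2 * t * (y + x v) + t^2)"])
         (simp add: b)
    also have "(\<Sum>w\<in>V. ?b v w * (x v + t + x w)^2) - (\<Sum>w\<in>V. ?b v w * (x v + x w)^2)
       = (\<Sum>w\<in>V. ?b v w * (2 * t * (x w + x v) + t^2))"
      unfolding sum_subtractf[symmetric]
      by (intro sum.cong) (auto simp: power2_eq_square algebra_simps)
    also have "(\<Sum>u\<in>V. (\<Sum>w\<in>V. ?b u w * (x u + x w)^2) + ?b u v * (2 * t * (x u + x v) + t^2))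
       = 2 * ?q + (\<Sum>w\<in>V. ?b v w * (2 * t * (x w + x v) + t^2))"
      using x(2) by (simp add: sum.distrib qform_def b(1)[of _ v])
    also have "(\<Sum>w\<in>V. ?b v w * (2 * t * (x w + x v) + t^2)) = 2 * t * (dg V E v * x v + N) + t^2 * dg V E v"
      using V by (simp add: N_def sum_nbr dg_eq_sum algebra_simps sum.distrib sum_distrib_left)
    finally show ?thesis unfolding x'_def[symmetric] by (simp add: algebra_simps)
  qed
  have "2 * (?q * x v - dg V E v * x v - N) * t + (?q - dg V E v) * t^2 \<ge> 0" for t
  proof -
    have "qform V E (x(v := x v + t)) \<le> ?q * sqnorm V (x(v := x v + t))"
      by (rule qform_le_qmax[OF V])
    then show ?thesis unfolding sq qf by (simp add: algebra_simps)
  qed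
  from linear_coeff_zero[OF this] show ?thesis by (simp add: N_def)
qed

lemma qmax_ge_deg_sum:
  assumes "finite V" "sym_irrefl E" "V \<noteq> {}"
  shows "qmax V E \<ge> 2 * deg_sum V E / card V"
proof -
  have "qform V E (\<lambda>_. 1) = 2 * deg_sum V E"
    using assms by (subst qform_expand) (simp_all add: deg_sum_def dg_def sum.distrib sum_distrib_left)
  moreover have "sqnorm V (\<lambda>_. 1) = card V" by (simp add: sqnorm_def)
  ultimately show ?thesis
    using qform_le_qmax[OF assms(1,2), of "\<lambda>_. 1"] assms by (simp add: divide_simps card_gt_0_iff)
qed

lemma qmax_le: 
  assumes "finite V" "sym_irrefl E" "V \<noteq> {}"
  shows "qmax V E \<le> 2 * (real (card V) - 1)"
proof -
  obtain x where "sqnorm V x = 1" "qform V E x = qmax V E"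
    using qmax_attained[OF assms(1,3,2)] by blast
  then show ?thesis using qform_le[OF assms(1,2), of x] by simp
qed

section \<open>Deleting vertices of small weight\<close>

lemma qform_remove:
  assumes "finite V" "sym_irrefl E" "u \<in> V"
  shows "qform V E x = qform (V - {u}) E x + (\<Sum>w\<in>nbr V E u. (x u + x w)^2)"
proof -
  let ?f = "\<lambda>a b. of_bool (E a b) * (x a + x b)^2"
  have sy: "?f a b = ?f b a" and z: "?f u u = 0" for a b
    using assms by (auto simp: sym_irrefl_def add.commute)
  have row: "(\<Sum>w\<in>V. ?f a w) = ?f a u + (\<Sum>w\<in>V-{u}. ?f a w)" for a
    using assms by (subst sum.remove[of _ u]) auto
  have "(\<Sum>a\<in>V. \<Sum>w\<in>V. ?f a w) = (\<Sum>w\<in>V. ?f u w) + (\<Sum>a\<in>V-{u}. \<Sum>w\<in>V. ?f a w)"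
    using assms by (subst sum.remove[of _ u]) auto
  also have "(\<Sum>a\<in>V-{u}. \<Sum>w\<in>V. ?f a w) = (\<Sum>a\<in>V-{u}. ?f a u) + (\<Sum>a\<in>V-{u}. \<Sum>w\<in>V-{u}. ?f a w)"
    unfolding row sum.distrib ..
  also have "(\<Sum>a\<in>V-{u}. ?f a u) = (\<Sum>w\<in>V. ?f u w)"
    unfolding row[of u] z by (simp only: sy add_0)
  finally show ?thesis
    using assms(1) by (simp add: qform_def sum_nbr add_divide_distrib)
qed

lemma sum_sq_le: "finite V \<Longrightarrow> (\<Sum>v\<in>V. x v)^2 \<le> real (card V) * sqnorm V x"
  using Cauchy_Schwarz_ineq_sum[of x "\<lambda>_. 1" V] by (simp add: sqnorm_def mult.commute)

text \<open>The denominator n - 1 makes deletion exactly monotone: complete graphs, with q = 2 (n -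
  1), have the constant value 2, and the estimate of \<open>deletion_arith\<close> is an equality
  for \<epsilon> = 0 and y = 1/n.\<close>

definition phi :: "nat set \<Rightarrow> (nat \<Rightarrow> nat \<Rightarrow> bool) \<Rightarrow> real" where
  "phi V E = qmax V E / (real (card V) - 1)"

text \<open>A one-sided condition, because its failure is what makes the deletion of a lightest
  vertex profitable. With unit norm, the total excess of the squared weights over the bound is only
  \<epsilon>.\<close>

definition flat :: "real \<Rightarrow> nat set \<Rightarrow> (nat \<Rightarrow> nat \<Rightarrow> bool) \<Rightarrow> bool" where
  "flat \<epsilon> V E \<longleftrightarrow> (\<exists>x. sqnorm V x = 1 \<and> qform V E x = qmax V E \<and>
     (\<forall>v\<in>V. x v \<ge> 0 \<and> (x v)^2 \<ge> (1 - \<epsilon>) / card V))"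

text \<open>Here y is the squared weight of the deleted vertex, and q, q' are the values before and
  after. With the surplus A = q - n + 1 >= c (n - 1), the last hypothesis says q' >= (2 q - n) - A /
  (1 - y). The loss A / (1 - y) is controlled by (n - \<epsilon>) (1 - y) >= n - 1, which follows
  from n y <= 1 - \<epsilon>.\<close>

lemma deletion_arith:
  fixes n q q' y c \<epsilon> :: real
  assumes n: "n \<ge> 3" and y: "0 \<le> y" "y \<le> (1 - \<epsilon>) / n" and \<epsilon>: "0 \<le> \<epsilon>" "\<epsilon> \<le> 1" and c: "c \<ge> 0"
    and q: "q \<ge> (1 + c) * (n - 1)" and q': "q' * (1 - y) \<ge> q - 1 - (2 * q - n) * y"
  shows "q' / (n - 2) \<ge> q / (n - 1) + c * \<epsilon> / (n - 2)"
proof -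
  define A where "A = q - n + 1"
  have A: "A \<ge> c * (n - 1)" using q by (simp add: A_def algebra_simps)
  then have A0: "A \<ge> 0" using c n by (meson diff_ge_0_iff_ge dual_order.trans mult_nonneg_nonneg numeral_le_one_iff one_le_numeral)
  have ny: "n * y \<le> 1 - \<epsilon>" using y n by (simp add: field_simps)
  have y1: "1 - y > 0"
  proof -
    have "n * y < n * 1" using ny \<epsilon> n by linarith
    then show ?thesis using n by (simp only: mult_less_cancel_left) auto
  qed
  have e1: "q' * (1 - y) \<ge> (2 * q - n) * (1 - y) - A"
    using q' by (simp add: A_def algebra_simps)
  have e2: "A * (n - 1) \<le> A * ((n - \<epsilon>) * (1 - y))"
  proof (rule mult_left_mono[OF _ A0])
    have "(n - \<epsilon>) * (1 - y) = n - \<epsilon> - n * y + \<epsilon> * y" by (simp add: algebra_simps)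
    moreover have "\<epsilon> * y \<ge> 0" using \<epsilon> y by simp
    ultimately show "n - 1 \<le> (n - \<epsilon>) * (1 - y)" using ny by linarith
  qed
  have "((2 * q - n) * (n - 1) - A * (n - \<epsilon>)) * (1 - y) \<le> (2 * q - n) * (1 - y) * (n - 1) - A * (n - 1)"
    using e2 by (simp add: algebra_simps)
  also have "\<dots> = ((2 * q - n) * (1 - y) - A) * (n - 1)" by (simp add: algebra_simps)
  also have "\<dots> \<le> (q' * (1 - y)) * (n - 1)" using e1 n by (intro mult_right_mono) auto
  finally have "((2 * q - n) * (n - 1) - A * (n - \<epsilon>)) * (1 - y) \<le> (q' * (n - 1)) * (1 - y)"
    by (simp add: mult_ac)
  then have "(2 * q - n) * (n - 1) - A * (n - \<epsilon>) \<le> q' * (n - 1)" using y1 by simp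
  moreover have "(2 * q - n) * (n - 1) - A * (n - \<epsilon>) = q * (n - 2) + A * \<epsilon>"
    by (simp add: A_def algebra_simps)
  moreover have "A * \<epsilon> \<ge> c * (n - 1) * \<epsilon>" using A \<epsilon> by (intro mult_right_mono)
  ultimately have "q * (n - 2) + c * \<epsilon> * (n - 1) \<le> q' * (n - 1)" by (simp add: mult_ac)
  then have "(q * (n - 2) + c * \<epsilon> * (n - 1)) / ((n - 1) * (n - 2)) \<le> (q' * (n - 1)) / ((n - 1) * (n - 2))"
    using n by (intro divide_right_mono) auto
  moreover have "(q * (n - 2) + c * \<epsilon> * (n - 1)) / ((n - 1) * (n - 2)) = q / (n - 1) + c * \<epsilon> / (n - 2)"
    using n by (simp add: add_divide_distrib)
  moreover have "(q' * (n - 1)) / ((n - 1) * (n - 2)) = q' / (n - 2)" using n by simp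
  ultimately show ?thesis by simp
qed

text \<open>The weights of the non-neighbours of \<open>u\<close> are bounded below by that of \<open>u\<close>, which is what makes
  \<^const>\<open>phi\<close> increase.\<close>

lemma phi_remove_min:
  assumes V: "finite V" "sym_irrefl E" and n: "card V \<ge> 3"
    and x: "sqnorm V x = 1" "qform V E x = qmax V E" and u: "u \<in> V"
    and min: "\<And>v. v \<in> V \<Longrightarrow> (x u)^2 \<le> (x v)^2" and y: "(x u)^2 \<le> (1 - \<epsilon>) / card V"
    and \<epsilon>: "0 \<le> \<epsilon>" "\<epsilon> \<le> 1" and c: "c \<ge> 0" "phi V E \<ge> 1 + c"
  shows "phi (V - {u}) E \<ge> phi V E + c * \<epsilon> / (real (card V) - 2)"
proof -
  let ?n = "real (card V)" and ?N = "nbr V E u"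
  define q where "q = qmax V E"
  have fN: "finite ?N" "?N \<subseteq> V" using V by (auto simp: nbr_def)
  have eig: "q * x u = dg V E u * x u + (\<Sum>w\<in>?N. x w)"
    unfolding q_def by (rule qmax_eigen[OF V x u])
  have cN: "real (card (V - ?N)) = ?n - dg V E u"
    using fN V by (simp add: dg_def card_Diff_subset card_mono of_nat_diff)
  have "1 = (\<Sum>w\<in>?N. (x w)^2) + (\<Sum>w\<in>V - ?N. (x w)^2)"
    using x(1) sum.subset_diff[OF fN(2) V(1), of "\<lambda>w. (x w)^2"] by (simp add: sqnorm_def)
  moreover have "(\<Sum>w\<in>V - ?N. (x w)^2) \<ge> real (card (V - ?N)) * (x u)^2"
    by (intro sum_bounded_below) (use min in auto)
  ultimately have s2: "(\<Sum>w\<in>?N. (x w)^2) \<le> 1 - (?n - dg V E u) * (x u)^2"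
    by (simp add: cN)
  have "(\<Sum>w\<in>?N. (x u + x w)^2) = dg V E u * (x u)^2 + 2 * x u * (\<Sum>w\<in>?N. x w) + (\<Sum>w\<in>?N. (x w)^2)"
    by (simp add: power2_sum sum.distrib dg_def sum_distrib_left)
  also have "(\<Sum>w\<in>?N. x w) = (q - dg V E u) * x u" using eig by (simp add: algebra_simps)
  finally have S: "(\<Sum>w\<in>?N. (x u + x w)^2) \<le> 1 + (2 * q - ?n) * (x u)^2"
    using s2 by (simp add: algebra_simps power2_eq_square)
  have fin': "finite (V - {u})" using V by simp
  have "sqnorm (V - {u}) x = 1 - (x u)^2"
    using x(1) V(1) u by (simp add: sqnorm_def sum.remove[of V u])
  then have "qmax (V - {u}) E * (1 - (x u)^2) \<ge> qform (V - {u}) E x"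
    using qform_le_qmax[OF fin' V(2), of x] by simp
  also have "qform (V - {u}) E x = q - (\<Sum>w\<in>?N. (x u + x w)^2)"
    using qform_remove[OF V u, of x] x by (simp add: q_def)
  finally have main: "qmax (V - {u}) E * (1 - (x u)^2) \<ge> q - 1 - (2 * q - ?n) * (x u)^2"
    using S by linarith
  have qc: "q \<ge> (1 + c) * (?n - 1)" using c n by (simp add: phi_def q_def field_simps)
  have "qmax (V - {u}) E / (?n - 2) \<ge> q / (?n - 1) + c * \<epsilon> / (?n - 2)"
    by (rule deletion_arith[OF _ _ y \<epsilon> c(1) qc main]) (use n in auto)
  moreover have "real (card (V - {u})) - 1 = ?n - 2"
    using V u n by simp
  ultimately show ?thesis by (simp only: phi_def q_def)
qed

text \<open>Each deletion at size m gains c \<epsilon> / (m - 2), at least c \<epsilon> ln (m / (m -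
  1)), so the total gain telescopes to a logarithm. The process stops at a flat set or at two
  vertices, where \<open>phi_remove_min\<close> no longer applies.\<close>

lemma flat_subset:
  assumes "finite V" "sym_irrefl E" "card V \<ge> 2" "c \<ge> 0" "phi V E \<ge> 1 + c" "0 \<le> \<epsilon>" "\<epsilon> \<le> 1"
  shows "\<exists>U\<subseteq>V. card U \<ge> 2 \<and> phi U E \<ge> phi V E + c * \<epsilon> * ln (card V / card U) \<and> (card U = 2 \<or> flat \<epsilon> U E)"
  using assms
proof (induction "card V" arbitrary: V rule: less_induct)
  case less
  show ?case
  proof (cases "card V = 2 \<or> flat \<epsilon> V E")
    case True
    then show ?thesis using less.prems by (intro exI[of _ V]) auto
  next
    case False
    let ?n = "real (card V)"
    have n: "card V \<ge> 3" using False less.prems by auto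
    then have "V \<noteq> {}" by auto
    then obtain x where x: "sqnorm V x = 1" "qform V E x = qmax V E" "\<And>v. x v \<ge> 0"
      using qmax_attained less.prems by metis
    from False x obtain v where v: "v \<in> V" "(x v)^2 < (1 - \<epsilon>) / card V"
      unfolding flat_def by force
    obtain u where u: "u \<in> V" "\<And>v. v \<in> V \<Longrightarrow> (x u)^2 \<le> (x v)^2"
      using ex_is_arg_min_if_finite[OF less.prems(1) \<open>V \<noteq> {}\<close>, of "\<lambda>v. (x v)^2"]
      unfolding is_arg_min_linorder by blast
    have ph: "phi (V - {u}) E \<ge> phi V E + c * \<epsilon> / (?n - 2)"
      using u v less.prems by (intro phi_remove_min[OF _ _ n x(1,2)]) force+
    have c': "card (V - {u}) = card V - 1" using u less.prems by simp
    have "c * \<epsilon> / (?n - 2) \<ge> 0" using less.prems n by simp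
    then have "phi (V - {u}) E \<ge> 1 + c" using ph less.prems by linarith
    then obtain U where U: "U \<subseteq> V - {u}" "card U \<ge> 2"
      "phi U E \<ge> phi (V - {u}) E + c * \<epsilon> * ln (card (V - {u}) / card U)"
      "card U = 2 \<or> flat \<epsilon> U E"
    proof -
      have "\<exists>U\<subseteq>V - {u}. card U \<ge> 2 \<and>
          phi U E \<ge> phi (V - {u}) E + c * \<epsilon> * ln (card (V - {u}) / card U) \<and> (card U = 2 \<or> flat \<epsilon> U E)"
        by (rule less.hyps) (use less.prems n c' \<open>phi (V - {u}) E \<ge> 1 + c\<close> in auto)
      then show ?thesis using that by blast
    qed
    have m0: "real (card U) > 0" using U by simp
    have "ln (?n / (?n - 1)) \<le> ?n / (?n - 1) - 1"
      using n by (intro ln_le_minus_one) auto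
    also have "\<dots> = 1 / (?n - 1)" using n by (simp add: field_simps)
    also have "\<dots> \<le> 1 / (?n - 2)" using n by (simp add: field_simps)
    finally have "c * \<epsilon> * ln (?n / (?n - 1)) \<le> c * \<epsilon> * (1 / (?n - 2))"
      using less.prems by (intro mult_left_mono) auto
    moreover have "ln (?n / card U) = ln (?n / (?n - 1)) + ln ((?n - 1) / card U)"
      using n m0 by (simp add: ln_div)
    moreover have cc: "real (card (V - {u})) = ?n - 1" using c' n by simp
    ultimately have "phi U E \<ge> phi V E + c * \<epsilon> * ln (card V / card U)"
      using U(3)[unfolded cc] ph by (simp add: algebra_simps)
    then show ?thesis using U by (intro exI[of _ U]) auto
  qed
qed

section \<open>Consequences of a flat Perron vector\<close>

lemma flat_obtain:
  assumes "finite V" "sym_irrefl E" "flat \<epsilon> V E" "V \<noteq> {}" "0 \<le> \<epsilon>" "\<epsilon> \<le> 1"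
  obtains x :: "nat \<Rightarrow> real" and a :: real where "sqnorm V x = 1" "qform V E x = qmax V E" "a \<ge> 0" "a^2 = (1 - \<epsilon>) / card V"
    "\<And>v. v \<in> V \<Longrightarrow> x v \<ge> a"
    "0 < sum x V" "sum x V \<le> sqrt (card V)" "sum x V \<ge> card V * a" "(1 - \<epsilon>) * sqrt (card V) \<le> card V * a"
proof -
  let ?n = "real (card V)"
  obtain x where x: "sqnorm V x = 1" "qform V E x = qmax V E"
     "\<forall>v\<in>V. x v \<ge> 0 \<and> (x v)^2 \<ge> (1 - \<epsilon>) / card V"
    using assms unfolding flat_def by blast
  define a where "a = sqrt ((1 - \<epsilon>) / card V)"
  have n: "?n > 0" using assms by (simp add: card_gt_0_iff)
  have a: "a \<ge> 0" "a^2 = (1 - \<epsilon>) / card V" using assms by (auto simp: a_def)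
  have xa: "x v \<ge> a" if "v \<in> V" for v
    using x(3) that by (auto simp: a_def intro: real_le_lsqrt)
  have "sum x V \<ge> 0" using x by (intro sum_nonneg) auto
  moreover have "sum x V \<noteq> 0"
    using x assms by (subst sum_nonneg_eq_0_iff) (auto simp: sqnorm_def)
  ultimately have S0: "0 < sum x V" by simp
  have "(sum x V)^2 \<le> ?n" using sum_sq_le[OF assms(1), of x] x by simp
  then have S1: "sum x V \<le> sqrt ?n" by (rule real_le_rsqrt)
  have S2: "sum x V \<ge> ?n * a" using sum_bounded_below[of V a x] xa by simp
  have "(1 - \<epsilon>) * sqrt ?n \<le> sqrt (1 - \<epsilon>) * sqrt ?n"
  proof (intro mult_right_mono)
    show "1 - \<epsilon> \<le> sqrt (1 - \<epsilon>)" using assms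
      by (intro real_le_rsqrt) (simp add: power2_eq_square mult_left_le)
  qed auto
  also have "\<dots> = ?n * a" using n by (simp add: a_def real_sqrt_divide field_simps)
  finally show ?thesis using that x a xa S0 S1 S2 by blast
qed

text \<open>Summing the eigenvalue equations over all vertices gives q S = 2 sum d_v x_v, where S is
  the sum of the entries. Split x_v = a + (x_v - a) with the common lower bound a: the first part
  yields the average degree, and the total excess S - n a is at most \<epsilon> S.\<close>

lemma flat_qmax_le:
  fixes \<epsilon> :: real
  assumes "finite V" "sym_irrefl E" "flat \<epsilon> V E" "V \<noteq> {}" "0 \<le> \<epsilon>" "\<epsilon> \<le> 1"
  shows "qmax V E \<le> 2 * deg_sum V E / real (card V) + 2 * real (card V) * \<epsilon>"
proof -
  let ?n = "real (card V)"
  obtain x :: "nat \<Rightarrow> real" and a :: real where x: "sqnorm V x = 1" "qform V E x = qmax V E" "a \<ge> 0" "a^2 = (1 - \<epsilon>) / card V"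
    "\<And>v. v \<in> V \<Longrightarrow> x v \<ge> a"
    "0 < sum x V" "sum x V \<le> sqrt (card V)" "sum x V \<ge> card V * a" "(1 - \<epsilon>) * sqrt (card V) \<le> card V * a"
    using flat_obtain[OF assms] by blast
  let ?S = "sum x V"
  have n: "?n > 0" using assms by (simp add: card_gt_0_iff)
  have sym: "of_bool (E u v) = (of_bool (E v u) :: real)" for u v
    using assms by (auto simp: sym_irrefl_def)
  have "qmax V E * ?S = (\<Sum>v\<in>V. dg V E v * x v) + (\<Sum>v\<in>V. \<Sum>w\<in>V. of_bool (E v w) * x w)"
    unfolding sum_distrib_left sum.distrib[symmetric]
    by (intro sum.cong) (auto simp: qmax_eigen[OF assms(1,2) x(1,2)] sum_nbr[OF assms(1)])
  also have "(\<Sum>v\<in>V. \<Sum>w\<in>V. of_bool (E v w) * x w) = (\<Sum>v\<in>V. dg V E v * x v)"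
    by (subst sum.swap) (simp add: dg_eq_sum[OF assms(1)] sum_distrib_right sym)
  also have "(\<Sum>v\<in>V. dg V E v * x v) + (\<Sum>v\<in>V. dg V E v * x v)
     = 2 * a * deg_sum V E + 2 * (\<Sum>v\<in>V. dg V E v * (x v - a))"
    by (simp add: deg_sum_def sum_distrib_left sum_subtractf algebra_simps)
  also have "(\<Sum>v\<in>V. dg V E v * (x v - a)) \<le> (\<Sum>v\<in>V. ?n * (x v - a))"
    using dg_le[OF assms(1,2)] x(5) by (intro sum_mono mult_right_mono) (force, auto)
  also have "(\<Sum>v\<in>V. ?n * (x v - a)) = ?n * (?S - ?n * a)"
    by (simp add: sum_distrib_left[symmetric] sum_subtractf)
  finally have "qmax V E * ?S \<le> 2 * a * deg_sum V E + 2 * (?n * (?S - ?n * a))" by simp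
  also have "2 * a * deg_sum V E \<le> 2 * (?S / ?n) * deg_sum V E"
    using x(8) n by (intro mult_right_mono)
      (auto simp: field_simps deg_sum_def intro!: sum_nonneg dg_nonneg)
  also have "?n * a \<ge> (1 - \<epsilon>) * ?S"
    using x(9) mult_left_mono[OF x(7), of "1 - \<epsilon>"] assms by linarith
  then have "?n * (?S - ?n * a) \<le> ?n * (\<epsilon> * ?S)"
    using n by (intro mult_left_mono) (auto simp: algebra_simps)
  finally have "qmax V E * ?S \<le> (2 * deg_sum V E / ?n + 2 * ?n * \<epsilon>) * ?S"
    by (simp add: algebra_simps)
  then show ?thesis using x(6) by simp
qed

text \<open>The non-neighbours of u carry at least (n - d) a of the total weight S, so the
  eigenvalue equation at u gives (q - d) a <= S - (n - d) a. As S <= (1 + 2 \<epsilon>) n a, this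
  means q <= 2 d + 2 \<epsilon> n. The case distinction supplies the sign of q - d.\<close>

lemma flat_min_degree:
  fixes \<epsilon> :: real
  assumes "finite V" "sym_irrefl E" "flat \<epsilon> V E" "0 \<le> \<epsilon>" "\<epsilon> \<le> 1 / 2" "u \<in> V"
  shows "dg V E u \<ge> qmax V E / 2 - \<epsilon> * card V"
proof (cases "dg V E u \<ge> qmax V E")
  case True
  moreover have "qmax V E \<ge> 0"
  proof -
    obtain x where "qform V E x = qmax V E" using assms by (auto simp: flat_def)
    then show ?thesis using qform_nonneg by metis
  qed
  moreover have "\<epsilon> * card V \<ge> 0" using assms by simp
  ultimately show ?thesis by linarith
next
  case False
  let ?n = "real (card V)" and ?N = "nbr V E u"
  have ne: "V \<noteq> {}" using assms by auto
  obtain x :: "nat \<Rightarrow> real" and a :: real where x: "sqnorm V x = 1" "qform V E x = qmax V E" "a \<ge> 0" "a^2 = (1 - \<epsilon>) / card V"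
    "\<And>v. v \<in> V \<Longrightarrow> x v \<ge> a"
    "0 < sum x V" "sum x V \<le> sqrt (card V)" "sum x V \<ge> card V * a" "(1 - \<epsilon>) * sqrt (card V) \<le> card V * a"
    using flat_obtain[OF assms(1-3) ne] assms by auto
  have n: "?n > 0" using assms ne by (simp add: card_gt_0_iff)
  have a0: "a > 0"
  proof -
    have "(1 - \<epsilon>) / card V > 0" using assms n by simp
    then show ?thesis using x(3,4) by (cases "a = 0") auto
  qed
  have fN: "finite ?N" "?N \<subseteq> V" using assms by (auto simp: nbr_def)
  have cN: "real (card (V - ?N)) = ?n - dg V E u"
    using fN assms by (simp add: dg_def card_Diff_subset card_mono of_nat_diff)
  have "(qmax V E - dg V E u) * a \<le> (qmax V E - dg V E u) * x u"
    using False x(5) assms by (intro mult_left_mono) auto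
  also have "\<dots> = (\<Sum>w\<in>?N. x w)"
    using qmax_eigen[OF assms(1,2) x(1,2) assms(6)] by (simp add: algebra_simps)
  also have "\<dots> = sum x V - (\<Sum>w\<in>V - ?N. x w)"
    using sum.subset_diff[OF fN(2) assms(1), of x] by simp
  also have "\<dots> \<le> sum x V - (?n - dg V E u) * a"
    using sum_bounded_below[of "V - ?N" a x] x(5) by (simp add: cN)
  finally have le: "(qmax V E - dg V E u) * a \<le> sqrt ?n - (?n - dg V E u) * a" using x(7) by linarith
  have "sqrt ?n \<le> (1 + 2 * \<epsilon>) * ((1 - \<epsilon>) * sqrt ?n)"
  proof -
    have "1 \<le> (1 + 2 * \<epsilon>) * (1 - \<epsilon>)"
      using mult_left_mono[OF assms(5), of "2 * \<epsilon>"] assms by (simp add: algebra_simps)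
    then have "1 * sqrt ?n \<le> ((1 + 2 * \<epsilon>) * (1 - \<epsilon>)) * sqrt ?n"
      by (intro mult_right_mono) auto
    then show ?thesis by (simp only: mult.assoc mult_1)
  qed
  also have "\<dots> \<le> (1 + 2 * \<epsilon>) * (?n * a)" using x(9) assms by (intro mult_left_mono) auto
  finally have "(qmax V E - dg V E u) * a \<le> (dg V E u + 2 * \<epsilon> * ?n) * a"
    using le by (simp add: algebra_simps)
  then have "qmax V E - dg V E u \<le> dg V E u + 2 * \<epsilon> * ?n" using a0 by simp
  then show ?thesis by (simp add: algebra_simps)
qed

section \<open>The limiting spectral density\<close>

lemma simple_graph_edgeD:
  assumes "simple_graph G" "{a, b} \<in> edges G"
  shows "a \<in> verts G" "b \<in> verts G" "a \<noteq> b"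
proof -
  obtain c d where "{a, b} = {c, d}" "c \<in> verts G" "d \<in> verts G" "c \<noteq> d"
    using assms unfolding simple_graph_def by blast
  then show "a \<in> verts G" "b \<in> verts G" "a \<noteq> b" by (auto simp: doubleton_eq_iff)
qed

definition embeds :: "'a graph \<Rightarrow> nat set \<Rightarrow> (nat \<Rightarrow> nat \<Rightarrow> bool) \<Rightarrow> bool" where
  "embeds F V E \<longleftrightarrow> (\<exists>f. inj_on f (verts F) \<and> f ` verts F \<subseteq> V \<and>
     (\<forall>u v. {u, v} \<in> edges F \<longrightarrow> E (f u) (f v)))"

lemma embeds_mono: "embeds F U E \<Longrightarrow> U \<subseteq> V \<Longrightarrow> embeds F V E"
  unfolding embeds_def by blast

text \<open>The bound on the degree sum is \<open>ex(n, F) \<le> t\<^sub>r(n) + O(1)\<close>, transported to arbitrary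
  finite vertex sets.\<close>

locale extremal_bound =
  fixes r :: nat and F :: "'a graph" and C :: real and N\<^sub>0 :: nat
  assumes r: "r \<ge> 3" and F: "simple_graph F" and C: "C \<ge> 0"
    and deg_sum_le: "\<And>V E. finite V \<Longrightarrow> sym_irrefl E \<Longrightarrow> \<not> embeds F V E \<Longrightarrow> card V \<ge> N\<^sub>0 \<Longrightarrow>
      deg_sum V E \<le> (1 - 1 / real r) * (real (card V))^2 + C"
begin

definition dens :: real where "dens = 2 * (1 - 1 / real r)"

lemma dens_bounds: "dens \<ge> 4 / 3" "dens \<le> 2"
  using r by (auto simp: dens_def field_simps)

definition free_on :: "nat set \<Rightarrow> (nat \<Rightarrow> nat \<Rightarrow> bool) \<Rightarrow> bool" where
  "free_on V E \<longleftrightarrow> finite V \<and> sym_irrefl E \<and> \<not> embeds F V E"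

lemma free_on_subset: "free_on V E \<Longrightarrow> U \<subseteq> V \<Longrightarrow> free_on U E"
  unfolding free_on_def using embeds_mono finite_subset by blast

lemma phi_le_2:
  assumes "finite V" "sym_irrefl E" "card V \<ge> 2"
  shows "phi V E \<le> 2"
proof -
  have "V \<noteq> {}" using assms by auto
  then show ?thesis using qmax_le[OF assms(1,2)] assms(3) by (simp add: phi_def field_simps)
qed

lemma phi_ge_imp_qmax_ge: "card U \<ge> 2 \<Longrightarrow> phi U E \<ge> b \<Longrightarrow> b * (real (card U) - 1) \<le> qmax U E"
  unfolding phi_def by (subst (asm) pos_le_divide_eq) auto

text \<open>Since \<open>dens\<close> >= 4/3, \<open>flat_subset\<close> applies with c = 1/3. Read
  backwards, its logarithmic gain bounds the shrinkage by the increase of \<open>phi\<close>. That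
  increase is at most 1 because \<open>phi\<close> never exceeds 2, which gives the cruder second
  bound.\<close>

lemma flat_subset_size:
  fixes \<epsilon> :: real
  assumes V: "finite V" "sym_irrefl E" and n: "card V \<ge> 2" and p: "phi V E \<ge> dens" and \<epsilon>: "0 < \<epsilon>" "\<epsilon> \<le> 1"
  obtains U where "U \<subseteq> V" "card U \<ge> 2" "card U = 2 \<or> flat \<epsilon> U E" "phi U E \<ge> phi V E"
    "card U \<ge> card V * exp (- 3 * (phi U E - phi V E) / \<epsilon>)" "card U \<ge> card V * exp (- 3 / \<epsilon>)"
proof -
  obtain U where U: "U \<subseteq> V" "card U \<ge> 2" "card U = 2 \<or> flat \<epsilon> U E"
    and ph: "phi U E \<ge> phi V E + (1 / 3) * \<epsilon> * ln (card V / card U)"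
    using flat_subset[OF V n, of "1 / 3" \<epsilon>] p dens_bounds \<epsilon> by auto
  have m: "real (card U) > 0" using U by simp
  have "card U \<le> card V" using U V by (intro card_mono) auto
  then have "ln (card V / card U) \<ge> 0" using m by (intro ln_ge_zero) auto
  then have "\<epsilon> * ln (card V / card U) \<ge> 0" using \<epsilon> by simp
  then have le: "phi U E \<ge> phi V E" using ph by linarith
  have gen: "card U \<ge> card V * exp (- 3 * t / \<epsilon>)" if "phi U E - phi V E \<le> t" for t
  proof -
    have "\<epsilon> * ln (card V / card U) \<le> 3 * t" using ph that by simp
    then have "ln (card V / card U) \<le> 3 * t / \<epsilon>" using \<epsilon> by (simp add: field_simps)
    then have "exp (ln (card V / card U)) \<le> exp (3 * t / \<epsilon>)" by simp
    moreover have "real (card V) / card U > 0" using m n by simp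
    ultimately have "card V / card U \<le> exp (3 * t / \<epsilon>)" by simp
    then have "real (card V) \<le> card U * exp (3 * t / \<epsilon>)" using m by (simp add: field_simps)
    then have "card V * exp (- 3 * t / \<epsilon>) \<le> card U * exp (3 * t / \<epsilon>) * exp (- 3 * t / \<epsilon>)"
      by (intro mult_right_mono) auto
    also have "\<dots> = card U" by (simp add: exp_minus field_simps)
    finally show ?thesis .
  qed
  have "phi U E - phi V E \<le> 1"
    using phi_le_2[of U E] U V p dens_bounds finite_subset[of U V] by auto
  from gen[OF this] gen[of "phi U E - phi V E"] show ?thesis
    using that[OF U le] by simp
qed

text \<open>Too large a \<open>phi\<close> would pass to a flat subset that still has a constant
  fraction of the vertices. There \<open>flat_qmax_le\<close> and the edge bound give q <= dens m +
  2 C + \<eta> m / 2, which is too small for large m.\<close>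

lemma phi_upper:
  fixes \<eta> :: real
  assumes "\<eta> > 0"
  obtains n\<^sub>1 where "\<And>V E. free_on V E \<Longrightarrow> card V \<ge> n\<^sub>1 \<Longrightarrow> phi V E \<le> dens + \<eta>"
proof -
  define \<epsilon> where "\<epsilon> = min 1 (\<eta> / 4)"
  have \<epsilon>: "0 < \<epsilon>" "\<epsilon> \<le> 1" "\<epsilon> \<le> \<eta> / 4" using assms by (auto simp: \<epsilon>_def)
  \<comment> \<open>The last entry is the size beyond which \<eta> m / 2 <= dens + \<eta> + 2 C
    fails; \<open>n\<^sub>1\<close> allows for the shrinkage by the factor exp (- 3 /
    \<epsilon>).\<close>
  define M where "M = max (real N\<^sub>0) (max 3 ((2 + \<eta> + 2 * C) * 2 / \<eta> + 1))"
  define n\<^sub>1 where "n\<^sub>1 = nat \<lceil>M * exp (3 / \<epsilon>)\<rceil> + 2"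
  show ?thesis
  proof (rule that[of n\<^sub>1], rule ccontr)
    fix V E assume fr: "free_on V E" and n: "card V \<ge> n\<^sub>1" and neg: "\<not> phi V E \<le> dens + \<eta>"
    have V: "finite V" "sym_irrefl E" using fr by (auto simp: free_on_def)
    have n2: "card V \<ge> 2" using n by (simp add: n\<^sub>1_def)
    have p: "phi V E \<ge> dens" using neg assms by linarith
    obtain U where U: "U \<subseteq> V" "card U \<ge> 2" "card U = 2 \<or> flat \<epsilon> U E" "phi U E \<ge> phi V E"
      "card U \<ge> card V * exp (- 3 / \<epsilon>)"
      using flat_subset_size[OF V n2 p \<epsilon>(1,2)] by metis
    have "M * exp (3 / \<epsilon>) \<le> card V" using n unfolding n\<^sub>1_def by linarith
    then have "M * exp (3 / \<epsilon>) * exp (- 3 / \<epsilon>) \<le> card V * exp (- 3 / \<epsilon>)"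
      by (intro mult_right_mono) auto
    moreover have "M * exp (3 / \<epsilon>) * exp (- 3 / \<epsilon>) = M" by (simp add: exp_minus field_simps)
    ultimately have m: "real (card U) \<ge> M" using U(5) by linarith
    let ?m = "real (card U)"
    have m3: "?m \<ge> 3" "?m \<ge> N\<^sub>0" "?m \<ge> (2 + \<eta> + 2 * C) * 2 / \<eta> + 1" using m by (auto simp: M_def)
    have fl: "flat \<epsilon> U E" using U(3) m3 by auto
    have frU: "free_on U E" by (rule free_on_subset[OF fr U(1)])
    then have fU: "finite U" "U \<noteq> {}" using m3 by (auto simp: free_on_def)
    have D: "deg_sum U E \<le> (1 - 1 / r) * ?m^2 + C"
      using frU m3 by (intro deg_sum_le) (auto simp: free_on_def)
    have "(dens + \<eta>) * (?m - 1) \<le> qmax U E"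
      using neg U(4) m3 by (intro phi_ge_imp_qmax_ge) auto
    also have "\<dots> \<le> 2 * deg_sum U E / ?m + 2 * ?m * \<epsilon>"
      by (rule flat_qmax_le[OF fU(1) V(2) fl fU(2)]) (use \<epsilon> in auto)
    also have "2 * deg_sum U E / ?m \<le> 2 * ((1 - 1 / r) * ?m^2 + C) / ?m"
      using D m3 by (intro divide_right_mono) auto
    also have "\<dots> = dens * ?m + 2 * C / ?m"
      using m3 by (simp add: dens_def power2_eq_square add_divide_distrib)
    also have "2 * C / ?m \<le> 2 * C" using C m3 by (simp add: field_simps mult_le_cancel_left1)
    also have "2 * ?m * \<epsilon> \<le> ?m * \<eta> / 2" using mult_left_mono[OF \<epsilon>(3), of ?m] by simp
    finally have "?m * \<eta> / 2 \<le> dens + \<eta> + 2 * C" by (simp add: algebra_simps)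
    then have "?m * \<eta> \<le> (2 + \<eta> + 2 * C) * 2" using dens_bounds by argo
    then have "?m \<le> (2 + \<eta> + 2 * C) * 2 / \<eta>" using assms by (simp add: field_simps)
    then show False using m3 by linarith
  qed
qed

text \<open>Applied to the flat subset itself, \<open>phi_upper\<close> bounds the increase of
  \<open>phi\<close> by \<eta> \<delta> / 3. The finer size bound of \<open>flat_subset_size\<close>
  then shows that the deletion has removed at most an \<eta> fraction of the vertices.\<close>

lemma dense_subset:
  fixes \<epsilon> \<eta> :: real
  assumes \<epsilon>: "0 < \<epsilon>" "\<epsilon> \<le> 1 / 2" and \<eta>: "0 < \<eta>"
  obtains n\<^sub>1 where "\<And>V E. free_on V E \<Longrightarrow> card V \<ge> n\<^sub>1 \<Longrightarrow> phi V E \<ge> dens \<Longrightarrow>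
    \<exists>U\<subseteq>V. card U \<ge> (1 - \<eta>) * card V \<and> (\<forall>u\<in>U. dg U E u \<ge> (1 - 1 / r - \<epsilon>) * card U)"
proof -
  define \<delta> where "\<delta> = \<epsilon> / 2"
  have \<delta>: "0 < \<delta>" "\<delta> \<le> 1 / 2" "\<delta> \<le> 1" using \<epsilon> by (auto simp: \<delta>_def)
  have "\<eta> * \<delta> / 3 > 0" using \<eta> \<delta> by simp
  then obtain n\<^sub>2 where n\<^sub>2: "\<And>V E. free_on V E \<Longrightarrow> card V \<ge> n\<^sub>2 \<Longrightarrow> phi V E \<le> dens + \<eta> * \<delta> / 3"
    using phi_upper by metis
  define M where "M = max (real n\<^sub>2) (max 3 (1 / \<delta>))"
  define n\<^sub>1 where "n\<^sub>1 = nat \<lceil>M * exp (3 / \<delta>)\<rceil> + 2"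
  show ?thesis
  proof (rule that[of n\<^sub>1])
    fix V E assume fr: "free_on V E" and n: "card V \<ge> n\<^sub>1" and p: "phi V E \<ge> dens"
    have V: "finite V" "sym_irrefl E" using fr by (auto simp: free_on_def)
    have n2: "card V \<ge> 2" using n by (simp add: n\<^sub>1_def)
    obtain U where U: "U \<subseteq> V" "card U \<ge> 2" "card U = 2 \<or> flat \<delta> U E" "phi U E \<ge> phi V E"
      "card U \<ge> card V * exp (- 3 * (phi U E - phi V E) / \<delta>)" "card U \<ge> card V * exp (- 3 / \<delta>)"
      using flat_subset_size[OF V n2 p \<delta>(1,3)] by metis
    have "M * exp (3 / \<delta>) \<le> card V" using n unfolding n\<^sub>1_def by linarith
    then have "M * exp (3 / \<delta>) * exp (- 3 / \<delta>) \<le> card V * exp (- 3 / \<delta>)"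
      by (intro mult_right_mono) auto
    moreover have "M * exp (3 / \<delta>) * exp (- 3 / \<delta>) = M" by (simp add: exp_minus field_simps)
    ultimately have m: "real (card U) \<ge> M" using U(6) by linarith
    let ?m = "real (card U)"
    have m3: "?m \<ge> 3" "?m \<ge> n\<^sub>2" "?m \<ge> 1 / \<delta>" using m by (auto simp: M_def)
    have fl: "flat \<delta> U E" using U(3) m3 by auto
    have frU: "free_on U E" by (rule free_on_subset[OF fr U(1)])
    then have fU: "finite U" "sym_irrefl E" using m3 by (auto simp: free_on_def)
    have "phi U E \<le> dens + \<eta> * \<delta> / 3" using n\<^sub>2[OF frU] m3 by simp
    then have "3 * (phi U E - phi V E) / \<delta> \<le> \<eta>" using p \<delta> by (simp add: field_simps)
    moreover have "- 3 * (phi U E - phi V E) / \<delta> = - (3 * (phi U E - phi V E) / \<delta>)"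
      by (simp only: minus_divide_left mult_minus_left)
    ultimately have "exp (- \<eta>) \<le> exp (- 3 * (phi U E - phi V E) / \<delta>)" by simp
    then have "1 - \<eta> \<le> exp (- 3 * (phi U E - phi V E) / \<delta>)"
      using exp_ge_add_one_self[of "- \<eta>"] by linarith
    then have "card V * (1 - \<eta>) \<le> card V * exp (- 3 * (phi U E - phi V E) / \<delta>)"
      by (intro mult_left_mono) auto
    then have size: "card U \<ge> (1 - \<eta>) * card V" using U(5) by (simp add: mult.commute)
    have "dg U E u \<ge> (1 - 1 / r - \<epsilon>) * card U" if u: "u \<in> U" for u
    proof -
      have "dens * (?m - 1) \<le> qmax U E"
        using p U(4) m3 by (intro phi_ge_imp_qmax_ge) auto
      moreover have "dg U E u \<ge> qmax U E / 2 - \<delta> * ?m"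
        by (rule flat_min_degree[OF fU fl _ _ u]) (use \<delta> in auto)
      moreover have "1 \<le> \<delta> * ?m" using m3 \<delta> by (simp add: field_simps)
      moreover have "dens * (?m - 1) = dens * ?m - dens" by (simp only: right_diff_distrib mult_1_right)
      then have "dens * ?m - 2 \<le> dens * (?m - 1)" using dens_bounds by linarith
      ultimately have "dg U E u \<ge> dens * ?m / 2 - 2 * \<delta> * ?m" by linarith
      moreover have "(1 - 1 / r - \<epsilon>) * ?m = dens * ?m / 2 - 2 * \<delta> * ?m"
        by (simp add: \<delta>_def dens_def algebra_simps)
      ultimately show ?thesis by simp
    qed
    then show "\<exists>U\<subseteq>V. card U \<ge> (1 - \<eta>) * card V \<and> (\<forall>u\<in>U. dg U E u \<ge> (1 - 1 / r - \<epsilon>) * card U)"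
      using U(1) size by blast
  qed
qed

end

section \<open>Embedding through complete multipartite subgraphs\<close>

definition cls :: "(nat \<Rightarrow> nat) \<Rightarrow> nat set \<Rightarrow> nat \<Rightarrow> nat set" where
  "cls l A i = {v \<in> A. l v = i}"

definition cross_complete :: "(nat \<Rightarrow> nat \<Rightarrow> bool) \<Rightarrow> (nat \<Rightarrow> nat) \<Rightarrow> nat set \<Rightarrow> bool" where
  "cross_complete E l P \<longleftrightarrow> (\<forall>u\<in>P. \<forall>w\<in>P. l u \<noteq> l w \<longrightarrow> E u w)"

lemma finite_cls: "finite A \<Longrightarrow> finite (cls l A i)"
  by (simp add: cls_def)

lemma card_classes:
  assumes "finite A" "\<And>v. v \<in> A \<Longrightarrow> l v < r"
  shows "card A = (\<Sum>i<r. card (cls l A i))"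
proof -
  have "l ` A \<subseteq> {..<r}" using assms(2) by auto
  from sum.group[OF assms(1) _ this, of "\<lambda>_. 1::nat"] show ?thesis by (simp add: cls_def)
qed

text \<open>Greedy completion: a new vertex for a deficient class i must avoid A and the
  non-neighbours of the vertices of A outside class i. As A has at most r N vertices, this excludes
  at most r N (\<mu> + 1) candidates, fewer than Q offers in class i.\<close>

lemma extend_cross_complete:
  fixes \<mu> :: real and r N :: nat
  assumes E: "sym_irrefl E" and fin: "finite A" "finite Q"
    and lab: "\<And>v. v \<in> A \<union> Q \<Longrightarrow> l v < r" and cc: "cross_complete E l A"
    and le: "\<And>i. i < r \<Longrightarrow> card (cls l A i) \<le> N"
    and miss: "\<And>s i. s \<in> A \<union> Q \<Longrightarrow> i < r \<Longrightarrow> i \<noteq> l s \<Longrightarrow> card {w \<in> cls l Q i. \<not> E s w} \<le> \<mu>"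
    and big: "\<And>i. i < r \<Longrightarrow> card (cls l Q i) > r * N * (\<mu> + 1)" and \<mu>: "\<mu> \<ge> 0"
  obtains P where "A \<subseteq> P" "P \<subseteq> A \<union> Q" "cross_complete E l P" "\<And>i. i < r \<Longrightarrow> card (cls l P i) = N"
proof -
  have "\<exists>P. A \<subseteq> P \<and> P \<subseteq> A \<union> Q \<and> cross_complete E l P \<and> (\<forall>i<r. card (cls l P i) = N)"
    using fin(1) lab cc le miss
  proof (induction "r * N - card A" arbitrary: A rule: less_induct)
    case less
    have cA: "card A = (\<Sum>i<r. card (cls l A i))"
      using less.prems by (intro card_classes) auto
    also have "\<dots> \<le> (\<Sum>i<r. N)" using less.prems by (intro sum_mono) auto
    finally have cA': "card A \<le> r * N" by simp
    show ?case
    proof (cases "\<forall>i<r. card (cls l A i) = N")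
      case True
      then show ?thesis using less.prems by (intro exI[of _ A]) auto
    next
      case False
      then obtain i where i: "i < r" "card (cls l A i) < N"
        using less.prems(4) by (metis le_neq_implies_less)
      have "(\<Sum>i<r. card (cls l A i)) < (\<Sum>i<r. N)"
        by (rule sum_strict_mono_ex1) (use less.prems i in auto)
      then have cA2: "card A < r * N" using cA by simp
      define B where "B = A \<union> (\<Union>s\<in>{s \<in> A. l s \<noteq> i}. {w \<in> cls l Q i. \<not> E s w})"
      have fB: "finite B" unfolding B_def using less.prems fin finite_cls by auto
      have "real (card B) \<le> real (card A) + real (\<Sum>s\<in>{s \<in> A. l s \<noteq> i}. card {w \<in> cls l Q i. \<not> E s w})"
      proof -
        have "card B \<le> card A + card (\<Union>s\<in>{s \<in> A. l s \<noteq> i}. {w \<in> cls l Q i. \<not> E s w})"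
          unfolding B_def by (rule card_Un_le)
        also have "\<dots> \<le> card A + (\<Sum>s\<in>{s \<in> A. l s \<noteq> i}. card {w \<in> cls l Q i. \<not> E s w})"
          using less.prems by (intro add_left_mono card_UN_le) auto
        finally show ?thesis by linarith
      qed
      also have "real (\<Sum>s\<in>{s \<in> A. l s \<noteq> i}. card {w \<in> cls l Q i. \<not> E s w}) \<le> (\<Sum>s\<in>{s \<in> A. l s \<noteq> i}. \<mu>)"
        unfolding of_nat_sum using less.prems i by (intro sum_mono) auto
      also have "\<dots> \<le> card A * \<mu>"
        using less.prems \<mu> by (auto intro!: mult_right_mono card_mono)
      also have "card A + card A * \<mu> = card A * (\<mu> + 1)" by (simp add: algebra_simps)
      also have "\<dots> \<le> (r * N) * (\<mu> + 1)"
        using cA' \<mu> by (intro mult_right_mono) (simp_all flip: of_nat_mult)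
      also have "\<dots> < card (cls l Q i)" using big[OF i(1)] by simp
      finally have "card B < card (cls l Q i)" by simp
      then have "\<not> cls l Q i \<subseteq> B" using card_mono[OF fB] by (meson not_le)
      then obtain w where w: "w \<in> cls l Q i" "w \<notin> B" by auto
      then have wQ: "w \<in> Q" "l w = i" "w \<notin> A" and wE: "\<And>s. s \<in> A \<Longrightarrow> l s \<noteq> i \<Longrightarrow> E s w"
        by (auto simp: B_def cls_def)
      let ?A = "insert w A"
      have "\<exists>P. ?A \<subseteq> P \<and> P \<subseteq> ?A \<union> Q \<and> cross_complete E l P \<and> (\<forall>i<r. card (cls l P i) = N)"
      proof (rule less.hyps)
        show "r * N - card ?A < r * N - card A" using wQ cA2 less.prems(1) by simp
        show "cross_complete E l ?A"
          using less.prems(3) wE wQ E unfolding cross_complete_def sym_irrefl_def by (auto simp: eq_commute)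
        show "card (cls l ?A j) \<le> N" if "j < r" for j
        proof (cases "j = i")
          case True
          then have "cls l ?A j = insert w (cls l A i)" using wQ by (auto simp: cls_def)
          then show ?thesis using i less.prems(1) by (simp add: card_insert_if finite_cls)
        next
          case False
          then have "cls l ?A j = cls l A j" using wQ by (auto simp: cls_def)
          then show ?thesis using less.prems(4) that by simp
        qed
      qed (use less.prems wQ in auto)
      then obtain P where P: "?A \<subseteq> P" "P \<subseteq> ?A \<union> Q" "cross_complete E l P" "\<forall>i<r. card (cls l P i) = N"
        by blast
      then show ?thesis using wQ by (intro exI[of _ P]) auto
    qed
  qed
  then show ?thesis using that by blast
qed

context extremal_bound
begin

text \<open>An internal degree sum of \<open>K\<^sub>0\<close> already exceeds C. Classes of size
  \<open>N\<^sub>1\<close> have room for a star with \<open>K\<^sub>0\<close> leaves and are large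
  enough for the edge bound.\<close>

definition K\<^sub>0 :: nat where "K\<^sub>0 = nat \<lceil>C\<rceil> + 1"
definition N\<^sub>1 :: nat where "N\<^sub>1 = K\<^sub>0 + 1 + N\<^sub>0"

lemma K\<^sub>0_gt: "K\<^sub>0 > C"
  unfolding K\<^sub>0_def by linarith

text \<open>Complete A to a balanced complete r-partite P. Its degree sum is at least (1 - 1/r)
  |P|^2 plus the internal degrees of A, so the edge bound leaves only C for the latter. Here Q is
  the reservoir for the completion, and A may overlap it.\<close>

lemma internal_edges_le:
  fixes \<mu> :: real
  assumes fr: "free_on V E" and sub: "A \<subseteq> V" "Q \<subseteq> V"
    and lab: "\<And>v. v \<in> A \<union> Q \<Longrightarrow> l v < r" and cc: "cross_complete E l A"
    and le: "\<And>i. i < r \<Longrightarrow> card (cls l A i) \<le> N" and N: "N \<ge> N\<^sub>0"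
    and miss: "\<And>s i. s \<in> A \<union> Q \<Longrightarrow> i < r \<Longrightarrow> i \<noteq> l s \<Longrightarrow> card {w \<in> cls l Q i. \<not> E s w} \<le> \<mu>"
    and big: "\<And>i. i < r \<Longrightarrow> card (cls l Q i) > r * N * (\<mu> + 1)" and \<mu>: "\<mu> \<ge> 0"
  shows "(\<Sum>v\<in>A. card {w \<in> A. E v w \<and> l w = l v}) \<le> C"
proof -
  have V: "finite V" "sym_irrefl E" using fr by (auto simp: free_on_def)
  have fin: "finite A" "finite Q" using V sub finite_subset by auto
  obtain P where P: "A \<subseteq> P" "P \<subseteq> A \<union> Q" "cross_complete E l P" "\<And>i. i < r \<Longrightarrow> card (cls l P i) = N"
    using extend_cross_complete[OF V(2) fin lab cc le miss big \<mu>] by blast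
  have fP: "finite P" using finite_subset[OF P(2)] fin by auto
  have labP: "l v < r" if "v \<in> P" for v using that P lab by auto
  have cP: "card P = r * N" using card_classes[OF fP labP] P(4) by simp
  have "P \<subseteq> V" using P(2) sub by blast
  then have frP: "free_on P E" by (rule free_on_subset[OF fr])
  have "card P \<ge> N\<^sub>0"
  proof -
    have "1 * N \<le> r * N" using r by (intro mult_right_mono) auto
    then have "N\<^sub>0 \<le> r * N" using N by linarith
    then show ?thesis using cP by simp
  qed
  then have "deg_sum P E \<le> (1 - 1 / r) * (real (card P))^2 + C"
    using frP deg_sum_le[of P E] by (simp add: free_on_def)
  also have "(1 - 1 / r) * (real (card P))^2 = real r * N * (real r - 1) * N"
    using r unfolding cP by (simp add: field_simps power2_eq_square)
  finally have D: "deg_sum P E \<le> real r * N * (real r - 1) * N + C" .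
  have "dg P E v \<ge> (real r - 1) * N + card {w \<in> A. E v w \<and> l w = l v}" if v: "v \<in> P" for v
  proof -
    have "card (P - cls l P (l v)) = r * N - N"
      using P(4)[OF labP[OF v]] fP cP by (subst card_Diff_subset) (auto simp: cls_def)
    also have "r * N - N = (r - 1) * N" by (simp add: diff_mult_distrib)
    finally have c1: "card (P - cls l P (l v)) = (r - 1) * N" .
    have "card (P - cls l P (l v)) + card {w \<in> A. E v w \<and> l w = l v}
      = card ((P - cls l P (l v)) \<union> {w \<in> A. E v w \<and> l w = l v})"
      using fP fin P(1) by (intro card_Un_disjoint[symmetric]) (auto simp: cls_def)
    also have "\<dots> \<le> card (nbr P E v)"
    proof (rule card_mono)
      show "(P - cls l P (l v)) \<union> {w \<in> A. E v w \<and> l w = l v} \<subseteq> nbr P E v"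
        using P(1,3) v by (auto simp: nbr_def cls_def cross_complete_def)
    qed (simp add: nbr_def fP)
    finally have "(r - 1) * N + card {w \<in> A. E v w \<and> l w = l v} \<le> card (nbr P E v)" using c1 by simp
    then have "real ((r - 1) * N + card {w \<in> A. E v w \<and> l w = l v}) \<le> dg P E v"
      unfolding dg_def by (simp only: of_nat_le_iff)
    then show ?thesis using r by (simp add: of_nat_diff)
  qed
  then have "(\<Sum>v\<in>P. (real r - 1) * N + card {w \<in> A. E v w \<and> l w = l v}) \<le> deg_sum P E"
    unfolding deg_sum_def by (intro sum_mono)
  moreover have "(\<Sum>v\<in>P. (real r - 1) * N + card {w \<in> A. E v w \<and> l w = l v})
     = real r * N * (real r - 1) * N + (\<Sum>v\<in>P. card {w \<in> A. E v w \<and> l w = l v})"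
    by (simp add: sum.distrib cP)
  moreover have "(\<Sum>v\<in>A. card {w \<in> A. E v w \<and> l w = l v}) \<le> (\<Sum>v\<in>P. card {w \<in> A. E v w \<and> l w = l v})"
    using P(1) fP by (intro sum_mono2) auto
  ultimately show ?thesis using D by linarith
qed

text \<open>A star with \<open>K\<^sub>0\<close> leaves inside one class violates
  \<open>internal_edges_le\<close> by the degree of its centre alone; having a single label, it is
  cross-complete vacuously.\<close>

lemma monochromatic_star_bound:
  fixes \<mu> :: real
  assumes fr: "free_on V E" and sub: "insert v L \<subseteq> V" "Q \<subseteq> V"
    and lab: "\<And>w. w \<in> Q \<Longrightarrow> l w < r" "l v < r"
    and L: "\<And>w. w \<in> L \<Longrightarrow> E v w \<and> l w = l v"
    and miss: "\<And>s i. s \<in> insert v L \<union> Q \<Longrightarrow> i < r \<Longrightarrow> i \<noteq> l s \<Longrightarrow> card {w \<in> cls l Q i. \<not> E s w} \<le> \<mu>"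
    and big: "\<And>i. i < r \<Longrightarrow> card (cls l Q i) > r * N\<^sub>1 * (\<mu> + 1)" and \<mu>: "\<mu> \<ge> 0"
  shows "card L < K\<^sub>0"
proof (rule ccontr)
  assume "\<not> card L < K\<^sub>0"
  then have "K\<^sub>0 \<le> card L" by simp
  then obtain L' where L': "L' \<subseteq> L" "card L' = K\<^sub>0" "finite L'"
    by (rule obtain_subset_with_card_n)
  let ?A = "insert v L'"
  have mono: "l w = l v" if "w \<in> ?A" for w using that L L' by auto
  have "(\<Sum>u\<in>?A. card {w \<in> ?A. E u w \<and> l w = l u}) \<le> C"
  proof (rule internal_edges_le[OF fr _ sub(2)])
    show "card (cls l ?A i) \<le> N\<^sub>1" for i
    proof -
      have "card (cls l ?A i) \<le> card ?A" using L' by (intro card_mono) (auto simp: cls_def)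
      also have "\<dots> \<le> Suc K\<^sub>0" using card_insert_le_m1[of "Suc K\<^sub>0" L' v] L' by simp
      finally show ?thesis by (simp add: N\<^sub>1_def)
    qed
    show "cross_complete E l ?A" unfolding cross_complete_def
    proof (intro ballI impI)
      fix u w assume "u \<in> ?A" "w \<in> ?A" "l u \<noteq> l w"
      with mono[of u] mono[of w] show "E u w" by metis
    qed
    show "?A \<subseteq> V" using sub L' by auto
    show "l w < r" if "w \<in> ?A \<union> Q" for w
    proof (cases "w \<in> ?A")
      case True
      then show ?thesis using mono[of w] lab(2) by presburger
    next
      case False
      then show ?thesis using that lab(1) by blast
    qed
    show "N\<^sub>1 \<ge> N\<^sub>0" by (simp add: N\<^sub>1_def)
    show "card {w \<in> cls l Q i. \<not> E s w} \<le> \<mu>" if "s \<in> ?A \<union> Q" "i < r" "i \<noteq> l s" for s i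
      using that L' by (intro miss) auto
    show "card (cls l Q i) > r * N\<^sub>1 * (\<mu> + 1)" if "i < r" for i using big that by simp
  qed (rule \<mu>)
  moreover have "K\<^sub>0 \<le> card {w \<in> ?A. E v w \<and> l w = l v}"
    unfolding L'(2)[symmetric] using L L' by (intro card_mono) auto
  moreover have "card {w \<in> ?A. E v w \<and> l w = l v} \<le> (\<Sum>u\<in>?A. card {w \<in> ?A. E u w \<and> l w = l u})"
    using L' by (intro member_le_sum[of v ?A "\<lambda>u. card {w \<in> ?A. E u w \<and> l w = l u}"]) auto
  ultimately show False using K\<^sub>0_gt by linarith
qed

text \<open>A vertex with many neighbours in every class could be counted into any of them: among
  its neighbours it is complete to the other classes and the centre of a large star in its
  own.\<close>

lemma poor_class_exists:
  fixes \<mu> :: real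
  assumes fr: "free_on V E" and v: "v \<in> V" and sub: "Q \<subseteq> V"
    and lab: "\<And>w. w \<in> Q \<Longrightarrow> l w < r"
    and miss: "\<And>s i. s \<in> Q \<Longrightarrow> i < r \<Longrightarrow> i \<noteq> l s \<Longrightarrow> card {w \<in> cls l Q i. \<not> E s w} \<le> \<mu>"
    and \<mu>: "\<mu> \<ge> 0"
  shows "\<exists>i<r. card {w \<in> cls l Q i. E v w} \<le> r * N\<^sub>1 * (\<mu> + 1)"
proof (rule ccontr)
  assume neg: "\<not> ?thesis"
  have E: "sym_irrefl E" and fQ: "finite Q" using fr sub finite_subset by (auto simp: free_on_def)
  define Q' where "Q' = {w \<in> Q. E v w}"
  \<comment> \<open>Class 0 is an arbitrary choice; the override matters because v may already carry
    another label.\<close>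
  define l' where "l' = l(v := 0)"
  have vQ: "v \<notin> Q'" using E by (auto simp: Q'_def sym_irrefl_def)
  have c: "cls l' Q' i = {w \<in> cls l Q i. E v w}" for i
    using vQ by (auto simp: cls_def Q'_def l'_def)
  have "card (cls l' Q' 0) < K\<^sub>0"
  proof (rule monochromatic_star_bound[OF fr, where v = v and l = l' and \<mu> = \<mu> and Q = Q'])
    show "insert v (cls l' Q' 0) \<subseteq> V" "Q' \<subseteq> V" using v sub by (auto simp: cls_def Q'_def)
    show "l' w < r" if "w \<in> Q'" for w using that lab vQ by (auto simp: l'_def Q'_def)
    show "l' v < r" using r by (simp add: l'_def)
    show "E v w \<and> l' w = l' v" if "w \<in> cls l' Q' 0" for w
      using that by (auto simp: cls_def l'_def Q'_def)
    show "r * N\<^sub>1 * (\<mu> + 1) < card (cls l' Q' i)" if "i < r" for i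
      using neg that unfolding c by (simp add: not_le)
    show "card {w \<in> cls l' Q' i. \<not> E s w} \<le> \<mu>"
      if "s \<in> insert v (cls l' Q' 0) \<union> Q'" "i < r" "i \<noteq> l' s" for s i
    proof (cases "s = v")
      case True
      then have e: "{w \<in> cls l' Q' i. \<not> E s w} = {}" by (auto simp: cls_def Q'_def)
      show ?thesis unfolding e using \<mu> by simp
    next
      case False
      then have s: "s \<in> Q" "l' s = l s" using that by (auto simp: cls_def Q'_def l'_def)
      have "card {w \<in> cls l' Q' i. \<not> E s w} \<le> card {w \<in> cls l Q i. \<not> E s w}"
        unfolding c using fQ by (intro card_mono) (auto simp: cls_def)
      moreover have "card {w \<in> cls l Q i. \<not> E s w} \<le> \<mu>" using miss s that by auto
      ultimately show ?thesis by linarith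
    qed
  qed (rule \<mu>)
  moreover have "card (cls l' Q' 0) \<ge> K\<^sub>0"
  proof -
    have "card (cls l' Q' 0) > r * N\<^sub>1 * (\<mu> + 1)"
      using neg r unfolding c by (auto simp: not_le)
    moreover have "real (r * N\<^sub>1) * (\<mu> + 1) \<ge> real (r * N\<^sub>1) * 1"
      using \<mu> by (intro mult_left_mono) auto
    moreover have "r * N\<^sub>1 \<ge> 1 * N\<^sub>1" using r by (intro mult_right_mono) auto
    moreover have "N\<^sub>1 \<ge> K\<^sub>0" by (simp add: N\<^sub>1_def)
    ultimately show ?thesis by linarith
  qed
  ultimately show False by simp
qed

end

section \<open>Stability from minimum degree\<close>

lemma pigeonhole_fibre:
  assumes "finite W" "finite S" "g ` W \<subseteq> S" "card W > t * card S"
  obtains s where "s \<in> S" "card {v \<in> W. g v = s} > t"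
proof -
  have "\<exists>s\<in>S. card {v \<in> W. g v = s} > t"
  proof (rule ccontr)
    assume "\<not> ?thesis"
    then have "(\<Sum>s\<in>S. card {v \<in> W. g v = s}) \<le> (\<Sum>s\<in>S. t)" by (intro sum_mono) (auto simp: not_less)
    moreover have "(\<Sum>s\<in>S. card {v \<in> W. g v = s}) = card W"
      using sum.group[OF assms(1-3), of "\<lambda>_. 1::nat"] by simp
    ultimately show False using assms(4) by (simp add: mult.commute)
  qed
  then show ?thesis using that by blast
qed

lemma sum_dg_swap:
  assumes "finite U" "sym_irrefl E" "H \<subseteq> U"
  shows "(\<Sum>w\<in>H. dg U E w) = (\<Sum>v\<in>U. dg H E v)"
proof -
  have fH: "finite H" using assms finite_subset by blast
  have s: "of_bool (E u v) = (of_bool (E v u) :: real)" for u v using assms by (auto simp: sym_irrefl_def)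
  have "(\<Sum>w\<in>H. dg U E w) = (\<Sum>w\<in>H. \<Sum>v\<in>U. of_bool (E w v))" using assms by (simp add: dg_eq_sum)
  also have "\<dots> = (\<Sum>v\<in>U. \<Sum>w\<in>H. of_bool (E v w))" by (subst sum.swap) (simp add: s)
  finally show ?thesis using fH by (simp add: dg_eq_sum)
qed

lemma dg_classes:
  assumes "finite H" "\<And>v. v \<in> H \<Longrightarrow> l v < s"
  shows "dg H E v = (\<Sum>i<s. real (card {w \<in> cls l H i. E v w}))"
proof -
  have "cls l (nbr H E v) i = {w \<in> cls l H i. E v w}" for i by (auto simp: cls_def nbr_def)
  moreover have "card (nbr H E v) = (\<Sum>i<s. card (cls l (nbr H E v) i))"
    using assms by (intro card_classes) (auto simp: nbr_def)
  ultimately show ?thesis by (simp add: dg_def)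
qed

lemma dg_le_poor_class:
  assumes "finite H" "\<And>v. v \<in> H \<Longrightarrow> l v < s" "\<And>i. i < s \<Longrightarrow> card (cls l H i) = T"
    and "j < s" "card {w \<in> cls l H j. E v w} \<le> b"
  shows "dg H E v \<le> (real s - 1) * T + b"
proof -
  have "dg H E v = (\<Sum>i<s. real (card {w \<in> cls l H i. E v w}))" by (rule dg_classes[OF assms(1,2)])
  also have "\<dots> = real (card {w \<in> cls l H j. E v w}) + (\<Sum>i\<in>{..<s} - {j}. real (card {w \<in> cls l H i. E v w}))"
    using assms(4) by (subst sum.remove[of _ j]) auto
  also have "(\<Sum>i\<in>{..<s} - {j}. real (card {w \<in> cls l H i. E v w})) \<le> (\<Sum>i\<in>{..<s} - {j}. real T)"
  proof (intro sum_mono of_nat_mono)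
    fix i assume "i \<in> {..<s} - {j}"
    then show "card {w \<in> cls l H i. E v w} \<le> T"
      using assms(3)[of i] card_mono[of "cls l H i" "{w \<in> cls l H i. E v w}"] assms(1) by (auto simp: finite_cls)
  qed
  also have "(\<Sum>i\<in>{..<s} - {j}. real T) = (real s - 1) * T"
    using assms(4) by (simp add: of_nat_diff)
  finally show ?thesis using assms(5) by linarith
qed

context extremal_bound
begin

text \<open>The induction of the Erdos-Stone theorem in its minimum-degree form: s classes of a
  larger size T are found first, and many vertices see at least t vertices of each of them. For s <
  r the degree condition suffices, because s (1/r + 1/(2 r^2)) <= 1 - 1/(2 r).\<close>

lemma complete_multipartite_exists:
  assumes "1 \<le> s" "s \<le> r"
  shows "\<exists>m\<^sub>0. \<forall>U E. finite U \<and> sym_irrefl E \<and> card U \<ge> m\<^sub>0 \<and>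
      (\<forall>u\<in>U. dg U E u \<ge> (1 - 1 / r - 1 / (2 * r^2)) * card U) \<longrightarrow>
      (\<exists>H l. H \<subseteq> U \<and> (\<forall>v\<in>H. l v < s) \<and> (\<forall>i<s. card (cls l H i) = t) \<and> cross_complete E l H)"
  using assms
proof (induction s arbitrary: t rule: dec_induct)
  case base
  show ?case
  proof (intro exI[of _ t] allI impI)
    fix U :: "nat set" and E :: "nat \<Rightarrow> nat \<Rightarrow> bool"
    assume a: "finite U \<and> sym_irrefl E \<and> card U \<ge> t \<and>
      (\<forall>u\<in>U. dg U E u \<ge> (1 - 1 / r - 1 / (2 * r^2)) * card U)"
    then obtain H where "H \<subseteq> U" "card H = t" using obtain_subset_with_card_n[of t U] by metis
    then show "\<exists>H l. H \<subseteq> U \<and> (\<forall>v\<in>H. l v < 1) \<and> (\<forall>i<1. card (cls l H i) = t) \<and> cross_complete E l H"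
      by (intro exI[of _ H] exI[of _ "\<lambda>_. 0"]) (auto simp: cls_def cross_complete_def)
  qed
next
  case (step s)
  \<comment> \<open>Then T / (2 r) = 2 (t + 1), so the average number of neighbours in H exceeds (s
    - 1) T + t by at least 1.\<close>
  define T where "T = 4 * r * (t + 1)"
  obtain m\<^sub>1 where m\<^sub>1': "\<forall>U E. finite U \<and> sym_irrefl E \<and> card U \<ge> m\<^sub>1 \<and>
      (\<forall>u\<in>U. dg U E u \<ge> (1 - 1 / r - 1 / (2 * r^2)) * card U) \<longrightarrow>
      (\<exists>H l. H \<subseteq> U \<and> (\<forall>v\<in>H. l v < s) \<and> (\<forall>i<s. card (cls l H i) = T) \<and> cross_complete E l H)"
    using step.IH[where t = T, OF Suc_leD[OF step.prems]] by (rule exE)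
  have m\<^sub>1: "\<exists>H l. H \<subseteq> U \<and> (\<forall>v\<in>H. l v < s) \<and> (\<forall>i<s. card (cls l H i) = T) \<and> cross_complete E l H"
    if "finite U" "sym_irrefl E" "card U \<ge> m\<^sub>1"
      "\<forall>u\<in>U. dg U E u \<ge> (1 - 1 / r - 1 / (2 * r^2)) * card U" for U E
    by (rule m\<^sub>1'[THEN spec, THEN spec, THEN mp]) (intro conjI that)
  define m\<^sub>2 where "m\<^sub>2 = max m\<^sub>1 (s * T * (t * 2 ^ (s * T) + s * T + 1))"
  show ?case
  proof (intro exI[of _ m\<^sub>2] allI impI)
    fix U :: "nat set" and E :: "nat \<Rightarrow> nat \<Rightarrow> bool"
    assume a: "finite U \<and> sym_irrefl E \<and> card U \<ge> m\<^sub>2 \<and>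
      (\<forall>u\<in>U. dg U E u \<ge> (1 - 1 / r - 1 / (2 * r^2)) * card U)"
    then have U: "finite U" "sym_irrefl E" "card U \<ge> m\<^sub>1" "card U \<ge> s * T * (t * 2 ^ (s * T) + s * T + 1)"
      and deg: "\<And>u. u \<in> U \<Longrightarrow> dg U E u \<ge> (1 - 1 / r - 1 / (2 * r^2)) * card U"
      by (auto simp: m\<^sub>2_def)
    obtain H l where H: "H \<subseteq> U" "\<And>v. v \<in> H \<Longrightarrow> l v < s" "\<And>i. i < s \<Longrightarrow> card (cls l H i) = T"
      "cross_complete E l H"
      using m\<^sub>1[OF U(1-3)] deg by blast
    have fH: "finite H" by (rule finite_subset[OF H(1) U(1)])
    have cH: "card H = s * T" using card_classes[OF fH H(2)] H(3) by simp
    \<comment> \<open>A vertex outside W has at most (s - 1) T + t neighbours in H, so double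
      counting the edges between H and U makes W large.\<close>
    define W where "W = {v \<in> U. \<forall>i<s. card {w \<in> cls l H i. E v w} \<ge> t}"
    have fW: "finite W" "W \<subseteq> U" using U by (auto simp: W_def)
    let ?m = "real (card U)"
    have sr: "1 \<le> s" "real s + 1 \<le> r" using step by auto
    have Tpos: "T > 0" using r by (simp add: T_def)
    have "real (s * T) * ((1 - 1 / r - 1 / (2 * r^2)) * ?m) \<le> (\<Sum>w\<in>H. dg U E w)"
      using sum_bounded_below[of H "(1 - 1 / r - 1 / (2 * r^2)) * ?m" "dg U E"] deg H cH by auto
    also have "\<dots> = (\<Sum>v\<in>U. dg H E v)" by (rule sum_dg_swap[OF U(1,2) H(1)])
    also have "\<dots> \<le> (\<Sum>v\<in>U. (if v \<in> W then real (s * T) else 0) + ((real s - 1) * T + t))"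
    proof (rule sum_mono)
      fix v assume v: "v \<in> U"
      have p: "(real s - 1) * T + t \<ge> 0" using sr by simp
      show "dg H E v \<le> (if v \<in> W then real (s * T) else 0) + ((real s - 1) * T + t)"
      proof (cases "v \<in> W")
        case True
        have "card (nbr H E v) \<le> card H" using fH by (intro card_mono) (auto simp: nbr_def)
        then have "dg H E v \<le> real (s * T)" unfolding dg_def cH of_nat_le_iff .
        then show ?thesis using True p by simp
      next
        case False
        then obtain j where "j < s" "card {w \<in> cls l H j. E v w} < t" using v by (auto simp: W_def not_le)
        then show ?thesis using dg_le_poor_class[OF fH H(2,3), of j E v t] False by simp
      qed
    qed
    also have "\<dots> = card W * real (s * T) + ?m * ((real s - 1) * T + t)"
      using U fW by (simp add: sum.distrib sum.If_cases Int_absorb1)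
    finally have main: "?m * (real (s * T) * (1 - 1 / r - 1 / (2 * r^2)) - (real s - 1) * T - t) \<le> card W * real (s * T)"
      by (simp add: algebra_simps)
    have "real (s * T) * (1 - 1 / r - 1 / (2 * r^2)) - (real s - 1) * T - t \<ge> 1"
    proof -
      have "real s * (1 / r + 1 / (2 * r^2)) \<le> (real r - 1) * (1 / r + 1 / (2 * r^2))"
        using sr by (intro mult_right_mono) auto
      also have "\<dots> = 1 - 1 / (2 * r) - 1 / (2 * r^2)"
        using r by (simp add: field_simps power2_eq_square)
      also have "\<dots> \<le> 1 - 1 / (2 * r)" by simp
      finally have "T * (1 - real s * (1 / r + 1 / (2 * r^2))) \<ge> T * (1 / (2 * r))"
        by (intro mult_left_mono) auto
      moreover have "T * (1 / (2 * r)) = 2 * (t + 1)" using r by (simp add: T_def field_simps)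
      moreover have "real (s * T) * (1 - 1 / r - 1 / (2 * r^2)) - (real s - 1) * T - t
         = T * (1 - real s * (1 / r + 1 / (2 * r^2))) - t" by (simp add: algebra_simps)
      ultimately show ?thesis by simp
    qed
    then have "?m * 1 \<le> card W * real (s * T)" using main
      by (meson mult_left_mono of_nat_0_le_iff order_trans)
    then have "card U \<le> card W * (s * T)" by (simp flip: of_nat_mult)
    then have "s * T * (t * 2 ^ (s * T) + s * T + 1) \<le> s * T * card W" using U(4) by (simp add: mult_ac)
    moreover have "0 < s * T" using Tpos sr by simp
    ultimately have "t * 2 ^ (s * T) + s * T + 1 \<le> card W" by (simp only: mult_le_cancel1)
    then have "t * 2 ^ (s * T) + s * T < card W" by simp
    moreover have "card W \<le> card (W - H) + card H" 
    proof -
      have "card W \<le> card ((W - H) \<union> H)" using fW fH by (intro card_mono) auto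
      also have "\<dots> \<le> card (W - H) + card H" by (rule card_Un_le)
      finally show ?thesis .
    qed
    \<comment> \<open>More than t vertices of W - H share one neighbourhood S in H: t of them form
      the new class, and S supplies t vertices of every old class.\<close>
    ultimately have "card (W - H) > t * card (Pow H)" using cH fH by (simp add: card_Pow)
    moreover have "(\<lambda>v. nbr H E v) ` (W - H) \<subseteq> Pow H" by (auto simp: nbr_def)
    ultimately obtain S where S: "S \<subseteq> H" "card {v \<in> W - H. nbr H E v = S} > t"
      using pigeonhole_fibre[of "W - H" "Pow H" "nbr H E" t] fW fH by auto
    then obtain R where R: "R \<subseteq> {v \<in> W - H. nbr H E v = S}" "card R = t" "finite R"
      using obtain_subset_with_card_n[of t "{v \<in> W - H. nbr H E v = S}"] by auto
    have "{v \<in> W - H. nbr H E v = S} \<noteq> {}" using S(2) by (metis card.empty not_less_zero)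
    then obtain v\<^sub>0 where v\<^sub>0: "v\<^sub>0 \<in> W" "nbr H E v\<^sub>0 = S" by blast
    have "\<exists>X. X \<subseteq> cls l S i \<and> card X = t" if "i < s" for i
    proof -
      have "{w \<in> cls l H i. E v\<^sub>0 w} = cls l S i" using v\<^sub>0 by (auto simp: cls_def nbr_def)
      then have "t \<le> card (cls l S i)" using v\<^sub>0 that by (auto simp: W_def)
      then show ?thesis using obtain_subset_with_card_n by metis
    qed
    then obtain X where X: "\<And>i. i < s \<Longrightarrow> X i \<subseteq> cls l S i \<and> card (X i) = t" by metis
    define H' where "H' = R \<union> (\<Union>i<s. X i)"
    define l' where "l' = (\<lambda>v. if v \<in> R then s else l v)"
    have RH: "R \<inter> H = {}" "R \<subseteq> U" using R fW by auto
    have XH: "v \<in> H \<and> v \<in> S \<and> l v = i \<and> v \<notin> R" if "i < s" "v \<in> X i" for v i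
      using X[OF that(1)] that S RH by (auto simp: cls_def)
    have clsX: "cls l' H' i = X i" if "i < s" for i
      using that XH unfolding cls_def H'_def l'_def by force
    have clsR: "cls l' H' s = R" unfolding cls_def H'_def l'_def using XH by force
    show "\<exists>H l. H \<subseteq> U \<and> (\<forall>v\<in>H. l v < Suc s) \<and> (\<forall>i<Suc s. card (cls l H i) = t) \<and> cross_complete E l H"
    proof (intro exI[of _ H'] exI[of _ l'] conjI)
      show "H' \<subseteq> U" using RH XH H(1) by (auto simp: H'_def)
      show "\<forall>v\<in>H'. l' v < Suc s" using XH by (auto simp: H'_def l'_def less_Suc_eq)
      show "\<forall>i<Suc s. card (cls l' H' i) = t" using clsX clsR X R by (auto simp: less_Suc_eq)
      show "cross_complete E l' H'" unfolding cross_complete_def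
      proof (intro ballI impI)
        fix u w assume uw: "u \<in> H'" "w \<in> H'" "l' u \<noteq> l' w"
        have RS: "E x y" if "x \<in> R" "y \<in> S" for x y using that R by (auto simp: nbr_def)
        have sy: "E x y \<Longrightarrow> E y x" for x y using U by (auto simp: sym_irrefl_def)
        consider "u \<in> R" "w \<in> R" | "u \<in> R" "w \<in> S" | "u \<in> S" "w \<in> R" | "u \<in> H" "w \<in> H" "l u \<noteq> l w"
          using uw XH unfolding H'_def l'_def by (auto split: if_splits)
        then show "E u w"
        proof cases
          case 1
          then show ?thesis using uw by (simp add: l'_def)
        next
          case 4
          then show ?thesis using H(4) by (auto simp: cross_complete_def)
        qed (use RS sy in auto)
      qed
    qed
  qed
qed

text \<open>W is the classified part of the vertex set. Lower bounds on the class sizes suffice,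
  since the r disjoint classes then bound each other from above.\<close>

definition struct :: "real \<Rightarrow> nat set \<Rightarrow> (nat \<Rightarrow> nat \<Rightarrow> bool) \<Rightarrow> nat set \<Rightarrow> (nat \<Rightarrow> nat) \<Rightarrow> bool" where
  "struct \<gamma> V E W l \<longleftrightarrow> W \<subseteq> V \<and> (\<forall>v\<in>W. l v < r) \<and> real (card (V - W)) \<le> \<gamma> * real (card V) \<and>
     (\<forall>i<r. card (cls l W i) \<ge> (1 / r - \<gamma>) * real (card V)) \<and>
     (\<forall>v\<in>W. card {w \<in> W. l w \<noteq> l v \<and> \<not> E v w} \<le> \<gamma> * real (card V)) \<and>
     (\<forall>v\<in>W. card {w \<in> W. l w = l v \<and> E v w} \<le> \<gamma> * real (card V))"

text \<open>Every vertex is labelled by a class of a complete r-partite subgraph H in which it has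
  few neighbours. Double counting between H and U shows that nearly all vertices see nearly
  everything in the other classes of H; for these, collected in W, the star bound limits the edges
  inside a class. The degrees then bound the class sizes from above, and summation bounds them from
  below.\<close>

lemma struct_of_min_degree:
  fixes \<gamma> :: real
  assumes \<gamma>: "0 < \<gamma>"
  obtains \<epsilon> :: real and m\<^sub>0 where "0 < \<epsilon>" "\<epsilon> \<le> 1 / 2"
    "\<And>U E. free_on U E \<Longrightarrow> card U \<ge> m\<^sub>0 \<Longrightarrow> \<forall>u\<in>U. dg U E u \<ge> (1 - 1 / r - \<epsilon>) * card U \<Longrightarrow>
       \<exists>W l. struct \<gamma> U E W l"
proof -
  \<comment> \<open>The unit of error is g; the largest final error is (2 r + 2) g. The choice of
    \<theta> makes 2 \<theta> N = 1/4. The three lower bounds on t give N (2 \<theta> t + 1) < t for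
    the star bound, N <= \<theta> t, and N <= \<theta> g t / 2 for the double count.\<close>
  define g where "g = min (1 / 4) (\<gamma> / (2 * r + 2))"
  define N where "N = real r * N\<^sub>1"
  define \<theta> where "\<theta> = 1 / (8 * N)"
  define \<epsilon> where "\<epsilon> = min g (min (1 / (2 * r^2)) (\<theta> * g / (2 * r)))"
  define t where "t = nat \<lceil>max (4 * N + 1) (max (N / \<theta>) (2 * N / (\<theta> * g)))\<rceil>"
  have g: "0 < g" "g \<le> 1 / 4" "g \<le> \<gamma> / (2 * r + 2)"
  proof -
    show "0 < g" using \<gamma> by (simp add: g_def)
    show "g \<le> 1 / 4" unfolding g_def by (rule min.cobounded1)
    show "g \<le> \<gamma> / (2 * r + 2)" unfolding g_def by (rule min.cobounded2)
  qed
  then have g': "(2 * r + 2) * g \<le> \<gamma>" by (simp add: field_simps)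
  have N1: "N\<^sub>1 \<ge> 2" by (simp add: N\<^sub>1_def K\<^sub>0_def)
  then have N: "N \<ge> 1"
  proof -
    have "1 * 1 \<le> real r * N\<^sub>1" using r N1 by (intro mult_mono) auto
    then show ?thesis by (simp add: N_def)
  qed
  have \<theta>: "0 < \<theta>" "2 * \<theta> * N = 1 / 4" using N by (auto simp: \<theta>_def)
  have \<epsilon>: "0 < \<epsilon>" "\<epsilon> \<le> g" "\<epsilon> \<le> 1 / (2 * r^2)" "\<epsilon> \<le> \<theta> * g / (2 * r)"
  proof -
    show "0 < \<epsilon>" using g \<theta> r by (simp add: \<epsilon>_def)
    show "\<epsilon> \<le> g" unfolding \<epsilon>_def by (rule min.cobounded1)
    show "\<epsilon> \<le> 1 / (2 * r^2)" unfolding \<epsilon>_def by (rule min.coboundedI2, rule min.cobounded1)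
    show "\<epsilon> \<le> \<theta> * g / (2 * r)" unfolding \<epsilon>_def by (rule min.coboundedI2, rule min.cobounded2)
  qed
  have t: "t \<ge> 4 * N + 1" "t \<ge> N / \<theta>" "t \<ge> 2 * N / (\<theta> * g)"
  proof -
    have "real t \<ge> max (4 * N + 1) (max (N / \<theta>) (2 * N / (\<theta> * g)))"
      unfolding t_def by (rule real_nat_ceiling_ge)
    then show "t \<ge> 4 * N + 1" "t \<ge> N / \<theta>" "t \<ge> 2 * N / (\<theta> * g)"
      by (simp_all only: max.bounded_iff)
  qed
  obtain m\<^sub>1 where m\<^sub>1': "\<forall>U E. finite U \<and> sym_irrefl E \<and> card U \<ge> m\<^sub>1 \<and>
      (\<forall>u\<in>U. dg U E u \<ge> (1 - 1 / r - 1 / (2 * r^2)) * card U) \<longrightarrow>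
      (\<exists>H l. H \<subseteq> U \<and> (\<forall>v\<in>H. l v < r) \<and> (\<forall>i<r. card (cls l H i) = t) \<and> cross_complete E l H)"
    using complete_multipartite_exists[of r t] r by auto
  have m\<^sub>1: "\<exists>H l. H \<subseteq> U \<and> (\<forall>v\<in>H. l v < r) \<and> (\<forall>i<r. card (cls l H i) = t) \<and> cross_complete E l H"
    if "finite U" "sym_irrefl E" "card U \<ge> m\<^sub>1"
      "\<forall>u\<in>U. dg U E u \<ge> (1 - 1 / r - 1 / (2 * r^2)) * card U" for U E
    by (rule m\<^sub>1'[THEN spec, THEN spec, THEN mp]) (intro conjI that)
  define m\<^sub>0 where "m\<^sub>0 = max m\<^sub>1 (nat \<lceil>K\<^sub>0 / g\<rceil>)"
  show ?thesis
  proof (rule that[of \<epsilon> m\<^sub>0])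
    show "0 < \<epsilon>" "\<epsilon> \<le> 1 / 2" using \<epsilon> g by auto
    fix U E assume fr: "free_on U E" and m: "card U \<ge> m\<^sub>0"
      and deg: "\<forall>u\<in>U. dg U E u \<ge> (1 - 1 / r - \<epsilon>) * card U"
    have U: "finite U" "sym_irrefl E" using fr by (auto simp: free_on_def)
    let ?m = "real (card U)"
    have mK: "K\<^sub>0 \<le> g * ?m"
    proof -
      have "K\<^sub>0 / g \<le> ?m" using m unfolding m\<^sub>0_def by linarith
      then show ?thesis using g by (simp add: field_simps)
    qed
    have "\<forall>u\<in>U. dg U E u \<ge> (1 - 1 / r - 1 / (2 * r^2)) * card U"
    proof
      fix u assume "u \<in> U"
      have "(1 - 1 / r - 1 / (2 * r^2)) * card U \<le> (1 - 1 / r - \<epsilon>) * card U"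
        using \<epsilon> by (intro mult_right_mono) auto
      then show "dg U E u \<ge> (1 - 1 / r - 1 / (2 * r^2)) * card U" using deg \<open>u \<in> U\<close> by force
    qed
    then obtain H h where H: "H \<subseteq> U" "\<And>v. v \<in> H \<Longrightarrow> h v < r" "\<And>i. i < r \<Longrightarrow> card (cls h H i) = t"
      "cross_complete E h H"
      using m\<^sub>1[OF U] m unfolding m\<^sub>0_def by (metis max.bounded_iff)
    have fH: "finite H" by (rule finite_subset[OF H(1) U(1)])
    have miss0: "{w \<in> cls h H i. \<not> E s w} = {}" if "s \<in> H" "i \<noteq> h s" for s i
      using that H(4) by (auto simp: cls_def cross_complete_def)
    have "\<exists>i<r. card {w \<in> cls h H i. E v w} \<le> N" if "v \<in> U" for v
      using poor_class_exists[OF fr that H(1), of h 0] H(2) miss0 by (simp add: N_def)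
    then obtain l where l: "\<And>v. v \<in> U \<Longrightarrow> l v < r" "\<And>v. v \<in> U \<Longrightarrow> card {w \<in> cls h H (l v). E v w} \<le> N"
      by metis
    \<comment> \<open>A vertex of H sees all t > N vertices of each class of H other than its own,
      so its poor class can only be its own.\<close>
    have lh: "l v = h v" if "v \<in> H" for v
    proof (rule ccontr)
      assume ne: "l v \<noteq> h v"
      have vU: "v \<in> U" using that H by auto
      have "{w \<in> cls h H (l v). E v w} = cls h H (l v)" using miss0[OF that ne] by auto
      then have "real t \<le> N" using l[OF vU] H(3) by simp
      then show False using t N by linarith
    qed
    have clsH: "cls l H i = cls h H i" for i using lh by (auto simp: cls_def)
    have cH: "card H = r * t" using card_classes[OF fH H(2)] H(3) by simp
    have dgU: "dg H E v \<le> (real r - 1) * t + N" if "v \<in> U" for v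
    proof -
      have "card {w \<in> cls h H (l v). E v w} \<le> r * N\<^sub>1" using l[OF that] unfolding N_def
        by (simp flip: of_nat_mult)
      from dg_le_poor_class[where H = H and l = h and j = "l v" and E = E and v = v and b = "r * N\<^sub>1",
        OF fH H(2,3) l(1)[OF that] this] show ?thesis by (simp add: N_def)
    qed
    define W where "W = {v \<in> U. dg H E v \<ge> (real r - 1) * t - \<theta> * t}"
    have W: "W \<subseteq> U" "finite W" using U by (auto simp: W_def)
    have labW: "l v < r" if "v \<in> W" for v using that W l by auto
    have tpos: "real t > 0" using t N by linarith
    have bad: "card (U - W) \<le> g * ?m"
    proof -
      have "real (r * t) * ((1 - 1 / r - \<epsilon>) * ?m) \<le> (\<Sum>w\<in>H. dg U E w)"
        using sum_bounded_below[of H "(1 - 1 / r - \<epsilon>) * ?m" "dg U E"] deg H cH by auto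
      also have "\<dots> = (\<Sum>v\<in>U. dg H E v)" by (rule sum_dg_swap[OF U H(1)])
      also have "\<dots> \<le> (\<Sum>v\<in>U. (real r - 1) * t + N - (if v \<in> U - W then \<theta> * t else 0))"
        using dgU N by (intro sum_mono) (auto simp: W_def)
      also have "\<dots> = ?m * ((real r - 1) * t + N) - card (U - W) * (\<theta> * t)"
      proof -
        have "U \<inter> {v. v \<notin> W} = U - W" by auto
        then show ?thesis using U W by (simp add: sum_subtractf sum.If_cases Int_absorb1)
      qed
      finally have "card (U - W) * (\<theta> * t) \<le> ?m * ((real r - 1) * t + N) - real (r * t) * ((1 - 1 / r - \<epsilon>) * ?m)"
        by simp
      also have "\<dots> = ?m * (N + r * t * \<epsilon>)"
        using r by (simp add: field_simps)
      also have "\<dots> \<le> ?m * (\<theta> * g * t)"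
      proof (intro mult_left_mono)
        have "N \<le> \<theta> * g * t / 2" using t(3) \<theta> g by (simp add: field_simps)
        moreover have "r * t * \<epsilon> \<le> r * t * (\<theta> * g / (2 * r))" using \<epsilon>(4) by (intro mult_left_mono) auto
        moreover have "r * t * (\<theta> * g / (2 * r)) = \<theta> * g * t / 2" using r by (simp add: field_simps)
        ultimately show "N + r * t * \<epsilon> \<le> \<theta> * g * t" by linarith
      qed auto
      finally have "card (U - W) * (\<theta> * t) \<le> (g * ?m) * (\<theta> * t)" by (simp add: mult_ac)
      then show ?thesis using \<theta> tpos by simp
    qed
    have missH: "card {w \<in> cls l H i. \<not> E v w} \<le> 2 * \<theta> * t" if v: "v \<in> W" and i: "i < r" "i \<noteq> l v" for v i
    proof -
      have vU: "v \<in> U" using v W by auto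
      have "dg H E v = (\<Sum>j<r. real (card {w \<in> cls l H j. E v w}))"
        using lh H(2) by (intro dg_classes[OF fH]) auto
      also have "\<dots> = card {w \<in> cls l H i. E v w} + (card {w \<in> cls l H (l v). E v w}
          + (\<Sum>j\<in>{..<r} - {i} - {l v}. real (card {w \<in> cls l H j. E v w})))"
        using i l(1)[OF vU] by (subst sum.remove[of _ i], simp, simp, subst sum.remove[of _ "l v"]) auto
      also have "(\<Sum>j\<in>{..<r} - {i} - {l v}. real (card {w \<in> cls l H j. E v w})) \<le> (\<Sum>j\<in>{..<r} - {i} - {l v}. real t)"
      proof (intro sum_mono of_nat_mono)
        fix j assume "j \<in> {..<r} - {i} - {l v}"
        then show "card {w \<in> cls l H j. E v w} \<le> t"
          using H(3)[of j] card_mono[of "cls l H j" "{w \<in> cls l H j. E v w}"] fH by (auto simp: finite_cls clsH)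
      qed
      also have "(\<Sum>j\<in>{..<r} - {i} - {l v}. real t) = (real r - 2) * t"
        using i l(1)[OF vU] r by (simp add: card_Diff_subset of_nat_diff)
      finally have "dg H E v \<le> card {w \<in> cls l H i. E v w} + N + (real r - 2) * t"
        using l(2)[OF vU] by (simp add: clsH)
      moreover have "dg H E v \<ge> (real r - 1) * t - \<theta> * t" using v by (simp add: W_def)
      moreover have "card {w \<in> cls l H i. E v w} + card {w \<in> cls l H i. \<not> E v w} = t"
      proof -
        have "card {w \<in> cls l H i. E v w} + card {w \<in> cls l H i. \<not> E v w} = card (cls l H i)"
          using fH by (subst card_Un_disjoint[symmetric]) (auto simp: finite_cls intro: arg_cong[where f = card])
        then show ?thesis using H(3)[OF i(1)] by (simp add: clsH)
      qed
      then have "real (card {w \<in> cls l H i. E v w}) = t - real (card {w \<in> cls l H i. \<not> E v w})" by linarith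
      moreover have "N \<le> \<theta> * t" using t(2) \<theta> by (simp add: field_simps)
      ultimately show ?thesis by (simp add: algebra_simps)
    qed
    have intl: "card {w \<in> W. l w = l v \<and> E v w} < K\<^sub>0" if v: "v \<in> W" for v
    proof (rule monochromatic_star_bound[OF fr, where v = v and Q = H and l = l and \<mu> = "2 * \<theta> * t"])
      show "insert v {w \<in> W. l w = l v \<and> E v w} \<subseteq> U" "H \<subseteq> U" using v W H by auto
      show "l w < r" if "w \<in> H" for w using lh H that by simp
      show "l v < r" using labW v by simp
      show "0 \<le> 2 * \<theta> * t" using \<theta> by simp
      show "r * N\<^sub>1 * (2 * \<theta> * t + 1) < card (cls l H i)" if "i < r" for i
      proof -
        have "r * N\<^sub>1 * (2 * \<theta> * t + 1) = (2 * \<theta> * N) * t + N" by (simp add: N_def algebra_simps)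
        also have "\<dots> < t" unfolding \<theta>(2) using t(1) N by linarith
        finally show ?thesis using H(3)[OF that] by (simp add: clsH)
      qed
      show "card {w \<in> cls l H i. \<not> E s w} \<le> 2 * \<theta> * t"
        if "s \<in> insert v {w \<in> W. l w = l v \<and> E v w} \<union> H" "i < r" "i \<noteq> l s" for s i
      proof (cases "s \<in> H")
        case True
        then have e: "{w \<in> cls l H i. \<not> E s w} = {}" using miss0[of s i] that lh by (simp add: clsH)
        show ?thesis unfolding e using \<theta> by simp
      next
        case False
        then show ?thesis using that v by (intro missH) auto
      qed
    qed auto
    have nbr_split: "dg U E v \<le> K\<^sub>0 + card (U - W) + card {w \<in> W. l w \<noteq> l v \<and> E v w}" if v: "v \<in> W" for v
    proof -
      have "card (nbr U E v) \<le> card ({w \<in> W. l w = l v \<and> E v w} \<union> (U - W) \<union> {w \<in> W. l w \<noteq> l v \<and> E v w})"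
        using U W by (intro card_mono) (auto simp: nbr_def)
      also have "\<dots> \<le> card {w \<in> W. l w = l v \<and> E v w} + card (U - W) + card {w \<in> W. l w \<noteq> l v \<and> E v w}"
        by (meson add_le_mono1 card_Un_le le_trans)
      finally show ?thesis using intl[OF v] by (simp add: dg_def)
    qed
    \<comment> \<open>A vertex of class i has fewer than \<open>K\<^sub>0\<close> neighbours there,
      so its large degree leaves room for little more than an r-th of all vertices in class
      i.\<close>
    have upper: "card (cls l W i) \<le> (1 / r + 2 * g) * ?m" if i: "i < r" for i
    proof (cases "cls l W i = {}")
      case True
      then show ?thesis using g r by simp
    next
      case False
      then obtain v where v: "v \<in> W" "l v = i" by (auto simp: cls_def)
      have "card {w \<in> W. l w \<noteq> l v \<and> E v w} + card (U - W) + card (cls l W i) \<le> card U"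
      proof -
        have "card {w \<in> W. l w \<noteq> l v \<and> E v w} + card (U - W) + card (cls l W i)
          = card ({w \<in> W. l w \<noteq> l v \<and> E v w} \<union> (U - W) \<union> cls l W i)"
          using U W v by (subst card_Un_disjoint, auto simp: cls_def, subst card_Un_disjoint) auto
        also have "\<dots> \<le> card U" using U W by (intro card_mono) (auto simp: cls_def)
        finally show ?thesis .
      qed
      then have "real (card {w \<in> W. l w \<noteq> l v \<and> E v w}) + card (U - W) + card (cls l W i) \<le> ?m"
        by linarith
      moreover have "(1 - 1 / r - \<epsilon>) * ?m \<le> K\<^sub>0 + card (U - W) + card {w \<in> W. l w \<noteq> l v \<and> E v w}"
        using nbr_split[OF v(1)] deg v W by force
      ultimately have "card (cls l W i) \<le> ?m - (1 - 1 / r - \<epsilon>) * ?m + K\<^sub>0" by linarith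
      also have "\<dots> \<le> ?m - (1 - 1 / r - g) * ?m + g * ?m"
        using \<epsilon>(2) mK by (intro add_mono diff_left_mono mult_right_mono) auto
      finally show ?thesis by (simp add: algebra_simps)
    qed
    have cW: "real (card W) = ?m - card (U - W)"
      using W U card_mono[OF U(1) W(1)] by (simp add: card_Diff_subset of_nat_diff)
    have lower: "card (cls l W i) \<ge> (1 / r - (2 * real r - 1) * g) * ?m" if i: "i < r" for i
    proof -
      have "real (card W) = (\<Sum>j<r. real (card (cls l W j)))"
        using card_classes[OF W(2) labW] by simp
      also have "\<dots> = card (cls l W i) + (\<Sum>j\<in>{..<r} - {i}. real (card (cls l W j)))"
        using i by (subst sum.remove[of _ i]) auto
      also have "(\<Sum>j\<in>{..<r} - {i}. real (card (cls l W j))) \<le> (\<Sum>j\<in>{..<r} - {i}. (1 / r + 2 * g) * ?m)"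
        using upper by (intro sum_mono) auto
      also have "\<dots> = (real r - 1) * ((1 / r + 2 * g) * ?m)" using i by (simp add: of_nat_diff)
      finally have "card (cls l W i) \<ge> ?m - g * ?m - (real r - 1) * ((1 / r + 2 * g) * ?m)"
        using bad cW by linarith
      also have "?m - g * ?m - (real r - 1) * ((1 / r + 2 * g) * ?m) = (1 / r - (2 * real r - 1) * g) * ?m"
        using r by (simp add: field_simps)
      finally show ?thesis .
    qed
    have missW: "card {w \<in> W. l w \<noteq> l v \<and> \<not> E v w} \<le> (2 * r + 2) * g * ?m" if v: "v \<in> W" for v
    proof -
      have "card {w \<in> W. l w \<noteq> l v \<and> \<not> E v w} + card {w \<in> W. l w \<noteq> l v \<and> E v w} + card (cls l W (l v))
        = card ({w \<in> W. l w \<noteq> l v \<and> \<not> E v w} \<union> {w \<in> W. l w \<noteq> l v \<and> E v w} \<union> cls l W (l v))"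
        using W by (subst card_Un_disjoint, auto simp: cls_def, subst card_Un_disjoint) auto
      also have "\<dots> \<le> card U" using U W by (intro card_mono) (auto simp: cls_def)
      finally have "real (card {w \<in> W. l w \<noteq> l v \<and> \<not> E v w}) + card {w \<in> W. l w \<noteq> l v \<and> E v w} + card (cls l W (l v)) \<le> ?m"
        by linarith
      moreover have "(1 - 1 / r - \<epsilon>) * ?m \<le> K\<^sub>0 + card (U - W) + card {w \<in> W. l w \<noteq> l v \<and> E v w}"
        using nbr_split[OF v] deg v W by force
      moreover have "(1 - 1 / r - g) * ?m \<le> (1 - 1 / r - \<epsilon>) * ?m"
        using \<epsilon>(2) by (intro mult_right_mono) auto
      ultimately have "card {w \<in> W. l w \<noteq> l v \<and> \<not> E v w}
         \<le> ?m - (1 / r - (2 * real r - 1) * g) * ?m + g * ?m + g * ?m - (1 - 1 / r - g) * ?m"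
        using lower[OF labW[OF v]] mK bad by linarith
      also have "\<dots> = (2 * r + 2) * g * ?m" by (simp add: algebra_simps)
      finally show ?thesis .
    qed
    have g\<gamma>: "c * g \<le> \<gamma>" if "c \<le> 2 * r + 2" for c :: real
    proof -
      have "c * g \<le> (2 * r + 2) * g" using that g by (intro mult_right_mono) auto
      then show ?thesis using g' by linarith
    qed
    have "struct \<gamma> U E W l" unfolding struct_def
    proof (intro conjI ballI allI impI)
      have gm: "c * g * ?m \<le> \<gamma> * ?m" if "c \<le> 2 * r + 2" for c :: real
        using g\<gamma>[OF that] by (intro mult_right_mono) auto
      show "W \<subseteq> U" by fact
      show "l v < r" if "v \<in> W" for v using labW that .
      show "card (U - W) \<le> \<gamma> * ?m" using bad gm[of 1] by simp
      show "card {w \<in> W. l w \<noteq> l v \<and> \<not> E v w} \<le> \<gamma> * ?m" if "v \<in> W" for v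
        using missW[OF that] gm[of "2 * r + 2"] by simp
      show "card {w \<in> W. l w = l v \<and> E v w} \<le> \<gamma> * ?m" if "v \<in> W" for v
        using intl[OF that] gm[of 1] mK by simp
      show "(1 / r - \<gamma>) * ?m \<le> card (cls l W i)" if "i < r" for i
      proof -
        have "(1 / r - \<gamma>) * ?m \<le> (1 / r - (2 * real r - 1) * g) * ?m"
          using g\<gamma>[of "2 * real r - 1"] by (intro mult_right_mono) auto
        then show ?thesis using lower[OF that] by linarith
      qed
    qed
    then show "\<exists>W l. struct \<gamma> U E W l" by blast
  qed
qed

end

section \<open>Near-constant eigenvectors and rewiring\<close>

lemma sum_diff_Diff:
  fixes f :: "nat \<Rightarrow> real"
  assumes "finite A" "finite B"
  shows "sum f A - sum f B = sum f (A - B) - sum f (B - A)"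
  using sum.Int_Diff[OF assms(1), of f B] sum.Int_Diff[OF assms(2), of f A] by (simp add: Int_commute)

lemma sum_perturb:
  fixes f :: "nat \<Rightarrow> real" and b M :: real
  assumes "finite A" "finite B" and f: "\<And>w. w \<in> A \<union> B \<Longrightarrow> 0 \<le> f w \<and> f w \<le> M"
    and c: "card (A - B) \<le> b" "card (B - A) \<le> b" and "M \<ge> 0"
  shows "\<bar>sum f A - sum f B\<bar> \<le> b * M"
proof -
  have "0 \<le> sum f (A - B)" "0 \<le> sum f (B - A)" using f by (auto intro!: sum_nonneg)
  moreover have "sum f (A - B) \<le> card (A - B) * M" "sum f (B - A) \<le> card (B - A) * M"
    using f by (auto intro!: sum_bounded_above)
  moreover have "card (A - B) * M \<le> b * M" "card (B - A) * M \<le> b * M"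
    using c \<open>M \<ge> 0\<close> by (auto intro!: mult_right_mono)
  ultimately show ?thesis unfolding sum_diff_Diff[OF assms(1,2)] by linarith
qed

context extremal_bound
begin

text \<open>The vertices of V - U simply become unclassified, at the cost of \<eta>.\<close>

lemma struct_mono:
  fixes \<gamma> \<eta> :: real
  assumes "struct \<gamma> U E W l" "U \<subseteq> V" "finite V" "card U \<ge> (1 - \<eta>) * card V" "\<gamma> \<ge> 0" "\<eta> \<ge> 0"
  shows "struct (\<gamma> + \<eta>) V E W l"
proof -
  have cU: "real (card U) \<le> card V" using assms by (simp add: card_mono)
  then have g: "\<gamma> * card U \<le> \<gamma> * card V" using assms(5) by (rule mult_left_mono)
  have e: "0 \<le> \<eta> * card V" using assms by simp
  have le: "x \<le> (\<gamma> + \<eta>) * card V" if "x \<le> \<gamma> * card U" for x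
    using that g e by (simp add: algebra_simps)
  have fU: "finite U" using assms finite_subset by blast
  have "V - W = (V - U) \<union> (U - W)" using assms by (auto simp: struct_def)
  then have "card (V - W) \<le> card (V - U) + card (U - W)" by (simp add: card_Un_le)
  then have "real (card (V - W)) \<le> real (card (V - U)) + card (U - W)" by linarith
  also have "real (card (V - U)) = real (card V) - card U"
    using assms fU card_mono[OF assms(3,2)] by (simp add: card_Diff_subset of_nat_diff)
  also have "real (card (U - W)) \<le> \<gamma> * card U" using assms by (simp add: struct_def)
  finally have 1: "card (V - W) \<le> (\<gamma> + \<eta>) * card V" using assms(4) g by (simp add: algebra_simps)
  have 2: "card (cls l W i) \<ge> (1 / r - (\<gamma> + \<eta>)) * card V" if "i < r" for i
  proof -
    have "(1 / r - \<gamma>) * card U \<le> card (cls l W i)" using assms(1) that by (simp add: struct_def)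
    moreover have "(1 / r) * ((1 - \<eta>) * card V) \<le> (1 / r) * card U"
      using assms(4) by (intro mult_left_mono) auto
    moreover have "(1 / r) * (\<eta> * card V) \<le> 1 * (\<eta> * card V)"
      using r e by (intro mult_right_mono) auto
    ultimately show ?thesis using g by (simp add: algebra_simps)
  qed
  show ?thesis
    using assms(1,2) 1 2 le unfolding struct_def by auto
qed

lemma struct_exists:
  fixes \<gamma> :: real
  assumes "\<gamma> > 0"
  obtains n\<^sub>1 where "\<And>V E. free_on V E \<Longrightarrow> card V \<ge> n\<^sub>1 \<Longrightarrow> phi V E \<ge> dens \<Longrightarrow> \<exists>W l. struct \<gamma> V E W l"
proof -
  define \<eta> where "\<eta> = min (1 / 2) (\<gamma> / 2)"
  have \<eta>: "0 < \<eta>" "\<eta> \<le> 1 / 2" "\<eta> \<le> \<gamma> / 2"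
  proof -
    show "0 < \<eta>" using assms by (simp add: \<eta>_def)
    show "\<eta> \<le> 1 / 2" unfolding \<eta>_def by (rule min.cobounded1)
    show "\<eta> \<le> \<gamma> / 2" unfolding \<eta>_def by (rule min.cobounded2)
  qed
  obtain \<epsilon> :: real and m\<^sub>0 where \<epsilon>: "0 < \<epsilon>" "\<epsilon> \<le> 1 / 2"
    and m\<^sub>0: "\<And>U E. free_on U E \<Longrightarrow> card U \<ge> m\<^sub>0 \<Longrightarrow> \<forall>u\<in>U. dg U E u \<ge> (1 - 1 / r - \<epsilon>) * card U \<Longrightarrow>
       \<exists>W l. struct (\<gamma> / 2) U E W l"
    using struct_of_min_degree[of "\<gamma> / 2"] assms by (metis half_gt_zero)
  obtain n\<^sub>2 where n\<^sub>2: "\<And>V E. free_on V E \<Longrightarrow> card V \<ge> n\<^sub>2 \<Longrightarrow> phi V E \<ge> dens \<Longrightarrow>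
    \<exists>U\<subseteq>V. card U \<ge> (1 - \<eta>) * card V \<and> (\<forall>u\<in>U. dg U E u \<ge> (1 - 1 / r - \<epsilon>) * card U)"
    using dense_subset[OF \<epsilon> \<eta>(1)] by metis
  show ?thesis
  proof (rule that[of "max n\<^sub>2 (2 * m\<^sub>0)"])
    fix V E assume fr: "free_on V E" and n: "card V \<ge> max n\<^sub>2 (2 * m\<^sub>0)" and p: "phi V E \<ge> dens"
    obtain U where U: "U \<subseteq> V" "card U \<ge> (1 - \<eta>) * card V"
      "\<forall>u\<in>U. dg U E u \<ge> (1 - 1 / r - \<epsilon>) * card U"
      using n\<^sub>2[OF fr _ p] n by auto
    have "1 / 2 * card V \<le> (1 - \<eta>) * card V" using \<eta> by (intro mult_right_mono) auto
    then have "card U \<ge> m\<^sub>0" using U(2) n by linarith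
    then obtain W l where W: "struct (\<gamma> / 2) U E W l"
      using m\<^sub>0[OF free_on_subset[OF fr U(1)] _ U(3)] by blast
    have "(1 - \<gamma> / 2) * card V \<le> (1 - \<eta>) * card V" using \<eta> by (intro mult_right_mono) auto
    then have "card U \<ge> (1 - \<gamma> / 2) * card V" using U(2) by linarith
    then have "struct (\<gamma> / 2 + \<gamma> / 2) V E W l"
      using fr assms by (intro struct_mono[OF W U(1)]) (auto simp: free_on_def)
    then show "\<exists>W l. struct \<gamma> V E W l" by auto
  qed
qed

text \<open>Scaling to squared norm n makes 1 the expected entry. For v in W the eigenvalue equation
  says that z_v D is close to Z - Y_i, where D = (1 - 1/r) n, i is the class of v, Z is the sum of z
  over W and Y_i its part on class i. Summing over a class makes Y_i close to Z / r, hence z_v close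
  to Z / n, and the norm forces this mean to be nearly 1.\<close>

lemma eigenvector_near_constant:
  fixes \<gamma> q :: real and z :: "nat \<Rightarrow> real"
  assumes V: "finite V" "V \<noteq> {}" "sym_irrefl E" and st: "struct \<gamma> V E W l" and \<gamma>: "0 \<le> \<gamma>" "\<gamma> \<le> 1 / 16"
    and z: "sqnorm V z = card V" "\<And>v. z v \<ge> 0"
    and eig: "\<And>v. v \<in> V \<Longrightarrow> q * z v = dg V E v * z v + (\<Sum>w\<in>nbr V E v. z w)"
    and q: "\<bar>q - dens * card V\<bar> \<le> \<gamma> * card V"
  shows "\<And>v. v \<in> V \<Longrightarrow> z v \<le> 4" "\<And>v. v \<in> W \<Longrightarrow> \<bar>z v - 1\<bar> \<le> 75 * r * \<gamma>"
proof -
  let ?n = "real (card V)"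
  have n: "?n > 0" using V by (simp add: card_gt_0_iff)
  have W: "W \<subseteq> V" "finite W" "\<And>v. v \<in> W \<Longrightarrow> l v < r" "card (V - W) \<le> \<gamma> * ?n"
    "\<And>i. i < r \<Longrightarrow> card (cls l W i) \<ge> (1 / r - \<gamma>) * ?n"
    "\<And>v. v \<in> W \<Longrightarrow> card {w \<in> W. l w \<noteq> l v \<and> \<not> E v w} \<le> \<gamma> * ?n"
    "\<And>v. v \<in> W \<Longrightarrow> card {w \<in> W. l w = l v \<and> E v w} \<le> \<gamma> * ?n"
    using st V finite_subset by (auto simp: struct_def)
  have "(sum z V)^2 \<le> ?n^2" using sum_sq_le[OF V(1), of z] z by (simp add: power2_eq_square)
  then have SV: "sum z V \<le> ?n" by (rule power2_le_imp_le) simp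
  \<comment> \<open>Here q - d_v >= n / 4, because q is close to dens n >= 4 n / 3 while d_v <= n;
    and the entries sum to at most n by Cauchy-Schwarz.\<close>
  show z4: "z v \<le> 4" if v: "v \<in> V" for v
  proof -
    have "dg V E v \<le> ?n" using dg_le[OF V(1,3) v] by simp
    moreover have "dens * ?n \<ge> 4 / 3 * ?n" using dens_bounds n by (intro mult_right_mono) auto
    moreover have "\<gamma> * ?n \<le> 1 / 16 * ?n" using \<gamma> by (intro mult_right_mono) auto
    ultimately have "q - dg V E v \<ge> ?n / 4" using q by linarith
    then have "?n / 4 * z v \<le> (q - dg V E v) * z v" using z by (intro mult_right_mono) auto
    also have "\<dots> = (\<Sum>w\<in>nbr V E v. z w)" using eig[OF v] by (simp add: algebra_simps)
    also have "\<dots> \<le> sum z V" using V z by (intro sum_mono2) (auto simp: nbr_def)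
    finally have "?n * z v \<le> ?n * 4" using SV by linarith
    then show ?thesis using n by simp
  qed
  define Z where "Z = sum z W"
  define Y where "Y i = sum z (cls l W i)" for i
  have Zn: "0 \<le> Z" "Z \<le> ?n"
  proof -
    show "0 \<le> Z" unfolding Z_def using z by (intro sum_nonneg) auto
    have "Z \<le> sum z V" unfolding Z_def using V W z by (intro sum_mono2) auto
    then show "Z \<le> ?n" using SV by linarith
  qed
  have sub: "sum z (W - cls l W i) = Z - Y i" for i
    using W(2) unfolding Z_def Y_def by (subst sum_diff) (auto simp: cls_def)
  have ZY: "0 \<le> Z - Y i" "Z - Y i \<le> ?n" for i
  proof -
    show "0 \<le> Z - Y i" unfolding sub[symmetric] using z by (intro sum_nonneg) auto
    have "0 \<le> Y i" unfolding Y_def using z by (intro sum_nonneg) auto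
    then show "Z - Y i \<le> ?n" using Zn by linarith
  qed
  have cX: "real (card (W - cls l W i)) = card W - real (card (cls l W i))" for i
    using W(2) by (subst card_Diff_subset) (auto simp: cls_def card_mono of_nat_diff)
  have lowX: "(1 - 1 / r) * ?n - r * \<gamma> * ?n \<le> card (W - cls l W i)" if i: "i < r" for i
  proof -
    have "real (card W) = (\<Sum>j<r. real (card (cls l W j)))" using card_classes[OF W(2,3)] by simp
    also have "\<dots> = card (cls l W i) + (\<Sum>j\<in>{..<r} - {i}. real (card (cls l W j)))"
      using i by (subst sum.remove[of _ i]) auto
    finally have 1: "real (card W) = card (cls l W i) + (\<Sum>j\<in>{..<r} - {i}. real (card (cls l W j)))" .
    have "(real r - 1) * ((1 / r - \<gamma>) * ?n) = (\<Sum>j\<in>{..<r} - {i}. (1 / r - \<gamma>) * ?n)"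
      using i by (simp add: of_nat_diff)
    also have "\<dots> \<le> (\<Sum>j\<in>{..<r} - {i}. real (card (cls l W j)))"
      using W(5) by (intro sum_mono) auto
    also have "\<dots> = card (W - cls l W i)" using 1 cX[of i] by linarith
    finally have "(real r - 1) * ((1 / r - \<gamma>) * ?n) \<le> card (W - cls l W i)" .
    moreover have "(real r - 1) * ((1 / r - \<gamma>) * ?n) = (1 - 1 / r) * ?n - (real r - 1) * \<gamma> * ?n"
      using r by (simp add: field_simps)
    moreover have "(real r - 1) * \<gamma> * ?n \<le> r * \<gamma> * ?n" using \<gamma> by (intro mult_right_mono) auto
    ultimately show ?thesis by linarith
  qed
  have cWn: "real (card W) \<le> ?n" using W V by (simp add: card_mono)
  have \<gamma>r: "\<gamma> * ?n \<le> r * \<gamma> * ?n"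
    using \<gamma> r by (intro mult_right_mono) (auto simp: mult_le_cancel_right1)
  have upX: "card (W - cls l W i) \<le> (1 - 1 / r) * ?n + r * \<gamma> * ?n" if i: "i < r" for i
  proof -
    have "card (W - cls l W i) \<le> ?n - (1 / r - \<gamma>) * ?n" using cX[of i] W(5)[OF i] cWn by linarith
    then show ?thesis using \<gamma>r by (simp add: algebra_simps)
  qed
  have cls_near: "\<bar>card (cls l W i) - ?n / r\<bar> \<le> r * \<gamma> * ?n" if i: "i < r" for i
    using lowX[OF i] cX[of i] cWn W(5)[OF i] \<gamma>r by (simp add: algebra_simps abs_le_iff)
  have perturb: "\<bar>sum f (nbr V E v) - sum f (W - cls l W (l v))\<bar> \<le> 2 * \<gamma> * ?n * M"
    if v: "v \<in> W" and f: "\<And>w. w \<in> V \<Longrightarrow> 0 \<le> f w \<and> f w \<le> M" and M: "M \<ge> 0" for v f M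
  proof (rule sum_perturb)
    have "card (nbr V E v - (W - cls l W (l v))) \<le> card ((V - W) \<union> {w \<in> W. l w = l v \<and> E v w})"
      using V W by (intro card_mono) (auto simp: nbr_def cls_def)
    also have "\<dots> \<le> card (V - W) + card {w \<in> W. l w = l v \<and> E v w}" by (rule card_Un_le)
    finally show "card (nbr V E v - (W - cls l W (l v))) \<le> 2 * \<gamma> * ?n"
      using W(4) W(7)[OF v] by linarith
    have "card (W - cls l W (l v) - nbr V E v) \<le> card {w \<in> W. l w \<noteq> l v \<and> \<not> E v w}"
      using W by (intro card_mono) (auto simp: nbr_def cls_def)
    moreover have "0 \<le> \<gamma> * ?n" using \<gamma> by simp
    ultimately show "card (W - cls l W (l v) - nbr V E v) \<le> 2 * \<gamma> * ?n"
      using W(6)[OF v] by linarith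
  qed (use V W f M in \<open>auto simp: nbr_def\<close>)
  define D where "D = (1 - 1 / r) * ?n"
  have key: "\<bar>z v * D - (Z - Y (l v))\<bar> \<le> (4 * r + 20) * \<gamma> * ?n" if v: "v \<in> W" for v
  proof -
    have vV: "v \<in> V" using v W by auto
    have "\<bar>dg V E v - card (W - cls l W (l v))\<bar> \<le> 2 * \<gamma> * ?n"
      using perturb[OF v, of "\<lambda>_. 1" 1] by (simp add: dg_def)
    then have "\<bar>dg V E v - D\<bar> \<le> 2 * \<gamma> * ?n + r * \<gamma> * ?n"
      using lowX[OF W(3)[OF v]] upX[OF W(3)[OF v]] by (simp add: D_def)
    moreover have "dens * ?n = 2 * D" by (simp add: D_def dens_def)
    ultimately have "\<bar>(q - dg V E v) - D\<bar> \<le> (r + 3) * \<gamma> * ?n"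
      using q by (simp add: algebra_simps)
    then have "\<bar>((q - dg V E v) - D) * z v\<bar> \<le> (r + 3) * \<gamma> * ?n * 4"
      unfolding abs_mult using z(2)[of v] z4[OF vV] by (intro mult_mono) auto
    moreover have "(q - dg V E v) * z v = sum z (nbr V E v)"
      using eig[OF vV] by (simp add: algebra_simps)
    moreover have "\<bar>sum z (nbr V E v) - (Z - Y (l v))\<bar> \<le> 2 * \<gamma> * ?n * 4"
      using perturb[OF v, of z 4] z4 z by (simp add: sub)
    moreover have "z v * D - (Z - Y (l v)) =
        (sum z (nbr V E v) - (Z - Y (l v))) - ((q - dg V E v) * z v - D * z v)
        + ((q - dg V E v) * z v - sum z (nbr V E v))"
      by (simp add: algebra_simps)
    ultimately show ?thesis by (simp add: algebra_simps)
  qed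
  have Y_near: "\<bar>Y i - Z / r\<bar> \<le> (5 * r + 20) * \<gamma> * ?n" if i: "i < r" for i
  proof -
    let ?c = "real (card (cls l W i))"
    have "\<bar>Y i * D - ?c * (Z - Y i)\<bar> = \<bar>\<Sum>v\<in>cls l W i. z v * D - (Z - Y i)\<bar>"
      by (simp add: Y_def sum_subtractf sum_distrib_right)
    also have "\<dots> \<le> (\<Sum>v\<in>cls l W i. \<bar>z v * D - (Z - Y i)\<bar>)" by (rule sum_abs)
    also have "\<dots> \<le> (\<Sum>v\<in>cls l W i. (4 * r + 20) * \<gamma> * ?n)"
      using key by (intro sum_mono) (auto simp: cls_def)
    also have "\<dots> = ?c * ((4 * r + 20) * \<gamma> * ?n)" by simp
    also have "\<dots> \<le> ?n * ((4 * r + 20) * \<gamma> * ?n)"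
    proof (rule mult_right_mono)
      have "card (cls l W i) \<le> card W" using W(2) by (intro card_mono) (auto simp: cls_def)
      then show "?c \<le> ?n" using cWn by linarith
    qed (use \<gamma> in simp)
    finally have 1: "\<bar>Y i * D - ?c * (Z - Y i)\<bar> \<le> (4 * r + 20) * \<gamma> * ?n * ?n" by (simp add: mult_ac)
    have 2: "\<bar>(?c - ?n / r) * (Z - Y i)\<bar> \<le> r * \<gamma> * ?n * ?n"
      unfolding abs_mult using cls_near[OF i] ZY[of i] by (intro mult_mono) auto
    \<comment> \<open>The identity rests on D + n / r = n; \<open>cls_near\<close> bounds the cost
      of exchanging the class size for n / r.\<close>
    have "(Y i - Z / r) * ?n = (Y i * D - ?c * (Z - Y i)) + (?c - ?n / r) * (Z - Y i)"
      using r by (simp add: D_def field_simps)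
    then have "\<bar>(Y i - Z / r) * ?n\<bar> \<le> \<bar>Y i * D - ?c * (Z - Y i)\<bar> + \<bar>(?c - ?n / r) * (Z - Y i)\<bar>"
      by (simp only: abs_triangle_ineq)
    also have "\<dots> \<le> (4 * r + 20) * \<gamma> * ?n * ?n + r * \<gamma> * ?n * ?n"
      by (rule add_mono[OF 1 2])
    also have "\<dots> = ((5 * r + 20) * \<gamma> * ?n) * ?n" by (simp add: algebra_simps)
    finally show ?thesis using n by (simp add: abs_mult)
  qed
  define \<zeta> where "\<zeta> = Z / ?n"
  define c where "c = (3 / 2) * (9 * r + 40) * \<gamma>"
  have c0: "c \<ge> 0" using \<gamma> by (simp add: c_def)
  have near_mean: "\<bar>z v - \<zeta>\<bar> \<le> c" if v: "v \<in> W" for v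
  proof -
    have "(z v - \<zeta>) * D = (z v * D - (Z - Y (l v))) - (Y (l v) - Z / r)"
      using n by (simp add: D_def \<zeta>_def algebra_simps)
    then have "\<bar>(z v - \<zeta>) * D\<bar> \<le> \<bar>z v * D - (Z - Y (l v))\<bar> + \<bar>Y (l v) - Z / r\<bar>"
      by (simp only: abs_triangle_ineq4)
    also have "\<dots> \<le> (4 * r + 20) * \<gamma> * ?n + (5 * r + 20) * \<gamma> * ?n"
      by (rule add_mono[OF key[OF v] Y_near[OF W(3)[OF v]]])
    also have "\<dots> = (9 * r + 40) * \<gamma> * ?n" by (simp add: algebra_simps)
    finally have 1: "\<bar>z v - \<zeta>\<bar> * D \<le> (9 * r + 40) * \<gamma> * ?n"
      using dens_bounds by (simp add: abs_mult D_def dens_def)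
    have "2 / 3 * ?n \<le> D"
      using dens_bounds n unfolding D_def dens_def by (intro mult_right_mono) auto
    then have "\<bar>z v - \<zeta>\<bar> * (2 / 3 * ?n) \<le> \<bar>z v - \<zeta>\<bar> * D" by (intro mult_left_mono) auto
    then have "(\<bar>z v - \<zeta>\<bar> * (2 / 3)) * ?n \<le> ((9 * r + 40) * \<gamma>) * ?n" using 1 by simp
    then have "\<bar>z v - \<zeta>\<bar> * (2 / 3) \<le> (9 * r + 40) * \<gamma>" using n by simp
    then show ?thesis by (simp add: c_def algebra_simps)
  qed
  have \<zeta>1: "0 \<le> \<zeta>" "\<zeta> \<le> 1" using Zn n by (auto simp: \<zeta>_def)
  \<comment> \<open>The unclassified vertices contribute at most 16 \<gamma> n to the squared norm
    n, which leaves (\<zeta> + c)^2 >= 1 - 16 \<gamma>.\<close>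
  have "\<zeta> \<ge> 1 - 16 * \<gamma> - c"
  proof -
    have "?n = sqnorm W z + sqnorm (V - W) z"
      using z(1) sum.subset_diff[OF W(1) V(1), of "\<lambda>v. (z v)^2"] by (simp add: sqnorm_def)
    moreover have "sqnorm (V - W) z \<le> real (card (V - W)) * 16"
      unfolding sqnorm_def
    proof (rule sum_bounded_above)
      fix v assume "v \<in> V - W"
      then show "(z v)^2 \<le> 16" using power_mono[OF z4[of v] z(2)[of v], of 2] by simp
    qed
    moreover have "sqnorm W z \<le> card W * (\<zeta> + c)^2"
      unfolding sqnorm_def
    proof (rule sum_bounded_above)
      fix v assume "v \<in> W"
      then have "z v \<le> \<zeta> + c" using near_mean[of v] by linarith
      then show "(z v)^2 \<le> (\<zeta> + c)^2" using z(2)[of v] by (rule power_mono)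
    qed
    moreover have "card W * (\<zeta> + c)^2 \<le> ?n * (\<zeta> + c)^2" using cWn by (intro mult_right_mono) auto
    ultimately have "?n \<le> ?n * (\<zeta> + c)^2 + \<gamma> * ?n * 16" using W(4) by linarith
    then have "?n * (1 - 16 * \<gamma>) \<le> ?n * (\<zeta> + c)^2" by (simp add: algebra_simps)
    then have "1 - 16 * \<gamma> \<le> (\<zeta> + c)^2" using n by simp
    moreover have "(1 - 16 * \<gamma>)^2 \<le> 1 - 16 * \<gamma>"
      using \<gamma> by (simp add: power2_eq_square mult_left_le)
    ultimately have "(1 - 16 * \<gamma>)^2 \<le> (\<zeta> + c)^2" by linarith
    then have "1 - 16 * \<gamma> \<le> \<zeta> + c" by (rule power2_le_imp_le) (use \<zeta>1 c0 in simp)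
    then show ?thesis by simp
  qed
  \<comment> \<open>The constant 75 comes from 27 r + 136 <= 75 r, valid for r >= 3.\<close>
  moreover have "2 * c + 16 * \<gamma> \<le> 75 * r * \<gamma>"
  proof -
    have "2 * c + 16 * \<gamma> = (27 * r + 136) * \<gamma>" by (simp add: c_def algebra_simps)
    also have "\<dots> \<le> 75 * r * \<gamma>" using r \<gamma> by (intro mult_right_mono) auto
    finally show ?thesis .
  qed
  ultimately show "\<bar>z v - 1\<bar> \<le> 75 * r * \<gamma>" if "v \<in> W" for v
    using near_mean[OF that] \<zeta>1 c0 \<gamma> by (simp add: abs_le_iff)
qed

section \<open>Replacing the neighbourhood of one vertex\<close>

definition rewire :: "(nat \<Rightarrow> nat \<Rightarrow> bool) \<Rightarrow> nat \<Rightarrow> nat set \<Rightarrow> nat \<Rightarrow> nat \<Rightarrow> bool" where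
  "rewire E v S = (\<lambda>u w. if u = v then w \<in> S else if w = v then u \<in> S else E u w)"

lemma sym_irrefl_rewire: "sym_irrefl E \<Longrightarrow> v \<notin> S \<Longrightarrow> sym_irrefl (rewire E v S)"
  by (auto simp: sym_irrefl_def rewire_def)

lemma qform_rewire:
  assumes "finite V" "sym_irrefl E" "v \<in> V" "S \<subseteq> V" "v \<notin> S"
  shows "qform V (rewire E v S) x = qform V E x + (\<Sum>w\<in>S. (x v + x w)^2) - (\<Sum>w\<in>nbr V E v. (x v + x w)^2)"
proof -
  have "nbr V (rewire E v S) v = S" using assms by (auto simp: nbr_def rewire_def)
  moreover have "qform (V - {v}) (rewire E v S) x = qform (V - {v}) E x"
    unfolding qform_def by (intro arg_cong2[where f = "(/)"] sum.cong) (auto simp: rewire_def)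
  ultimately show ?thesis
    using qform_remove[OF assms(1-3), of x] qform_remove[OF assms(1) sym_irrefl_rewire[OF assms(2,5)] assms(3), of x]
    by simp
qed

text \<open>A copy of \<open>F\<close> through the rewired vertex \<open>v\<close> survives when \<open>v\<close> is exchanged for an unused
  vertex of the class \<open>i\<close> that sees all the neighbours used.\<close>

lemma free_rewire:
  fixes \<gamma> :: real
  assumes fr: "free_on V E" and st: "struct \<gamma> V E W l" and v: "v \<in> V" and i: "i < r"
    and big: "(1 / r - \<gamma>) * card V > card (verts F) * (\<gamma> * card V + 1)" and \<gamma>: "\<gamma> \<ge> 0"
  shows "free_on V (rewire E v {w \<in> W. l w \<noteq> i \<and> w \<noteq> v})"
proof -
  let ?S = "{w \<in> W. l w \<noteq> i \<and> w \<noteq> v}" and ?n = "real (card V)"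
  let ?E = "rewire E v ?S"
  have V: "finite V" "sym_irrefl E" and nE: "\<not> embeds F V E" using fr by (auto simp: free_on_def)
  have W: "W \<subseteq> V" "finite W" "card (cls l W i) \<ge> (1 / r - \<gamma>) * ?n"
    "\<And>v. v \<in> W \<Longrightarrow> card {w \<in> W. l w \<noteq> l v \<and> \<not> E v w} \<le> \<gamma> * ?n"
    using st V i finite_subset by (auto simp: struct_def)
  have fF: "finite (verts F)" using F by (simp add: simple_graph_def)
  have "\<not> embeds F V ?E"
  proof
    assume "embeds F V ?E"
    then obtain f where f: "inj_on f (verts F)" "f ` verts F \<subseteq> V" "\<And>a b. {a, b} \<in> edges F \<Longrightarrow> ?E (f a) (f b)"
      unfolding embeds_def by blast
    define T where "T = f ` verts F"
    have T: "finite T" "card T \<le> card (verts F)" using fF by (auto simp: T_def card_image_le)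
    \<comment> \<open>The vertices unfit to replace v: those used by the copy, and those missing a
      used vertex of W outside class i. By \<open>big\<close>, class i is not exhausted by
      them.\<close>
    define B where "B = T \<union> (\<Union>s\<in>{s \<in> T \<inter> W. l s \<noteq> i}. {w \<in> W. l w \<noteq> l s \<and> \<not> E s w})"
    have fB: "finite B" using T W by (auto simp: B_def)
    have "card B \<le> card T + (\<Sum>s\<in>{s \<in> T \<inter> W. l s \<noteq> i}. card {w \<in> W. l w \<noteq> l s \<and> \<not> E s w})"
    proof -
      have "card B \<le> card T + card (\<Union>s\<in>{s \<in> T \<inter> W. l s \<noteq> i}. {w \<in> W. l w \<noteq> l s \<and> \<not> E s w})"
        unfolding B_def by (rule card_Un_le)
      also have "\<dots> \<le> card T + (\<Sum>s\<in>{s \<in> T \<inter> W. l s \<noteq> i}. card {w \<in> W. l w \<noteq> l s \<and> \<not> E s w})"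
        using T by (intro add_left_mono card_UN_le) auto
      finally show ?thesis .
    qed
    then have "real (card B) \<le> card T + (\<Sum>s\<in>{s \<in> T \<inter> W. l s \<noteq> i}. real (card {w \<in> W. l w \<noteq> l s \<and> \<not> E s w}))"
      unfolding of_nat_sum[symmetric] by linarith
    also have "(\<Sum>s\<in>{s \<in> T \<inter> W. l s \<noteq> i}. real (card {w \<in> W. l w \<noteq> l s \<and> \<not> E s w})) \<le> (\<Sum>s\<in>{s \<in> T \<inter> W. l s \<noteq> i}. \<gamma> * ?n)"
      using W(4) by (intro sum_mono) auto
    also have "\<dots> = card {s \<in> T \<inter> W. l s \<noteq> i} * (\<gamma> * ?n)" by simp
    also have "\<dots> \<le> card T * (\<gamma> * ?n)"
      using T \<gamma> by (intro mult_right_mono of_nat_mono card_mono) auto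
    also have "card T + card T * (\<gamma> * ?n) = card T * (\<gamma> * ?n + 1)" by (simp add: algebra_simps)
    also have "\<dots> \<le> card (verts F) * (\<gamma> * ?n + 1)"
      using T \<gamma> by (intro mult_right_mono) auto
    finally have "card B < card (cls l W i)" using big W(3) by linarith
    then have "\<not> cls l W i \<subseteq> B" using card_mono[OF fB] by (meson not_le)
    then obtain v' where v': "v' \<in> W" "l v' = i" "v' \<notin> B" by (auto simp: cls_def)
    have v'T: "v' \<notin> T" using v' by (simp add: B_def)
    have v'E: "E v' s" if "s \<in> T" "s \<in> W" "l s \<noteq> i" for s
      using v' that V(2) by (auto simp: B_def sym_irrefl_def)
    define g where "g = (\<lambda>a. if f a = v then v' else f a)"
    have gf: "f a \<in> T" if "a \<in> verts F" for a using that by (simp add: T_def)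
    have "inj_on g (verts F)"
    proof (rule inj_onI)
      fix a b assume ab: "a \<in> verts F" "b \<in> verts F" "g a = g b"
      then show "a = b" using gf[of a] gf[of b] v'T inj_onD[OF f(1), of a b]
        by (auto simp: g_def split: if_splits)
    qed
    moreover have "g ` verts F \<subseteq> V" using f(2) v' W(1) by (auto simp: g_def)
    moreover have "E (g a) (g b)" if e: "{a, b} \<in> edges F" for a b
    proof -
      have ab: "a \<in> verts F" "b \<in> verts F" "a \<noteq> b" using simple_graph_edgeD[OF F e] by auto
      have ne: "f a \<noteq> f b" using f(1) ab by (auto dest: inj_onD)
      have sy: "E x y \<Longrightarrow> E y x" for x y using V by (auto simp: sym_irrefl_def)
      from f(3)[OF e] show ?thesis
        using v'E[OF gf[OF ab(1)]] v'E[OF gf[OF ab(2)]] ne sy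
        by (auto simp: g_def rewire_def split: if_splits)
    qed
    ultimately have "embeds F V E" unfolding embeds_def by blast
    with nE show False ..
  qed
  moreover have "sym_irrefl ?E" by (rule sym_irrefl_rewire[OF V(2)]) simp
  ultimately show ?thesis using V by (simp add: free_on_def)
qed

end

section \<open>The structure of spectral extremal graphs\<close>

context extremal_bound
begin

definition q_extremal :: "nat set \<Rightarrow> (nat \<Rightarrow> nat \<Rightarrow> bool) \<Rightarrow> bool" where
  "q_extremal V E \<longleftrightarrow> free_on V E \<and> (\<forall>E'. free_on V E' \<longrightarrow> qmax V E' \<le> qmax V E)"

text \<open>The old maximiser is a test vector for the rewired graph, so by extremality the gained
  edges cannot outweigh the lost ones.\<close>

lemma rewire_sum_le:
  assumes ex: "q_extremal V E" and x: "sqnorm V x = 1" "qform V E x = qmax V E"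
    and S: "v \<in> V" "S \<subseteq> V" "v \<notin> S" and fr: "free_on V (rewire E v S)"
  shows "(\<Sum>w\<in>S - nbr V E v. (x v + x w)^2) \<le> (\<Sum>w\<in>nbr V E v - S. (x v + x w)^2)"
proof -
  have V: "finite V" "sym_irrefl E" using ex by (auto simp: q_extremal_def free_on_def)
  have fS: "finite S" using S V finite_subset by blast
  have "qform V (rewire E v S) x \<le> qmax V (rewire E v S) * sqnorm V x"
    using fr by (intro qform_le_qmax) (auto simp: free_on_def)
  also have "\<dots> \<le> qmax V E" using ex fr x by (simp add: q_extremal_def)
  finally have "(\<Sum>w\<in>S. (x v + x w)^2) - (\<Sum>w\<in>nbr V E v. (x v + x w)^2) \<le> 0"
    using qform_rewire[OF V S, of x] x by simp
  then show ?thesis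
    using sum_diff_Diff[OF fS finite_nbr[OF V(1)], of "\<lambda>w. (x v + x w)^2"] by simp
qed

text \<open>A vertex missing many vertices of two classes could be rewired so as to increase the Rayleigh
  quotient.\<close>

lemma struct_whole:
  fixes \<gamma> :: real
  assumes ex: "q_extremal V E" and st: "struct \<gamma> V E W l"
    and x: "sqnorm V x = 1" "qform V E x = qmax V E" "\<And>v. v \<in> V \<Longrightarrow> x v \<ge> 0"
    and z4: "\<And>v. v \<in> V \<Longrightarrow> sqrt (card V) * x v \<le> 4"
    and zW: "\<And>v. v \<in> W \<Longrightarrow> sqrt (card V) * x v \<ge> 1 / 2"
    and \<gamma>: "\<gamma> > 0" and n: "\<gamma> * card V \<ge> 1"
    and big: "(1 / r - \<gamma>) * card V > card (verts F) * (\<gamma> * card V + 1)"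
  shows "\<exists>l. struct (257 * (2 + 2 * r * N\<^sub>1) * \<gamma>) V E V l"
proof -
  let ?n = "real (card V)"
  define z where "z v = sqrt ?n * x v" for v
  define b where "b = (1 + 2 * r * N\<^sub>1) * \<gamma> * ?n"
  have fr: "free_on V E" using ex by (simp add: q_extremal_def)
  have V: "finite V" "sym_irrefl E" using fr by (auto simp: free_on_def)
  have n0: "?n > 0" using n \<gamma> by (metis linorder_not_le mult_nonneg_nonpos less_eq_real_def not_one_le_zero of_nat_0_le_iff order_trans)
  have W: "W \<subseteq> V" "finite W" "\<And>v. v \<in> W \<Longrightarrow> l v < r" "card (V - W) \<le> \<gamma> * ?n"
    "\<And>i. i < r \<Longrightarrow> card (cls l W i) \<ge> (1 / r - \<gamma>) * ?n"
    "\<And>v. v \<in> W \<Longrightarrow> card {w \<in> W. l w \<noteq> l v \<and> \<not> E v w} \<le> \<gamma> * ?n"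
    "\<And>v. v \<in> W \<Longrightarrow> card {w \<in> W. l w = l v \<and> E v w} \<le> \<gamma> * ?n"
    using st V finite_subset by (auto simp: struct_def)
  have b: "b \<ge> \<gamma> * ?n" "b \<ge> 0"
  proof -
    have "1 * (\<gamma> * ?n) \<le> (1 + 2 * r * N\<^sub>1) * (\<gamma> * ?n)" using \<gamma> by (intro mult_right_mono) auto
    then show "b \<ge> \<gamma> * ?n" by (simp add: b_def mult_ac)
    then show "b \<ge> 0" using n by linarith
  qed
  have poor: "\<exists>i<r. card {w \<in> W. l w = i \<and> E v w} \<le> 2 * r * N\<^sub>1 * (\<gamma> * ?n)" if v: "v \<in> V" for v
  proof -
    have "\<exists>i<r. card {w \<in> cls l W i. E v w} \<le> r * N\<^sub>1 * (\<gamma> * ?n + 1)"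
    proof (rule poor_class_exists[OF fr v W(1,3)])
      fix s i assume s: "s \<in> W" "i < r" "i \<noteq> l s"
      have "card {w \<in> cls l W i. \<not> E s w} \<le> card {w \<in> W. l w \<noteq> l s \<and> \<not> E s w}"
        using W s by (intro card_mono) (auto simp: cls_def)
      then show "card {w \<in> cls l W i. \<not> E s w} \<le> \<gamma> * ?n" using W(6)[OF s(1)] by linarith
    qed (use \<gamma> in auto)
    then obtain i where i: "i < r" "card {w \<in> cls l W i. E v w} \<le> r * N\<^sub>1 * (\<gamma> * ?n + 1)" by blast
    have "r * N\<^sub>1 * (\<gamma> * ?n + 1) \<le> r * N\<^sub>1 * (2 * (\<gamma> * ?n))"
      using n by (intro mult_left_mono) auto
    then have "card {w \<in> cls l W i. E v w} \<le> 2 * r * N\<^sub>1 * (\<gamma> * ?n)" using i(2) by (simp add: mult_ac)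
    moreover have "{w \<in> cls l W i. E v w} = {w \<in> W. l w = i \<and> E v w}" by (auto simp: cls_def)
    ultimately show ?thesis using i(1) by auto
  qed
  \<comment> \<open>Rewire v to all of W outside its poor class i. At most b edges are lost, each of
    weight at most (4 + 4)^2 = 64, while each gained edge weighs at least (1/2)^2 = 1/4; hence at
    most 256 b edges are gained. Unclassified vertices later raise this to 257 b.\<close>
  have miss: "card {w \<in> W. l w \<noteq> i \<and> \<not> E v w} \<le> 256 * b"
    if v: "v \<in> V - W" and i: "i < r" "card {w \<in> W. l w = i \<and> E v w} \<le> 2 * r * N\<^sub>1 * (\<gamma> * ?n)" for v i
  proof -
    let ?S = "{w \<in> W. l w \<noteq> i \<and> w \<noteq> v}"
    have vV: "v \<in> V" using v by simp
    have S: "?S \<subseteq> V" "v \<notin> ?S" using W by auto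
    have "free_on V (rewire E v ?S)" by (rule free_rewire[OF fr st vV i(1) big]) (use \<gamma> in simp)
    then have le: "(\<Sum>w\<in>?S - nbr V E v. (x v + x w)^2) \<le> (\<Sum>w\<in>nbr V E v - ?S. (x v + x w)^2)"
      by (rule rewire_sum_le[OF ex x(1,2) vV S])
    have zz: "(z v + z w)^2 = ?n * (x v + x w)^2" for w
      by (simp add: z_def distrib_left[symmetric] power_mult_distrib)
    have "(\<Sum>w\<in>?S - nbr V E v. (z v + z w)^2) \<le> (\<Sum>w\<in>nbr V E v - ?S. (z v + z w)^2)"
      unfolding zz sum_distrib_left[symmetric] using le by (intro mult_left_mono) auto
    also have "\<dots> \<le> real (card (nbr V E v - ?S)) * 64"
    proof (rule sum_bounded_above)
      fix w assume "w \<in> nbr V E v - ?S"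
      then have "w \<in> V" by (auto simp: nbr_def)
      then have "0 \<le> z v + z w" "z v + z w \<le> 8"
        using z4[OF vV] z4[of w] x(3)[OF vV] x(3)[of w] by (auto simp: z_def)
      then show "(z v + z w)^2 \<le> 64" using power_mono[of "z v + z w" 8 2] by simp
    qed
    also have "real (card (nbr V E v - ?S)) \<le> b"
    proof -
      have "nbr V E v - ?S \<subseteq> (V - W) \<union> {w \<in> W. l w = i \<and> E v w}"
        using v by (auto simp: nbr_def)
      then have "card (nbr V E v - ?S) \<le> card ((V - W) \<union> {w \<in> W. l w = i \<and> E v w})"
        using V W by (intro card_mono) auto
      also have "\<dots> \<le> card (V - W) + card {w \<in> W. l w = i \<and> E v w}" by (rule card_Un_le)
      finally have "real (card (nbr V E v - ?S)) \<le> \<gamma> * ?n + 2 * r * N\<^sub>1 * (\<gamma> * ?n)" using W(4) i(2) by linarith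
      then show ?thesis by (simp add: b_def algebra_simps)
    qed
    finally have up: "(\<Sum>w\<in>?S - nbr V E v. (z v + z w)^2) \<le> b * 64" by simp
    have "real (card (?S - nbr V E v)) * (1 / 4) \<le> (\<Sum>w\<in>?S - nbr V E v. (z v + z w)^2)"
    proof (rule sum_bounded_below)
      fix w assume "w \<in> ?S - nbr V E v"
      then have "1 / 2 \<le> z w" using zW[of w] by (auto simp: z_def)
      moreover have "0 \<le> z v" using x(3)[OF vV] by (simp add: z_def)
      ultimately have "1 / 2 \<le> z v + z w" by linarith
      then show "1 / 4 \<le> (z v + z w)^2" using power_mono[of "1 / 2" "z v + z w" 2] by (simp add: power2_eq_square)
    qed
    moreover have "?S - nbr V E v = {w \<in> W. l w \<noteq> i \<and> \<not> E v w}"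
      using v W by (auto simp: nbr_def)
    ultimately show ?thesis using up by simp
  qed
  obtain c where c: "\<And>v. v \<in> V \<Longrightarrow> c v < r"
    "\<And>v. v \<in> V \<Longrightarrow> card {w \<in> W. l w = c v \<and> E v w} \<le> 2 * r * N\<^sub>1 * (\<gamma> * ?n)"
    using poor by metis
  define l' where "l' = (\<lambda>v. if v \<in> W then l v else c v)"
  have cross: "card {w \<in> W. l w \<noteq> l' v \<and> \<not> E v w} \<le> 256 * b" if "v \<in> V" for v
    using miss[of v "c v"] c[OF that] that W(6)[of v] b by (auto simp: l'_def)
  have intl: "card {w \<in> W. l w = l' v \<and> E v w} \<le> 256 * b" if "v \<in> V" for v
  proof -
    have "2 * r * N\<^sub>1 * (\<gamma> * ?n) \<le> b" using n by (simp add: b_def algebra_simps)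
    then show ?thesis using c(2)[OF that] W(7)[of v] b by (auto simp: l'_def)
  qed
  have ext: "real (card {w \<in> V. P w}) \<le> 257 * b" if "card {w \<in> W. P w} \<le> 256 * b" for P
  proof -
    have "card {w \<in> V. P w} \<le> card ((V - W) \<union> {w \<in> W. P w})"
      using V W by (intro card_mono) auto
    also have "\<dots> \<le> card (V - W) + card {w \<in> W. P w}" by (rule card_Un_le)
    finally show ?thesis using that W(4) b by linarith
  qed
  have tot: "257 * b \<le> 257 * (2 + 2 * r * N\<^sub>1) * \<gamma> * ?n"
    using n by (simp add: b_def algebra_simps)
  have "struct (257 * (2 + 2 * r * N\<^sub>1) * \<gamma>) V E V l'"
    unfolding struct_def
  proof (intro conjI ballI allI impI)
    show "l' v < r" if "v \<in> V" for v using that c W by (auto simp: l'_def)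
    show "real (card (V - V)) \<le> 257 * (2 + 2 * r * N\<^sub>1) * \<gamma> * ?n" using tot b by simp
    show "(1 / r - 257 * (2 + 2 * r * N\<^sub>1) * \<gamma>) * ?n \<le> card (cls l' V i)" if "i < r" for i
    proof -
      have "card (cls l W i) \<le> card (cls l' V i)"
        using V W by (intro card_mono) (auto simp: cls_def l'_def)
      moreover have "(1 / r - 257 * (2 + 2 * r * N\<^sub>1) * \<gamma>) * ?n \<le> (1 / r - \<gamma>) * ?n"
        using tot b by (simp add: algebra_simps)
      ultimately show ?thesis using W(5)[OF that] by linarith
    qed
    show "real (card {w \<in> V. l' w \<noteq> l' v \<and> \<not> E v w}) \<le> 257 * (2 + 2 * r * N\<^sub>1) * \<gamma> * ?n" if "v \<in> V" for v
    proof -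
      have "{w \<in> W. l' w \<noteq> l' v \<and> \<not> E v w} = {w \<in> W. l w \<noteq> l' v \<and> \<not> E v w}" by (auto simp: l'_def)
      then show ?thesis using ext[of "\<lambda>w. l' w \<noteq> l' v \<and> \<not> E v w"] cross[OF that] tot by simp
    qed
    show "real (card {w \<in> V. l' w = l' v \<and> E v w}) \<le> 257 * (2 + 2 * r * N\<^sub>1) * \<gamma> * ?n" if "v \<in> V" for v
    proof -
      have "{w \<in> W. l' w = l' v \<and> E v w} = {w \<in> W. l w = l' v \<and> E v w}" by (auto simp: l'_def)
      then show ?thesis using ext[of "\<lambda>w. l' w = l' v \<and> E v w"] intl[OF that] tot by simp
    qed
  qed simp
  then show ?thesis by blast
qed

text \<open>Pair \<open>K\<^sub>0\<close> such vertices with internal neighbours. The resulting set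
  has at most 2 \<open>K\<^sub>0\<close> vertices, which fit into a class of size
  \<open>N\<^sub>1\<close> + \<open>K\<^sub>0\<close>, and internal degree sum at least
  \<open>K\<^sub>0\<close> > C.\<close>

lemma internal_vertices_bound:
  fixes \<gamma> :: real
  assumes fr: "free_on V E" and st: "struct \<gamma> V E V l" and i: "i < r" and \<gamma>: "\<gamma> \<ge> 0"
    and big: "(1 / r - \<gamma>) * card V > real (r * (N\<^sub>1 + K\<^sub>0)) * (\<gamma> * card V + 1)"
  shows "card {v \<in> cls l V i. \<exists>w\<in>cls l V i. E v w} < K\<^sub>0"
proof (rule ccontr)
  let ?B = "{v \<in> cls l V i. \<exists>w\<in>cls l V i. E v w}" and ?n = "real (card V)"
  assume "\<not> card ?B < K\<^sub>0"
  then have "K\<^sub>0 \<le> card ?B" by simp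
  then obtain B where B: "B \<subseteq> ?B" "card B = K\<^sub>0" "finite B" by (rule obtain_subset_with_card_n)
  have "\<forall>v\<in>B. \<exists>w. w \<in> cls l V i \<and> E v w" using B by blast
  then obtain p where p: "\<And>v. v \<in> B \<Longrightarrow> p v \<in> cls l V i \<and> E v (p v)" by metis
  define A where "A = B \<union> p ` B"
  have V: "finite V" "sym_irrefl E" using fr by (auto simp: free_on_def)
  have A: "finite A" "A \<subseteq> cls l V i" "card A \<le> K\<^sub>0 + K\<^sub>0"
  proof -
    show "finite A" "A \<subseteq> cls l V i" using B p by (auto simp: A_def)
    have "card A \<le> card B + card (p ` B)" unfolding A_def by (rule card_Un_le)
    then show "card A \<le> K\<^sub>0 + K\<^sub>0" using card_image_le[OF B(3), of p] B by simp
  qed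
  have "(\<Sum>v\<in>A. card {w \<in> A. E v w \<and> l w = l v}) \<le> C"
  proof (rule internal_edges_le[OF fr, where Q = V and N = "N\<^sub>1 + K\<^sub>0" and \<mu> = "\<gamma> * ?n"])
    show "A \<subseteq> V" using A by (auto simp: cls_def)
    show "l v < r" if "v \<in> A \<union> V" for v using that A st by (auto simp: struct_def cls_def)
    show "cross_complete E l A" using A by (auto simp: cross_complete_def cls_def)
    show "card (cls l A j) \<le> N\<^sub>1 + K\<^sub>0" for j
    proof -
      have "card (cls l A j) \<le> card A" using A by (intro card_mono) (auto simp: cls_def)
      then show ?thesis using A by (simp add: N\<^sub>1_def)
    qed
    show "N\<^sub>1 + K\<^sub>0 \<ge> N\<^sub>0" by (simp add: N\<^sub>1_def)
    show "card {w \<in> cls l V j. \<not> E s w} \<le> \<gamma> * ?n" if "s \<in> A \<union> V" "j < r" "j \<noteq> l s" for s j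
    proof -
      have "s \<in> V" using that A by (auto simp: cls_def)
      have "card {w \<in> cls l V j. \<not> E s w} \<le> card {w \<in> V. l w \<noteq> l s \<and> \<not> E s w}"
        using V that by (intro card_mono) (auto simp: cls_def)
      moreover have "card {w \<in> V. l w \<noteq> l s \<and> \<not> E s w} \<le> \<gamma> * ?n"
        using st \<open>s \<in> V\<close> by (simp add: struct_def)
      ultimately show ?thesis by linarith
    qed
    show "r * (N\<^sub>1 + K\<^sub>0) * (\<gamma> * ?n + 1) < card (cls l V j)" if "j < r" for j
    proof -
      have "(1 / r - \<gamma>) * ?n \<le> card (cls l V j)" using st that by (simp add: struct_def)
      then show ?thesis using big by linarith
    qed
  qed (use \<gamma> in auto)
  moreover have "card B \<le> (\<Sum>v\<in>A. card {w \<in> A. E v w \<and> l w = l v})"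
  proof -
    have "card B = (\<Sum>v\<in>B. 1)" by simp
    also have "\<dots> \<le> (\<Sum>v\<in>B. card {w \<in> A. E v w \<and> l w = l v})"
    proof (rule sum_mono)
      fix v assume v: "v \<in> B"
      have "p v \<in> {w \<in> A. E v w \<and> l w = l v}"
        using p[OF v] v B by (auto simp: A_def cls_def)
      then have "card {w \<in> A. E v w \<and> l w = l v} \<noteq> 0" using A by auto
      then show "1 \<le> card {w \<in> A. E v w \<and> l w = l v}" by simp
    qed
    also have "\<dots> \<le> (\<Sum>v\<in>A. card {w \<in> A. E v w \<and> l w = l v})"
      using A by (intro sum_mono2) (auto simp: A_def)
    finally show ?thesis .
  qed
  ultimately show False using K\<^sub>0_gt B(2) by linarith
qed

lemma eventually_linear:
  fixes a b :: real
  assumes "a > 0"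
  obtains n\<^sub>1 :: nat where "\<And>n::nat. n \<ge> n\<^sub>1 \<Longrightarrow> a * n \<ge> b"
proof (rule that[of "nat \<lceil>b / a\<rceil>"])
  fix n :: nat assume "n \<ge> nat \<lceil>b / a\<rceil>"
  then have "b / a \<le> n" by linarith
  then show "a * n \<ge> b" using assms by (simp add: field_simps)
qed

text \<open>Only u has to avoid B, so by symmetry of E every deviation from the complete r-partite
  graph is a pair inside B. The bound on the size of B is independent of \<kappa>, so \<kappa> can
  later be chosen small against it.\<close>

definition near_complete :: "real \<Rightarrow> nat set \<Rightarrow> (nat \<Rightarrow> nat \<Rightarrow> bool) \<Rightarrow> bool" where
  "near_complete \<kappa> V E \<longleftrightarrow> (\<exists>l B x. B \<subseteq> V \<and> card B \<le> r * K\<^sub>0 \<and> (\<forall>v\<in>V. l v < r) \<and>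
     (\<forall>i<r. real (card (cls l V i)) \<ge> (1 / r - \<kappa>) * real (card V)) \<and>
     (\<forall>u\<in>V. \<forall>w\<in>V. u \<notin> B \<longrightarrow> (E u w \<longleftrightarrow> l u \<noteq> l w)) \<and>
     sqnorm V x = 1 \<and> qform V E x = qmax V E \<and> (\<forall>v\<in>V. \<bar>sqrt (card V) * x v - 1\<bar> \<le> \<kappa>))"

text \<open>A bootstrap: the partial structure bounds the Perron entries by 4 from above and, on W,
  by 1/2 from below, which lets \<open>struct_whole\<close> classify every vertex. A second use of
  \<open>eigenvector_near_constant\<close>, now on the whole set, brings all entries close to 1. The
  set B collects the vertices with an internal edge.\<close>

lemma near_complete_multipartite:
  fixes \<kappa> :: real
  assumes "0 < \<kappa>"
  obtains n\<^sub>1 where "\<And>V E. q_extremal V E \<Longrightarrow> phi V E \<ge> dens \<Longrightarrow> card V \<ge> n\<^sub>1 \<Longrightarrow>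
    near_complete \<kappa> V E"
proof -
  define R where "R = real r"
  have R: "R \<ge> 3" using r by (simp add: R_def)
  define M where "M = real (r * (N\<^sub>1 + K\<^sub>0)) + card (verts F) + 1"
  have M: "M \<ge> 1" by (simp add: M_def)
  \<comment> \<open>The three bounds make the entries accurate to \<kappa>, the classes large in the
    sense of \<open>bigg\<close>, and 75 r \<gamma>' at most 1/2. Dividing by D below pays for the
    loss in \<open>struct_whole\<close>.\<close>
  define \<gamma>' where "\<gamma>' = min (\<kappa> / (75 * R)) (min (1 / (4 * R * M)) (1 / (300 * R)))"
  have \<gamma>': "0 < \<gamma>'" "\<gamma>' \<le> \<kappa> / (75 * R)" "\<gamma>' \<le> 1 / (4 * R * M)" "\<gamma>' \<le> 1 / (300 * R)"
  proof -
    show "0 < \<gamma>'" using assms R M by (simp add: \<gamma>'_def)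
    show "\<gamma>' \<le> \<kappa> / (75 * R)" unfolding \<gamma>'_def by (rule min.cobounded1)
    show "\<gamma>' \<le> 1 / (4 * R * M)" unfolding \<gamma>'_def by (rule min.coboundedI2, rule min.cobounded1)
    show "\<gamma>' \<le> 1 / (300 * R)" unfolding \<gamma>'_def by (rule min.coboundedI2, rule min.cobounded2)
  qed
  define D where "D = 257 * (2 + 2 * r * N\<^sub>1)"
  have D: "real D \<ge> 1" by (simp add: D_def)
  define \<gamma> where "\<gamma> = \<gamma>' / D"
  have \<gamma>: "0 < \<gamma>" "\<gamma> \<le> \<gamma>'" "257 * (2 + 2 * r * N\<^sub>1) * \<gamma> = \<gamma>'"
  proof -
    show "0 < \<gamma>" using \<gamma>'(1) D by (simp add: \<gamma>_def)
    have "\<gamma>' * 1 \<le> \<gamma>' * D" using \<gamma>'(1) D by (intro mult_left_mono) auto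
    then show "\<gamma> \<le> \<gamma>'" using D by (simp add: \<gamma>_def divide_le_eq)
    show "257 * (2 + 2 * r * N\<^sub>1) * \<gamma> = \<gamma>'" using D unfolding \<gamma>_def D_def[symmetric] by simp
  qed
  obtain n\<^sub>2 where n\<^sub>2: "\<And>V E. free_on V E \<Longrightarrow> card V \<ge> n\<^sub>2 \<Longrightarrow> phi V E \<ge> dens \<Longrightarrow> \<exists>W l. struct \<gamma> V E W l"
    using struct_exists[OF \<gamma>(1)] by metis
  obtain n\<^sub>3 where n\<^sub>3: "\<And>V E. free_on V E \<Longrightarrow> card V \<ge> n\<^sub>3 \<Longrightarrow> phi V E \<le> dens + \<gamma>"
    using phi_upper[OF \<gamma>(1)] by metis
  obtain n\<^sub>4 :: nat where n\<^sub>4: "\<And>n::nat. n \<ge> n\<^sub>4 \<Longrightarrow> \<gamma> * n \<ge> 2"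
    using eventually_linear[OF \<gamma>(1)] by metis
  have "1 / (2 * R) > 0" using R by simp
  then obtain n\<^sub>5 :: nat where n\<^sub>5: "\<And>n::nat. n \<ge> n\<^sub>5 \<Longrightarrow> 1 / (2 * R) * n \<ge> M + 1"
    using eventually_linear by metis
  show ?thesis
  proof (rule that[of "Max {2, n\<^sub>2, n\<^sub>3, n\<^sub>4, n\<^sub>5}"])
    fix V E assume ex: "q_extremal V E" and p: "phi V E \<ge> dens" and n: "card V \<ge> Max {2, n\<^sub>2, n\<^sub>3, n\<^sub>4, n\<^sub>5}"
    have n': "card V \<ge> 2" "card V \<ge> n\<^sub>2" "card V \<ge> n\<^sub>3" "card V \<ge> n\<^sub>4" "card V \<ge> n\<^sub>5" using n by simp_all
    let ?n = "real (card V)"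
    have fr: "free_on V E" using ex by (simp add: q_extremal_def)
    have V: "finite V" "sym_irrefl E" using fr by (auto simp: free_on_def)
    have ne: "V \<noteq> {}" using n'(1) by auto
    have n2: "?n \<ge> 2" using n'(1) by simp
    obtain x where x: "sqnorm V x = 1" "qform V E x = qmax V E" "\<And>v. x v \<ge> 0"
      using qmax_attained[OF V(1) ne V(2)] by blast
    define z where "z v = sqrt ?n * x v" for v
    have z: "sqnorm V z = ?n" "\<And>v. z v \<ge> 0"
      using x sqnorm_scale[of V "sqrt ?n" x] by (auto simp: z_def[abs_def])
    have eig: "qmax V E * z v = dg V E v * z v + (\<Sum>w\<in>nbr V E v. z w)" if "v \<in> V" for v
    proof -
      have "qmax V E * z v = sqrt ?n * (qmax V E * x v)" by (simp add: z_def)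
      also have "qmax V E * x v = dg V E v * x v + (\<Sum>w\<in>nbr V E v. x w)" by (rule qmax_eigen[OF V x(1,2) that])
      finally show ?thesis by (simp add: z_def algebra_simps sum_distrib_left)
    qed
    have gn: "\<gamma> * ?n \<ge> 2" using n\<^sub>4[OF n'(4)] .
    have "\<bar>qmax V E - dens * ?n\<bar> \<le> \<gamma> * ?n"
    proof -
      have q: "qmax V E = phi V E * (?n - 1)" using n2 by (simp add: phi_def)
      have "phi V E * (?n - 1) \<le> (dens + \<gamma>) * (?n - 1)" using n\<^sub>3[OF fr n'(3)] n2 by (intro mult_right_mono) auto
      also have "\<dots> \<le> (dens + \<gamma>) * ?n" using dens_bounds \<gamma> by (intro mult_left_mono) auto
      finally have "qmax V E \<le> dens * ?n + \<gamma> * ?n" using q by (simp add: algebra_simps)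
      moreover have "dens * (?n - 1) \<le> phi V E * (?n - 1)" using p n2 by (intro mult_right_mono) auto
      then have "dens * ?n - dens \<le> qmax V E" using q by (simp add: algebra_simps)
      ultimately show ?thesis using gn dens_bounds by linarith
    qed
    note q = this
    have q': "\<bar>qmax V E - dens * ?n\<bar> \<le> \<gamma>' * ?n"
      using q mult_right_mono[OF \<gamma>(2), of ?n] by linarith
    have s16: "\<gamma>' \<le> 1 / 16" "75 * r * \<gamma>' \<le> 1 / 2" "75 * r * \<gamma>' \<le> \<kappa>"
    proof -
      have "300 * R * \<gamma>' \<le> 1" using \<gamma>'(4) R by (simp add: field_simps)
      then show "75 * r * \<gamma>' \<le> 1 / 2" by (simp add: R_def)
      have "3 * \<gamma>' \<le> R * \<gamma>'" using R \<gamma>' by (intro mult_right_mono) auto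
      then show "\<gamma>' \<le> 1 / 16" using \<open>300 * R * \<gamma>' \<le> 1\<close> by linarith
      show "75 * r * \<gamma>' \<le> \<kappa>" using \<gamma>'(2) R by (simp add: field_simps R_def)
    qed
    have s16': "\<gamma> \<le> 1 / 16" "75 * r * \<gamma> \<le> 1 / 2"
    proof -
      show "\<gamma> \<le> 1 / 16" using s16 \<gamma> by linarith
      have "75 * r * \<gamma> \<le> 75 * r * \<gamma>'" using \<gamma> by (intro mult_left_mono) auto
      then show "75 * r * \<gamma> \<le> 1 / 2" using s16 by linarith
    qed
    obtain W l\<^sub>0 where W: "struct \<gamma> V E W l\<^sub>0" using n\<^sub>2[OF fr n'(2) p] by blast
    have z4: "z v \<le> 4" if "v \<in> V" for v
      by (rule eigenvector_near_constant(1)[OF V(1) ne V(2) W _ s16'(1) z eig q that]) (use \<gamma> in auto)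
    have zW: "z v \<ge> 1 / 2" if "v \<in> W" for v
    proof -
      have "\<bar>z v - 1\<bar> \<le> 75 * r * \<gamma>"
        by (rule eigenvector_near_constant(2)[OF V(1) ne V(2) W _ s16'(1) z eig q that]) (use \<gamma> in auto)
      then show ?thesis using s16' by linarith
    qed
    have bigg: "(1 / r - g) * ?n > m * (g * ?n + 1)" if g: "0 < g" "g \<le> \<gamma>'" and m: "0 \<le> m" "m \<le> M - 1" for g m
    proof -
      have "4 * R * M * \<gamma>' \<le> 1" using \<gamma>'(3) R M by (simp add: field_simps)
      then have "4 * R * (M * \<gamma>' * ?n) \<le> ?n"
        using mult_right_mono[of "4 * R * M * \<gamma>'" 1 ?n] by (simp add: mult_ac)
      then have 1: "M * \<gamma>' * ?n \<le> 1 / (4 * R) * ?n" using R by (simp add: field_simps)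
      have "(m + 1) * (g * ?n) \<le> M * (\<gamma>' * ?n)"
        using m g M by (intro mult_mono) auto
      then have "(m + 1) * (g * ?n) \<le> 1 / (4 * R) * ?n" using 1 by (simp add: mult_ac)
      moreover have "m \<le> 1 / (2 * R) * ?n - 2" using n\<^sub>5[OF n'(5)] m by linarith
      moreover have "1 / R * ?n = 1 / (2 * R) * ?n + 2 * (1 / (4 * R) * ?n)" by simp
      moreover have "1 / (4 * R) * ?n \<ge> 0" using R by simp
      ultimately have "m * (g * ?n) + g * ?n + m < 1 / R * ?n" by (simp add: algebra_simps)
      then show ?thesis by (simp add: R_def algebra_simps)
    qed
    have "\<exists>l. struct (257 * (2 + 2 * r * N\<^sub>1) * \<gamma>) V E V l"
    proof (rule struct_whole[OF ex W x(1,2)])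
      show "x v \<ge> 0" for v by (rule x(3))
      show "sqrt ?n * x v \<le> 4" if "v \<in> V" for v using z4[OF that] by (simp add: z_def)
      show "1 / 2 \<le> sqrt ?n * x v" if "v \<in> W" for v using zW[OF that] by (simp add: z_def)
      show "1 \<le> \<gamma> * ?n" using gn by linarith
      show "card (verts F) * (\<gamma> * ?n + 1) < (1 / r - \<gamma>) * ?n"
        by (rule bigg) (use \<gamma> in \<open>auto simp: M_def\<close>)
    qed (use \<gamma> in auto)
    then obtain l where st: "struct \<gamma>' V E V l" unfolding \<gamma>(3) by blast
    have zV: "\<bar>z v - 1\<bar> \<le> 75 * r * \<gamma>'" if "v \<in> V" for v
      by (rule eigenvector_near_constant(2)[OF V(1) ne V(2) st _ s16(1) z eig q' that]) (use \<gamma>' in auto)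
    have lab: "l v < r" if "v \<in> V" for v using st that by (simp add: struct_def)
    define B where "B = (\<Union>i<r. {v \<in> cls l V i. \<exists>w\<in>cls l V i. E v w})"
    have B: "B \<subseteq> V" by (auto simp: B_def cls_def)
    have cB: "card B \<le> r * K\<^sub>0"
    proof -
      have "card B \<le> (\<Sum>i<r. card {v \<in> cls l V i. \<exists>w\<in>cls l V i. E v w})"
        unfolding B_def by (rule card_UN_le) simp
      also have "\<dots> \<le> (\<Sum>i<r. K\<^sub>0)"
      proof (intro sum_mono less_imp_le internal_vertices_bound[OF fr st])
        show "real (r * (N\<^sub>1 + K\<^sub>0)) * (\<gamma>' * ?n + 1) < (1 / r - \<gamma>') * ?n"
          by (rule bigg) (use \<gamma>' in \<open>auto simp: M_def\<close>)
      qed (use \<gamma>' in auto)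
      finally show ?thesis by simp
    qed
    have xpos: "x v > 0" if "v \<in> V" for v
    proof -
      have "z v > 0" using zV[OF that] s16 by linarith
      then show ?thesis using x(3)[of v] by (auto simp: z_def zero_less_mult_iff)
    qed
    \<comment> \<open>A vertex outside B has no neighbour in its own class, so rewiring it to all
      other classes only adds edges. Since all entries are positive, any added edge would be a
      strict gain.\<close>
    have adj: "E u w \<longleftrightarrow> l u \<noteq> l w" if u: "u \<in> V" "u \<notin> B" and w: "w \<in> V" for u w
    proof -
      let ?S = "{w \<in> V. l w \<noteq> l u \<and> w \<noteq> u}"
      have noint: "\<not> E u y" if "y \<in> V" "l y = l u" for y
        using u that lab[OF u(1)] by (auto simp: B_def cls_def)
      have "free_on V (rewire E u ?S)"
        by (rule free_rewire[OF fr st u(1) lab[OF u(1)] bigg]) (use \<gamma>' in \<open>auto simp: M_def\<close>)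
      then have "(\<Sum>w\<in>?S - nbr V E u. (x u + x w)^2) \<le> (\<Sum>w\<in>nbr V E u - ?S. (x u + x w)^2)"
        by (intro rewire_sum_le[OF ex x(1,2) u(1)]) auto
      moreover have "nbr V E u - ?S = {}"
        using noint V(2) by (auto simp: nbr_def sym_irrefl_def)
      ultimately have s0: "(\<Sum>w\<in>?S - nbr V E u. (x u + x w)^2) \<le> 0" by simp
      have "?S - nbr V E u = {}"
      proof (rule ccontr)
        assume ne: "?S - nbr V E u \<noteq> {}"
        have "(\<Sum>w\<in>?S - nbr V E u. (x u + x w)^2) > 0"
        proof (rule sum_pos)
          fix w assume "w \<in> ?S - nbr V E u"
          then have "x u + x w > 0" using xpos[OF u(1)] xpos[of w] by auto
          then show "0 < (x u + x w)^2" by simp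
        qed (use V ne in auto)
        then show False using s0 by linarith
      qed
      then show ?thesis using noint w u by (auto simp: nbr_def)
    qed
    have sizes: "card (cls l V i) \<ge> (1 / r - \<kappa>) * ?n" if "i < r" for i
    proof -
      have "1 * \<gamma>' \<le> 75 * r * \<gamma>'" using r \<gamma>' by (intro mult_right_mono) auto
      then have "(1 / r - \<kappa>) * ?n \<le> (1 / r - \<gamma>') * ?n" using s16 by (intro mult_right_mono) auto
      then show ?thesis using st that by (force simp: struct_def)
    qed
    have near: "\<bar>sqrt ?n * x v - 1\<bar> \<le> \<kappa>" if "v \<in> V" for v
      using zV[OF that] s16(3) by (simp add: z_def)
    show "near_complete \<kappa> V E" unfolding near_complete_def
      using B cB lab sizes adj x(1,2) near
      by (intro exI[of _ l] exI[of _ B] exI[of _ x]) blast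
  qed
qed

end

section \<open>Complete multipartite graphs\<close>

lemma deg_sum_eq_pairs: "finite V \<Longrightarrow> deg_sum V E = (\<Sum>u\<in>V. \<Sum>w\<in>V. of_bool (E u w))"
  by (simp add: deg_sum_def dg_eq_sum)

definition edge_set :: "nat set \<Rightarrow> (nat \<Rightarrow> nat \<Rightarrow> bool) \<Rightarrow> nat set set" where
  "edge_set V E = {{u, w} | u w. u \<in> V \<and> w \<in> V \<and> E u w}"

lemma edge_set_props:
  assumes "finite V" "sym_irrefl E"
  shows "finite (edge_set V E)" "\<And>v. v \<in> V \<Longrightarrow> card {e \<in> edge_set V E. v \<in> e} = card (nbr V E v)"
    "deg_sum V E = 2 * card (edge_set V E)"
proof -
  have "edge_set V E \<subseteq> Pow V" by (auto simp: edge_set_def)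
  then show fin: "finite (edge_set V E)" using assms finite_subset by auto
  show dg: "card {e \<in> edge_set V E. v \<in> e} = card (nbr V E v)" if "v \<in> V" for v
  proof -
    have "bij_betw (\<lambda>w. {v, w}) (nbr V E v) {e \<in> edge_set V E. v \<in> e}"
    proof (rule bij_betwI')
      show "({v, w} = {v, w'}) = (w = w')" for w w' by (auto simp: doubleton_eq_iff)
      show "{v, w} \<in> {e \<in> edge_set V E. v \<in> e}" if "w \<in> nbr V E v" for w
        using that \<open>v \<in> V\<close> by (auto simp: nbr_def edge_set_def)
      fix e assume e: "e \<in> {e \<in> edge_set V E. v \<in> e}"
      then obtain u w where uw: "e = {u, w}" "u \<in> V" "w \<in> V" "E u w" by (auto simp: edge_set_def)
      have "E w u" using uw assms by (auto simp: sym_irrefl_def)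
      then show "\<exists>w\<in>nbr V E v. e = {v, w}" using e uw by (auto simp: nbr_def)
    qed
    then show ?thesis by (metis bij_betw_same_card)
  qed
  have "(\<Sum>v\<in>V. card {e \<in> edge_set V E. v \<in> e}) = 2 * card (edge_set V E)"
  proof (rule sum_multicount[OF assms(1) fin])
    show "\<forall>e\<in>edge_set V E. card {v \<in> V. v \<in> e} = 2"
    proof
      fix e assume "e \<in> edge_set V E"
      then obtain u w where uw: "e = {u, w}" "u \<in> V" "w \<in> V" "E u w" by (auto simp: edge_set_def)
      have "u \<noteq> w" using uw assms by (auto simp: sym_irrefl_def)
      moreover have "{v \<in> V. v \<in> e} = {u, w}" using uw by auto
      ultimately show "card {v \<in> V. v \<in> e} = 2" by simp
    qed
  qed
  then have "(\<Sum>v\<in>V. card (nbr V E v)) = 2 * card (edge_set V E)" using dg by simp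
  then have "real (\<Sum>v\<in>V. card (nbr V E v)) = real (2 * card (edge_set V E))" by (simp only:)
  then show "deg_sum V E = 2 * card (edge_set V E)" by (simp add: deg_sum_def dg_def)
qed

definition cross :: "(nat \<Rightarrow> nat) \<Rightarrow> nat \<Rightarrow> nat \<Rightarrow> bool" where
  "cross l = (\<lambda>u w. l u \<noteq> l w)"

lemma sym_irrefl_cross: "sym_irrefl (cross l)"
  by (auto simp: sym_irrefl_def cross_def)

text \<open>The quantity D of the overview.\<close>

definition imbalance :: "nat \<Rightarrow> nat set \<Rightarrow> (nat \<Rightarrow> nat) \<Rightarrow> real" where
  "imbalance r V l = (\<Sum>i<r. (real (card (cls l V i)) - card V / r)^2)"

lemma imbalance_nonneg: "imbalance r V l \<ge> 0"
  by (simp add: imbalance_def sum_nonneg)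

lemma sum_over_classes:
  fixes f :: "nat \<Rightarrow> real"
  assumes "finite V" "\<And>v. v \<in> V \<Longrightarrow> l v < r"
  shows "sum f V = (\<Sum>i<r. sum f (cls l V i))"
proof -
  have "l ` V \<subseteq> {..<r}" using assms by auto
  from sum.group[OF assms(1) _ this, of f] show ?thesis by (simp add: cls_def)
qed

lemma dg_cross:
  assumes "finite V"
  shows "dg V (cross l) v = real (card V) - card (cls l V (l v))"
proof -
  have "nbr V (cross l) v = V - cls l V (l v)" by (auto simp: nbr_def cross_def cls_def)
  moreover have "card (V - cls l V (l v)) = card V - card (cls l V (l v))"
    using assms by (intro card_Diff_subset) (auto simp: cls_def)
  moreover have "card (cls l V (l v)) \<le> card V" using assms by (intro card_mono) (auto simp: cls_def)
  ultimately show ?thesis by (simp add: dg_def of_nat_diff)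
qed

lemma sum_class_cards:
  assumes "finite V" "\<And>v. v \<in> V \<Longrightarrow> l v < r"
  shows "(\<Sum>i<r. real (card (cls l V i))) = card V"
  using card_classes[OF assms] by simp

lemma imbalance_eq:
  assumes "finite V" "\<And>v. v \<in> V \<Longrightarrow> l v < r" "r > 0"
  shows "imbalance r V l = (\<Sum>i<r. (real (card (cls l V i)))^2) - (real (card V))^2 / r"
proof -
  let ?c = "\<lambda>i. real (card (cls l V i))" and ?a = "card V / r"
  have "imbalance r V l = (\<Sum>i<r. (?c i)^2) - 2 * ?a * (\<Sum>i<r. ?c i) + r * ?a^2"
    by (simp add: imbalance_def power2_diff sum.distrib sum_subtractf sum_distrib_left sum_divide_distrib mult_ac)
  also have "(\<Sum>i<r. ?c i) = card V" by (rule sum_class_cards[OF assms(1,2)])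
  also have "2 * ?a * card V = 2 * ((real (card V))^2 / r)" by (simp add: power2_eq_square)
  also have "r * ?a^2 = (real (card V))^2 / r" using assms(3) by (simp add: power2_eq_square)
  finally show ?thesis by simp
qed

lemma deg_sum_cross:
  assumes "finite V" "\<And>v. v \<in> V \<Longrightarrow> l v < r" "r > 0"
  shows "deg_sum V (cross l) = (1 - 1 / r) * (real (card V))^2 - imbalance r V l"
proof -
  let ?c = "\<lambda>i. real (card (cls l V i))"
  have "deg_sum V (cross l) = (\<Sum>v\<in>V. real (card V) - ?c (l v))"
    by (simp add: deg_sum_def dg_cross[OF assms(1)])
  also have "\<dots> = (\<Sum>i<r. \<Sum>v\<in>cls l V i. real (card V) - ?c (l v))" by (rule sum_over_classes[OF assms(1,2)])
  also have "\<dots> = (\<Sum>i<r. ?c i * (real (card V) - ?c i))"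
    by (intro sum.cong) (auto simp: cls_def)
  also have "\<dots> = card V * (\<Sum>i<r. ?c i) - (\<Sum>i<r. (?c i)^2)"
    by (simp add: algebra_simps sum_subtractf sum_distrib_left power2_eq_square)
  also have "(\<Sum>i<r. ?c i) = card V" by (rule sum_class_cards[OF assms(1,2)])
  finally have "deg_sum V (cross l) = (real (card V))^2 - (\<Sum>i<r. (?c i)^2)"
    by (simp only: power2_eq_square)
  moreover have "imbalance r V l = (\<Sum>i<r. (?c i)^2) - (real (card V))^2 / r"
    by (rule imbalance_eq[OF assms])
  ultimately show ?thesis by (simp add: left_diff_distrib)
qed

section \<open>Quadratic form and secular equation of a complete multipartite graph\<close>

lemma qform_cross:
  assumes "finite V" "\<And>v. v \<in> V \<Longrightarrow> l v < r"
  shows "qform V (cross l) x = (\<Sum>i<r. (real (card V) - card (cls l V i)) * sqnorm (cls l V i) x)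
     + (sum x V)^2 - (\<Sum>i<r. (sum x (cls l V i))^2)"
proof -
  let ?c = "\<lambda>i. real (card (cls l V i))"
  have nb: "(\<Sum>w\<in>nbr V (cross l) v. x w) = sum x V - sum x (cls l V (l v))" for v
  proof -
    have "nbr V (cross l) v = V - cls l V (l v)" by (auto simp: nbr_def cross_def cls_def)
    then show ?thesis using assms(1) by (simp add: sum_diff cls_def)
  qed
  have "qform V (cross l) x = (\<Sum>v\<in>V. (card V - ?c (l v)) * (x v)^2 + x v * (sum x V - sum x (cls l V (l v))))"
    by (simp add: qform_expand[OF assms(1) sym_irrefl_cross] dg_cross[OF assms(1)] nb)
  also have "\<dots> = (\<Sum>i<r. \<Sum>v\<in>cls l V i. (card V - ?c (l v)) * (x v)^2 + x v * (sum x V - sum x (cls l V (l v))))"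
    by (rule sum_over_classes[OF assms])
  also have "\<dots> = (\<Sum>i<r. (card V - ?c i) * sqnorm (cls l V i) x + sum x (cls l V i) * (sum x V - sum x (cls l V i)))"
  proof (rule sum.cong[OF refl])
    fix i
    have "(\<Sum>v\<in>cls l V i. (card V - ?c (l v)) * (x v)^2 + x v * (sum x V - sum x (cls l V (l v))))
       = (\<Sum>v\<in>cls l V i. (card V - ?c i) * (x v)^2 + x v * (sum x V - sum x (cls l V i)))"
      by (intro sum.cong) (auto simp: cls_def)
    then show "(\<Sum>v\<in>cls l V i. (card V - ?c (l v)) * (x v)^2 + x v * (sum x V - sum x (cls l V (l v))))
       = (card V - ?c i) * sqnorm (cls l V i) x + sum x (cls l V i) * (sum x V - sum x (cls l V i))"
      by (simp add: sum.distrib sqnorm_def sum_distrib_left sum_distrib_right)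
  qed
  also have "\<dots> = (\<Sum>i<r. (card V - ?c i) * sqnorm (cls l V i) x) + (\<Sum>i<r. sum x (cls l V i)) * sum x V
      - (\<Sum>i<r. (sum x (cls l V i))^2)"
    by (simp add: sum.distrib right_diff_distrib sum_subtractf sum_distrib_right power2_eq_square)
  also have "(\<Sum>i<r. sum x (cls l V i)) = sum x V" by (rule sum_over_classes[OF assms, symmetric])
  finally show ?thesis by (simp add: power2_eq_square)
qed

text \<open>The hypothesis says that \<open>q\<close> is at least the largest root of the secular equation
  \<open>\<Sum> n\<^sub>i / (q - n + 2 n\<^sub>i) = 1\<close> of a complete multipartite graph with class sizes \<open>n\<^sub>i\<close>.\<close>

lemma qform_cross_le:
  fixes q :: real
  assumes V: "finite V" "\<And>v. v \<in> V \<Longrightarrow> l v < r"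
    and pos: "\<And>i. i < r \<Longrightarrow> card (cls l V i) > 0"
    and q: "q \<ge> card V"
    and sec: "(\<Sum>i<r. card (cls l V i) / (q - card V + 2 * card (cls l V i))) \<le> 1"
  shows "qform V (cross l) x \<le> q * sqnorm V x"
proof -
  let ?c = "\<lambda>i. real (card (cls l V i))" and ?S = "\<lambda>i. sum x (cls l V i)"
  define m where "m i = q - card V + 2 * ?c i" for i
  have m: "m i > 0" "?c i > 0" if "i < r" for i using pos[OF that] q by (auto simp: m_def)
  \<comment> \<open>Cauchy-Schwarz with the weights m_i / n_i, chosen so that the second factor is
    the secular sum, which is at most 1.\<close>
  have "(sum x V)^2 = (\<Sum>i<r. ?S i)^2" by (subst sum_over_classes[OF V]) auto
  also have "\<dots> = (\<Sum>i<r. (?S i * sqrt (m i / ?c i)) * sqrt (?c i / m i))^2"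
  proof -
    have "?S i = ?S i * sqrt (m i / ?c i) * sqrt (?c i / m i)" if "i < r" for i
      using m[OF that] by (simp add: real_sqrt_mult[symmetric] mult.assoc)
    then show ?thesis by (intro arg_cong[where f = "\<lambda>y. y^2"] sum.cong) auto
  qed
  also have "\<dots> \<le> (\<Sum>i<r. (?S i * sqrt (m i / ?c i))^2) * (\<Sum>i<r. (sqrt (?c i / m i))^2)"
    by (rule Cauchy_Schwarz_ineq_sum)
  also have "(\<Sum>i<r. (?S i * sqrt (m i / ?c i))^2) = (\<Sum>i<r. (?S i)^2 * (m i / ?c i))"
    by (intro sum.cong) (use m in \<open>auto simp: power_mult_distrib less_imp_le\<close>)
  also have "(\<Sum>i<r. (sqrt (?c i / m i))^2) = (\<Sum>i<r. ?c i / m i)"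
    by (intro sum.cong) (use m in \<open>auto simp: less_imp_le\<close>)
  also have "(\<Sum>i<r. (?S i)^2 * (m i / ?c i)) * (\<Sum>i<r. ?c i / m i) \<le> (\<Sum>i<r. (?S i)^2 * (m i / ?c i)) * 1"
    using sec m unfolding m_def by (intro mult_left_mono sum_nonneg) (auto simp: less_imp_le)
  finally have S: "(sum x V)^2 \<le> (\<Sum>i<r. (?S i)^2 * (m i / ?c i))" by simp
  have "(\<Sum>i<r. (?S i)^2 * (m i / ?c i)) \<le> (\<Sum>i<r. (q - card V + ?c i) * sqnorm (cls l V i) x + (?S i)^2)"
  proof (rule sum_mono)
    fix i assume "i \<in> {..<r}"
    then have i: "i < r" by simp
    have "(?S i)^2 \<le> ?c i * sqnorm (cls l V i) x" using V by (intro sum_sq_le) (simp add: cls_def)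
    then have "(?S i)^2 / ?c i \<le> sqnorm (cls l V i) x" using m[OF i] by (simp add: divide_le_eq mult.commute)
    then have "(q - card V + ?c i) * ((?S i)^2 / ?c i) \<le> (q - card V + ?c i) * sqnorm (cls l V i) x"
      using q by (intro mult_left_mono) auto
    moreover have "(?S i)^2 * (m i / ?c i) = (q - card V + ?c i) * ((?S i)^2 / ?c i) + (?S i)^2"
      using m[OF i] by (simp add: m_def field_simps)
    ultimately show "(?S i)^2 * (m i / ?c i) \<le> (q - card V + ?c i) * sqnorm (cls l V i) x + (?S i)^2" by simp
  qed
  also have "\<dots> = q * (\<Sum>i<r. sqnorm (cls l V i) x) - (\<Sum>i<r. (card V - ?c i) * sqnorm (cls l V i) x) + (\<Sum>i<r. (?S i)^2)"
    unfolding sum_distrib_left sum_subtractf[symmetric] sum.distrib[symmetric]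
    by (intro sum.cong) (auto simp: algebra_simps)
  also have "(\<Sum>i<r. sqnorm (cls l V i) x) = sqnorm V x"
    unfolding sqnorm_def by (rule sum_over_classes[OF V, symmetric])
  finally show ?thesis using S qform_cross[of V l r x, OF V] by linarith
qed

text \<open>A second-order expansion of the secular equation around equal class sizes.\<close>

lemma secular_bound:
  fixes n s \<kappa> :: real and c :: "nat \<Rightarrow> real"
  assumes r: "r \<ge> 3" and n: "n > 0" and s: "0 < s" "s \<le> 1" and \<kappa>: "0 \<le> \<kappa>" "\<kappa> \<le> s / (8 * r)"
    and sumc: "(\<Sum>i<r. c i) = n" and near: "\<And>i. i < r \<Longrightarrow> \<bar>c i - n / r\<bar> \<le> \<kappa> * n"
  defines "D \<equiv> \<Sum>i<r. (c i - n / r)^2"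
  defines "q \<equiv> 2 * (1 - 1 / r) * n - 2 * (1 - 2 / r) * (1 - s) * D / n"
  shows "q \<ge> n" "(\<Sum>i<r. c i / (q - n + 2 * c i)) \<le> 1"
proof -
  define \<alpha> where "\<alpha> = 1 - 2 / real r"
  have \<alpha>: "1 / 3 \<le> \<alpha>" "\<alpha> \<le> 1" using r by (auto simp: \<alpha>_def field_simps)
  define h where "h = 2 * \<alpha> * (1 - s) * D / n"
  define t where "t = q - n"
  define P where "P = n - h"
  have D0: "D \<ge> 0" by (simp add: D_def sum_nonneg)
  have \<kappa>s: "8 * r * \<kappa> \<le> s" using \<kappa>(2) r by (simp add: field_simps)
  have \<kappa>3: "24 * \<kappa> \<le> 8 * r * \<kappa>" using r \<kappa> by (intro mult_right_mono) auto
  have Dle: "D \<le> r * (\<kappa> * n)^2"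
  proof -
    have "D \<le> (\<Sum>i<r. (\<kappa> * n)^2)" unfolding D_def
    proof (rule sum_mono)
      fix i assume "i \<in> {..<r}"
      then have "\<bar>c i - n / r\<bar> \<le> \<bar>\<kappa> * n\<bar>" using near[of i] by simp
      then show "(c i - n / r)^2 \<le> (\<kappa> * n)^2" by (simp only: abs_le_square_iff)
    qed
    then show ?thesis by simp
  qed
  have h0: "h \<ge> 0" using \<alpha> s D0 n by (simp add: h_def)
  have hle: "h \<le> \<alpha> * n * (s / 2)"
  proof -
    have "h = 2 * \<alpha> * ((1 - s) * D) / n" by (simp add: h_def)
    also have "(1 - s) * D \<le> 1 * D" using s D0 by (intro mult_right_mono) auto
    then have "2 * \<alpha> * ((1 - s) * D) / n \<le> 2 * \<alpha> * D / n"
      using \<alpha> n by (intro divide_right_mono mult_left_mono) auto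
    also have "\<dots> \<le> 2 * \<alpha> * (r * (\<kappa> * n)^2) / n"
      using \<alpha> n Dle by (intro divide_right_mono mult_left_mono) auto
    also have "\<dots> = \<alpha> * n * (2 * r * \<kappa> * \<kappa>)" using n by (simp add: power2_eq_square)
    also have "\<dots> \<le> \<alpha> * n * (s / 2)"
    proof (intro mult_left_mono)
      have "\<kappa> \<le> 1" using \<kappa>s \<kappa>3 s \<kappa> by linarith
      then have "2 * r * \<kappa> * \<kappa> \<le> 2 * r * \<kappa> * 1" using \<kappa> by (intro mult_left_mono) auto
      then show "2 * r * \<kappa> * \<kappa> \<le> s / 2" using \<kappa>s s by linarith
    qed (use \<alpha> n in auto)
    finally show ?thesis .
  qed
  have t: "t = \<alpha> * n - h" by (simp add: t_def q_def h_def \<alpha>_def algebra_simps)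
  have "\<alpha> * n * (s / 2) \<le> \<alpha> * n * (1 / 2)" using s \<alpha> n by (intro mult_left_mono) auto
  then have hh: "h \<le> \<alpha> * n / 2" using hle by simp
  have an: "0 < \<alpha> * n" "\<alpha> * n \<le> 1 * n" using \<alpha> n by (auto intro: mult_right_mono)
  have tpos: "t > 0" using t hh an by linarith
  have P: "P \<ge> n / 2" "P \<le> n" using hh an h0 unfolding P_def by linarith+
  then have P0: "P > 0" using n by linarith
  note P = P P0
  show "q \<ge> n" using tpos by (simp add: t_def)
  have tP: "t + 2 * n / r = P" unfolding t P_def \<alpha>_def by (simp add: algebra_simps)
  \<comment> \<open>P is the common value of the denominators for equal class sizes, and u_i is the
    relative deviation of the i-th one.\<close>
  define u where "u i = 2 * (c i - n / r) / P" for i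
  have ub: "\<bar>u i\<bar> \<le> s / 2" if "i < r" for i
  proof -
    have "\<bar>u i\<bar> = 2 * \<bar>c i - n / r\<bar> / P" using P(3) by (simp only: u_def abs_divide abs_mult abs_numeral abs_of_pos)
    also have "\<dots> \<le> 2 * (\<kappa> * n) / (n / 2)" using near[OF that] P n \<kappa> by (intro frac_le mult_left_mono) auto
    also have "\<dots> = 4 * \<kappa>" using n by simp
    finally show ?thesis using \<kappa>s \<kappa>3 \<kappa> s by linarith
  qed
  have mi: "t + 2 * c i = P * (1 + u i)" for i
  proof -
    have "t + 2 * c i = P + 2 * (c i - n / r)" using tP by (simp add: algebra_simps)
    also have "\<dots> = P * (1 + u i)" using P by (simp add: u_def field_simps)
    finally show ?thesis .
  qed
  have upos: "1 + u i > 0" if "i < r" for i using ub[OF that] s by linarith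
  \<comment> \<open>The Taylor expansion of 1 / (1 + u) for |u| <= s/2; lowering the quadratic
    coefficient by s/2 absorbs the higher terms. The linear terms cancel in the sum by
    \<open>su\<close>.\<close>
  have inv: "1 / (t + 2 * c i) \<ge> (1 - u i + (1 - s / 2) * (u i)^2) / P" if "i < r" for i
  proof -
    have "(1 - u i + (1 - s / 2) * (u i)^2) * (1 + u i) = 1 - (u i)^2 * (s / 2 - u i + (s / 2) * u i)"
      by (simp add: power2_eq_square algebra_simps)
    also have "\<dots> \<le> 1"
    proof -
      have "u i * (1 - s / 2) \<le> (s / 2) * 1"
      proof (cases "u i \<ge> 0")
        case True
        then show ?thesis using ub[OF that] s by (intro mult_mono) auto
      next
        case False
        then have "u i * (1 - s / 2) \<le> 0" using s by (intro mult_nonpos_nonneg) auto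
        then show ?thesis using s by simp
      qed
      then have "s / 2 - u i + (s / 2) * u i \<ge> 0" by (simp add: algebra_simps)
      then show ?thesis by simp
    qed
    finally have "1 - u i + (1 - s / 2) * (u i)^2 \<le> 1 / (1 + u i)"
      using upos[OF that] by (simp add: pos_le_divide_eq)
    then have "(1 - u i + (1 - s / 2) * (u i)^2) / P \<le> 1 / (1 + u i) / P"
      using P by (intro divide_right_mono) auto
    then show ?thesis unfolding mi by (simp add: mult.commute)
  qed
  have su: "(\<Sum>i<r. u i) = 0"
  proof -
    have "(\<Sum>i<r. u i) = 2 * ((\<Sum>i<r. c i) - r * (n / r)) / P"
      by (simp add: u_def sum_divide_distrib[symmetric] sum_distrib_left[symmetric] sum_subtractf)
    then show ?thesis using sumc r by simp
  qed
  have su2: "(\<Sum>i<r. (u i)^2) = 4 * D / P^2"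
  proof -
    have "(u i)^2 = (4 / P^2) * (c i - n / r)^2" for i
      unfolding u_def power_divide power_mult_distrib by simp
    then show ?thesis by (simp only: sum_distrib_left sum_divide_distrib D_def times_divide_eq_left)
  qed
  have "(\<Sum>i<r. 1 / (t + 2 * c i)) \<ge> (\<Sum>i<r. (1 - u i + (1 - s / 2) * (u i)^2) / P)"
    using inv by (intro sum_mono) auto
  also have "(\<Sum>i<r. (1 - u i + (1 - s / 2) * (u i)^2) / P) = (r + (1 - s / 2) * (4 * D / P^2)) / P"
    using su by (simp add: sum_divide_distrib[symmetric] sum.distrib sum_subtractf sum_distrib_left[symmetric] su2)
  finally have inv_sum: "(\<Sum>i<r. 1 / (t + 2 * c i)) \<ge> (r + (1 - s / 2) * (4 * D / P^2)) / P" .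
  \<comment> \<open>As c / (t + 2 c) = (1 - t / (t + 2 c)) / 2, the secular inequality amounts to t
    times the sum of the reciprocals being at least r - 2. The other half of the slack s goes into
    replacing t by \<alpha> n.\<close>
  have "t * ((r + (1 - s / 2) * (4 * D / P^2)) / P) \<ge> r - 2"
  proof -
    have "t * (1 - s / 2) \<ge> \<alpha> * n * (1 - s)"
    proof -
      have "t \<ge> \<alpha> * n * (1 - s / 2)" using hle t by (simp add: algebra_simps)
      then have "t * (1 - s / 2) \<ge> \<alpha> * n * (1 - s / 2) * (1 - s / 2)"
        using s by (intro mult_right_mono) auto
      moreover have "(1 - s / 2) * (1 - s / 2) \<ge> 1 - s" by (simp add: algebra_simps)
      then have "\<alpha> * n * ((1 - s / 2) * (1 - s / 2)) \<ge> \<alpha> * n * (1 - s)"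
        using an by (intro mult_left_mono) auto
      ultimately show ?thesis by (simp add: mult.assoc)
    qed
    then have "4 * D * (\<alpha> * n * (1 - s)) / P^2 \<le> 4 * D * (t * (1 - s / 2)) / P^2"
      using D0 by (intro divide_right_mono mult_left_mono) auto
    moreover have "4 * D * (\<alpha> * n * (1 - s)) / n^2 \<le> 4 * D * (\<alpha> * n * (1 - s)) / P^2"
      using P D0 an s n by (intro divide_left_mono power_mono) auto
    moreover have "4 * D * (\<alpha> * n * (1 - s)) / n^2 = 2 * h" using n by (simp add: h_def power2_eq_square)
    ultimately have "2 * h \<le> t * ((1 - s / 2) * (4 * D / P^2))" by (simp add: mult_ac)
    moreover have "t * r - (r - 2) * P = - 2 * h"
    proof -
      have "r * \<alpha> = r - 2" using r by (simp add: \<alpha>_def field_simps)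
      then have "r * (\<alpha> * n) = (r - 2) * n" by (simp add: mult.assoc[symmetric])
      then show ?thesis using r unfolding t P_def by (simp add: algebra_simps of_nat_diff)
    qed
    ultimately have "(r - 2) * P \<le> t * (r + (1 - s / 2) * (4 * D / P^2))"
      by (simp add: algebra_simps)
    then show ?thesis using P r by (simp add: pos_le_divide_eq of_nat_diff)
  qed
  moreover have "t * ((r + (1 - s / 2) * (4 * D / P^2)) / P) \<le> t * (\<Sum>i<r. 1 / (t + 2 * c i))"
    using inv_sum tpos by (intro mult_left_mono) auto
  ultimately have ge: "t * (\<Sum>i<r. 1 / (t + 2 * c i)) \<ge> real r - 2" using r by (simp add: of_nat_diff)
  have "(\<Sum>i<r. c i / (q - n + 2 * c i)) = (\<Sum>i<r. (1 - t * (1 / (t + 2 * c i))) / 2)"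
  proof (rule sum.cong[OF refl])
    fix i assume "i \<in> {..<r}"
    then have "t + 2 * c i > 0" unfolding mi using P upos by simp
    then show "c i / (q - n + 2 * c i) = (1 - t * (1 / (t + 2 * c i))) / 2"
      by (simp add: t_def field_simps)
  qed
  also have "\<dots> = (r - t * (\<Sum>i<r. 1 / (t + 2 * c i))) / 2"
    by (simp add: sum_divide_distrib[symmetric] sum_subtractf sum_distrib_left)
  finally show "(\<Sum>i<r. c i / (q - n + 2 * c i)) \<le> 1" using ge by simp
qed

section \<open>Comparison with the Turan graph\<close>

lemma sum_pairs_restrict:
  fixes g :: "nat \<Rightarrow> nat \<Rightarrow> real"
  assumes "finite V" "B \<subseteq> V" "\<And>u w. u \<in> V \<Longrightarrow> w \<in> V \<Longrightarrow> \<not> (u \<in> B \<and> w \<in> B) \<Longrightarrow> g u w = 0"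
  shows "(\<Sum>u\<in>V. \<Sum>w\<in>V. g u w) = (\<Sum>u\<in>B. \<Sum>w\<in>B. g u w)"
proof -
  have "(\<Sum>u\<in>V. \<Sum>w\<in>V. g u w) = (\<Sum>u\<in>B. \<Sum>w\<in>V. g u w)"
    by (rule sum.mono_neutral_right[OF assms(1,2)]) (use assms(3) in \<open>auto intro!: sum.neutral\<close>)
  also have "\<dots> = (\<Sum>u\<in>B. \<Sum>w\<in>B. g u w)"
    by (intro sum.cong refl sum.mono_neutral_right[OF assms(1,2)]) (use assms(2,3) in auto)
  finally show ?thesis .
qed

lemma deg_sum_diff:
  assumes "finite V" "B \<subseteq> V" "\<And>u w. u \<in> V \<Longrightarrow> w \<in> V \<Longrightarrow> \<not> (u \<in> B \<and> w \<in> B) \<Longrightarrow> E u w = E' u w"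
  shows "deg_sum V E - deg_sum V E' = (\<Sum>u\<in>B. \<Sum>w\<in>B. of_bool (E u w) - of_bool (E' u w))"
proof -
  have "deg_sum V E - deg_sum V E' = (\<Sum>u\<in>V. \<Sum>w\<in>V. of_bool (E u w) - of_bool (E' u w))"
    by (simp add: deg_sum_eq_pairs[OF assms(1)] sum_subtractf)
  also have "\<dots> = (\<Sum>u\<in>B. \<Sum>w\<in>B. of_bool (E u w) - of_bool (E' u w))"
    by (rule sum_pairs_restrict[OF assms(1,2)]) (use assms(3) in auto)
  finally show ?thesis .
qed

lemma residue_class_card:
  assumes "r > 0" "i < r"
  shows "card (cls (\<lambda>v. v mod r) {0..<n} i) \<in> {n div r, n div r + 1}"
proof -
  let ?c = "cls (\<lambda>v. v mod r) {0..<n} i" and ?f = "\<lambda>j. j * r + i"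
  have inj: "inj_on ?f A" for A using assms by (auto simp: inj_on_def)
  have "?f ` {..<n div r} \<subseteq> ?c"
  proof
    fix v assume "v \<in> ?f ` {..<n div r}"
    then obtain j where j: "j < n div r" "v = j * r + i" by auto
    have "v < (j + 1) * r" using j assms by simp
    also have "\<dots> \<le> (n div r) * r" using j by (intro mult_right_mono) auto
    also have "\<dots> \<le> n" by simp
    finally show "v \<in> ?c" using j assms by (simp add: cls_def)
  qed
  then have "card (?f ` {..<n div r}) \<le> card ?c" by (intro card_mono) (auto simp: cls_def)
  moreover have "?c \<subseteq> ?f ` {..n div r}"
  proof
    fix v assume "v \<in> ?c"
    then have "v = (v div r) * r + i" "v div r \<le> n div r" by (auto simp: cls_def intro: div_le_mono)
    then show "v \<in> ?f ` {..n div r}" by blast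
  qed
  then have "card ?c \<le> card (?f ` {..n div r})" by (intro card_mono) auto
  ultimately show ?thesis using inj by (auto simp: card_image)
qed

text \<open>Sizes c equal to a or a + 1 satisfy c^2 = (2 a + 1) c - a (a + 1), so the sum of squares
  depends on n alone. The imbalance is then r/4 minus the square (n - r a - r/2)^2 / r.\<close>

lemma turan_imbalance_le:
  assumes "r > 0"
  shows "imbalance r {0..<n} (\<lambda>v. v mod r) \<le> r / 4"
proof -
  let ?c = "\<lambda>i. real (card (cls (\<lambda>v. v mod r) {0..<n} i))"
  define a where "a = real (n div r)"
  have lab: "v mod r < r" for v using assms by simp
  have "(?c i)^2 = (2 * a + 1) * ?c i - a * (a + 1)" if "i < r" for i
  proof -
    have "?c i = a \<or> ?c i = a + 1" using residue_class_card[OF assms that, of n] by (auto simp: a_def)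
    then show ?thesis by (auto simp: power2_eq_square algebra_simps)
  qed
  then have "(\<Sum>i<r. (?c i)^2) = (\<Sum>i<r. (2 * a + 1) * ?c i - a * (a + 1))" by (intro sum.cong) auto
  also have "\<dots> = (2 * a + 1) * (\<Sum>i<r. ?c i) - r * (a * (a + 1))"
    by (simp add: sum_subtractf sum_distrib_left)
  also have "(\<Sum>i<r. ?c i) = n" using sum_class_cards[of "{0..<n}" "\<lambda>v. v mod r" r] lab by simp
  finally have sq: "(\<Sum>i<r. (?c i)^2) = (2 * a + 1) * n - r * (a * (a + 1))" .
  have "imbalance r {0..<n} (\<lambda>v. v mod r) = (\<Sum>i<r. (?c i)^2) - (real n)^2 / r"
    using imbalance_eq[of "{0..<n}" "\<lambda>v. v mod r" r] lab assms by simp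
  moreover have "r / 4 - ((2 * a + 1) * n - r * (a * (a + 1)) - (real n)^2 / r) = (n - r * a - r / 2)^2 / r"
    using assms by (simp add: field_simps power2_eq_square)
  moreover have "(n - r * a - r / 2)^2 / r \<ge> 0" by simp
  ultimately show ?thesis using sq by linarith
qed

context extremal_bound
begin

text \<open>The exceptional part of the graph is transplanted into the balanced Turan graph; a copy of \<open>F\<close>
  there could be pulled back, because its ordinary vertices can be placed anywhere in their class.\<close>

lemma transplant:
  assumes fr: "free_on V E" and B: "B \<subseteq> V"
    and adj: "\<And>u w. u \<in> V \<Longrightarrow> w \<in> V \<Longrightarrow> u \<notin> B \<Longrightarrow> E u w \<longleftrightarrow> l u \<noteq> l w"
    and lab: "\<And>v. v \<in> V \<Longrightarrow> l v < r"
    and big: "\<And>i. i < r \<Longrightarrow> card (cls l V i) \<ge> card (verts F) + card B" and n: "n \<ge> r * card B"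
  obtains E' where "free_on {0..<n} E'"
    "deg_sum {0..<n} E' = deg_sum {0..<n} (cross (\<lambda>v. v mod r)) + (deg_sum V E - deg_sum V (cross l))"
proof -
  have V: "finite V" "sym_irrefl E" using fr by (auto simp: free_on_def)
  have sy: "E x y \<Longrightarrow> E y x" and irr: "\<not> E x x" for x y using V by (auto simp: sym_irrefl_def)
  have fB: "finite B" using B V finite_subset by blast
  obtain idx where idx: "bij_betw idx B {0..<card B}" using ex_bij_betw_finite_nat[OF fB] by blast
  \<comment> \<open>The residue of \<open>g v\<close> modulo r is the label of v, and its quotient
    is the index, which makes g injective; n >= r * card B keeps the values below n.\<close>
  define g where "g v = idx v * r + l v" for v
  have gmod: "g v mod r = l v" if "v \<in> B" for v using that lab B by (auto simp: g_def)
  have gn: "g v < n" if "v \<in> B" for v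
  proof -
    have "idx v < card B" using idx that by (auto simp: bij_betw_def)
    have "g v < (idx v + 1) * r" using lab B that by (auto simp: g_def)
    also have "\<dots> \<le> card B * r" using \<open>idx v < card B\<close> by (intro mult_right_mono) auto
    finally show ?thesis using n by (simp add: mult.commute)
  qed
  have ginj: "inj_on g B"
  proof (rule inj_onI)
    fix u v assume uv: "u \<in> B" "v \<in> B" "g u = g v"
    have gdiv: "g v div r = idx v" if "v \<in> B" for v
    proof -
      have "l v < r" using that lab B by auto
      then show ?thesis by (simp add: g_def)
    qed
    have "idx u = idx v" using gdiv[OF uv(1)] gdiv[OF uv(2)] uv(3) by metis
    then show "u = v" using idx uv by (auto simp: bij_betw_def dest: inj_onD)
  qed
  define h where "h = the_inv_into B g"
  have hg: "h (g v) = v" if "v \<in> B" for v using the_inv_into_f_f[OF ginj that] by (simp add: h_def)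
  define E' where "E' u w = (if u \<in> g ` B \<and> w \<in> g ` B then E (h u) (h w) else u mod r \<noteq> w mod r)" for u w
  have sE': "sym_irrefl E'" using sy irr by (auto simp: sym_irrefl_def E'_def)
  have "\<not> embeds F {0..<n} E'"
  proof
    assume "embeds F {0..<n} E'"
    then obtain f where f: "inj_on f (verts F)" "f ` verts F \<subseteq> {0..<n}" "\<And>a b. {a, b} \<in> edges F \<Longrightarrow> E' (f a) (f b)"
      unfolding embeds_def by blast
    have fF: "finite (verts F)" using F by (simp add: simple_graph_def)
    \<comment> \<open>The ordinary vertices of the copy in residue class i. By \<open>big\<close>,
      class i of V has at least \<open>card (verts F)\<close> vertices outside B to receive them
      injectively.\<close>
    define T where "T i = {t \<in> f ` verts F - g ` B. t mod r = i}" for i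
    have "\<exists>p. p ` T i \<subseteq> cls l V i - B \<and> inj_on p (T i)" if "i < r" for i
    proof -
      have "card (T i) \<le> card (f ` verts F)" using fF by (intro card_mono) (auto simp: T_def)
      also have "\<dots> \<le> card (verts F)" by (rule card_image_le[OF fF])
      also have "\<dots> \<le> card (cls l V i) - card B" using big[OF that] by simp
      also have "\<dots> \<le> card (cls l V i - B)" by (rule diff_card_le_card_Diff[OF fB])
      finally show ?thesis
        using inj_on_iff_card_le[of "T i" "cls l V i - B"] fF V by (auto simp: T_def finite_cls)
    qed
    then obtain p where p: "\<And>i. i < r \<Longrightarrow> p i ` T i \<subseteq> cls l V i - B \<and> inj_on (p i) (T i)" by metis
    define k where "k t = (if t \<in> g ` B then h t else p (t mod r) t)" for t
    have rr: "t mod r < r" for t using r by simp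
    have kin: "k t \<in> B" if "t \<in> g ` B" for t using that hg by (auto simp: k_def)
    have kout: "k t \<in> cls l V (t mod r) - B" if "t \<in> f ` verts F" "t \<notin> g ` B" for t
      using p[OF rr[of t]] that by (auto simp: k_def T_def)
    have klab: "l (k t) = t mod r" "k t \<in> V" if "t \<in> f ` verts F" for t
      using kout[OF that] kin[of t] gmod hg B by (auto simp: cls_def k_def)
    have kinj: "inj_on k (f ` verts F)"
    proof (rule inj_onI)
      fix s t assume st: "s \<in> f ` verts F" "t \<in> f ` verts F" "k s = k t"
      have m: "s mod r = t mod r" using klab[OF st(1)] klab[OF st(2)] st(3) by simp
      consider "s \<in> g ` B" "t \<in> g ` B" | "s \<notin> g ` B" "t \<notin> g ` B"
        using kin[of s] kin[of t] kout[OF st(1)] kout[OF st(2)] st(3) by fastforce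
      then show "s = t"
      proof cases
        case 1
        then show ?thesis using st(3) hg by (auto simp: k_def)
      next
        case 2
        then have "s \<in> T (s mod r)" "t \<in> T (s mod r)" using st m by (auto simp: T_def)
        moreover have "p (s mod r) s = p (s mod r) t" using 2 st(3) m by (simp add: k_def)
        ultimately show ?thesis using p[OF rr[of s]] by (auto dest: inj_onD)
      qed
    qed
    have kE: "E (k s) (k t)" if "s \<in> f ` verts F" "t \<in> f ` verts F" "E' s t" for s t
    proof (cases "s \<in> g ` B \<and> t \<in> g ` B")
      case True
      then show ?thesis using that(3) by (simp add: E'_def k_def)
    next
      case False
      then have ne: "l (k s) \<noteq> l (k t)" using that klab[OF that(1)] klab[OF that(2)] by (auto simp: E'_def)
      from False consider "s \<notin> g ` B" | "t \<notin> g ` B" by blast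
      then show ?thesis
      proof cases
        case 1
        then have "k s \<notin> B" using kout[OF that(1)] by auto
        then show ?thesis using adj[of "k s" "k t"] klab[OF that(1)] klab[OF that(2)] ne by simp
      next
        case 2
        then have "k t \<notin> B" using kout[OF that(2)] by auto
        then have "E (k t) (k s)" using adj[of "k t" "k s"] klab[OF that(1)] klab[OF that(2)] ne by simp
        then show ?thesis by (rule sy)
      qed
    qed
    have "embeds F V E" unfolding embeds_def
    proof (intro exI[of _ "k \<circ> f"] conjI allI impI)
      show "inj_on (k \<circ> f) (verts F)" using f(1) kinj by (rule comp_inj_on)
      show "(k \<circ> f) ` verts F \<subseteq> V" using klab by auto
      show "E ((k \<circ> f) a) ((k \<circ> f) b)" if "{a, b} \<in> edges F" for a b
        using kE[of "f a" "f b"] f(3)[OF that] simple_graph_edgeD[OF F that] by simp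
    qed
    then show False using fr by (simp add: free_on_def)
  qed
  then have "free_on {0..<n} E'" using sE' by (simp add: free_on_def)
  moreover have "deg_sum {0..<n} E' - deg_sum {0..<n} (cross (\<lambda>v. v mod r))
     = (\<Sum>u\<in>g ` B. \<Sum>w\<in>g ` B. of_bool (E' u w) - of_bool (cross (\<lambda>v. v mod r) u w))"
    by (rule deg_sum_diff) (use gn in \<open>auto simp: E'_def cross_def\<close>)
  moreover have "\<dots> = (\<Sum>u\<in>B. \<Sum>w\<in>B. of_bool (E u w) - of_bool (cross l u w))"
    by (simp add: sum.reindex[OF ginj] E'_def hg cross_def gmod cong: sum.cong)
  moreover have "\<dots> = deg_sum V E - deg_sum V (cross l)"
  proof (rule deg_sum_diff[symmetric, OF V(1) B])
    fix u w assume uw: "u \<in> V" "w \<in> V" "\<not> (u \<in> B \<and> w \<in> B)"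
    show "E u w = cross l u w"
    proof (cases "u \<in> B")
      case True
      then have "E w u \<longleftrightarrow> l w \<noteq> l u" using uw adj by blast
      then show ?thesis using sy by (auto simp: cross_def)
    next
      case False
      then show ?thesis using uw adj by (auto simp: cross_def)
    qed
  qed
  ultimately show ?thesis using that[of E'] by simp
qed

text \<open>X will be ex(n, F). It enters through two inequalities only: n q >= 4 X, which comes
  from the all-ones vector on an edge-extremal graph, and the edge bound for free graphs, which is
  applied to the transplanted graph.\<close>

lemma extremal_edges:
  obtains n\<^sub>1 where "\<And>n E (X::nat). n \<ge> n\<^sub>1 \<Longrightarrow> q_extremal {0..<n} E \<Longrightarrow> phi {0..<n} E \<ge> dens \<Longrightarrow>
    real n * qmax {0..<n} E \<ge> 4 * real X \<Longrightarrow>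
    (\<And>E'. free_on {0..<n} E' \<Longrightarrow> deg_sum {0..<n} E' \<le> 2 * real X) \<Longrightarrow> 2 * real X \<le> deg_sum {0..<n} E"
proof -
  define R where "R = real r"
  have R: "R \<ge> 3" using r by (simp add: R_def)
  \<comment> \<open>With R s = 1/20, the loss of the factor 1 - s raises (1 - \<beta>) R / 4 from
    1/2 to at most 41/80.\<close>
  define s where "s = 1 / (20 * R)"
  have s: "0 < s" "s \<le> 1 / 60" "R * s = 1 / 20" using R by (auto simp: s_def field_simps)
  define b where "b = real (r * K\<^sub>0)"
  have b: "b \<ge> 1"
  proof -
    have "1 * 1 \<le> r * K\<^sub>0" using r by (intro mult_mono) (auto simp: K\<^sub>0_def)
    then show ?thesis unfolding b_def by linarith
  qed
  \<comment> \<open>Class sizes deviate by at most R \<kappa> n, and \<open>secular_bound\<close>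
    asks for R \<kappa> <= s / (8 R). The second bound keeps the spectral error 6 \<kappa> b^2 from
    the pairs inside B at most 1/10.\<close>
  define \<kappa> where "\<kappa> = min (s / (8 * R * R)) (1 / (60 * b * b))"
  have \<kappa>: "0 < \<kappa>" "\<kappa> \<le> s / (8 * R * R)" "\<kappa> \<le> 1 / (60 * b * b)"
  proof -
    show "0 < \<kappa>" using s R b by (simp add: \<kappa>_def)
    show "\<kappa> \<le> s / (8 * R * R)" unfolding \<kappa>_def by (rule min.cobounded1)
    show "\<kappa> \<le> 1 / (60 * b * b)" unfolding \<kappa>_def by (rule min.cobounded2)
  qed
  have \<kappa>b: "6 * \<kappa> * b^2 \<le> 1 / 10" using \<kappa>(3) b by (simp add: field_simps power2_eq_square)
  have R\<kappa>: "R * \<kappa> \<le> s / (8 * R)" using \<kappa>(2) R by (simp add: field_simps)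
  have \<kappa>1: "\<kappa> \<le> 1" "\<kappa> \<le> 1 / (2 * R)"
  proof -
    have "8 * R * (R * \<kappa>) \<le> s" using R\<kappa> R by (simp add: field_simps)
    moreover have "24 * (R * \<kappa>) \<le> 8 * R * (R * \<kappa>)" using R \<kappa> by (intro mult_right_mono) auto
    ultimately have 1: "R * \<kappa> \<le> 1 / 2" using s by linarith
    then show "\<kappa> \<le> 1 / (2 * R)" using R by (simp add: field_simps)
    have "3 * \<kappa> \<le> R * \<kappa>" using R \<kappa> by (intro mult_right_mono) auto
    then show "\<kappa> \<le> 1" using 1 by linarith
  qed
  \<comment> \<open>The relative weight with which the imbalance D counts in q, compared with its
    weight 1 in the degree sum. The lower bound is the value for r = 3.\<close>
  define \<beta> where "\<beta> = (1 - 2 / R) * (1 - s)"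
  have \<beta>: "\<beta> \<ge> 59 / 180" "0 \<le> 1 - \<beta>" "(1 - \<beta>) * (R / 4) \<le> 41 / 80"
  proof -
    have R13: "1 / 3 \<le> 1 - 2 / R" "1 - 2 / R \<le> 1" using R by (auto simp: field_simps)
    have "1 / 3 * (59 / 60) \<le> \<beta>" unfolding \<beta>_def using R13 s by (intro mult_mono) auto
    then show "\<beta> \<ge> 59 / 180" by simp
    have "\<beta> \<le> 1 * 1" unfolding \<beta>_def using R13 s by (intro mult_mono) auto
    then show "0 \<le> 1 - \<beta>" by simp
    have "(1 - \<beta>) * (R / 4) = 1 / 2 + R * s / 4 - s / 2" using R by (simp add: \<beta>_def field_simps)
    then show "(1 - \<beta>) * (R / 4) \<le> 41 / 80" using s by simp
  qed
  obtain n\<^sub>2 where n\<^sub>2: "\<And>V E. q_extremal V E \<Longrightarrow> phi V E \<ge> dens \<Longrightarrow> card V \<ge> n\<^sub>2 \<Longrightarrow> near_complete \<kappa> V E"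
    using near_complete_multipartite[OF \<kappa>(1)] by metis
  have "1 / (2 * R) > 0" using R by simp
  then obtain n\<^sub>3 :: nat where n\<^sub>3: "\<And>n::nat. n \<ge> n\<^sub>3 \<Longrightarrow> 1 / (2 * R) * n \<ge> card (verts F) + b + 1"
    using eventually_linear by metis
  show ?thesis
  proof (rule that[of "n\<^sub>2 + n\<^sub>3 + r * (r * K\<^sub>0) + 1"], rule ccontr)
    fix n :: nat and E and X :: nat
    assume n: "n \<ge> n\<^sub>2 + n\<^sub>3 + r * (r * K\<^sub>0) + 1" and ex: "q_extremal {0..<n} E" and p: "phi {0..<n} E \<ge> dens"
      and X: "real n * qmax {0..<n} E \<ge> 4 * real X"
      and Xmax: "\<And>E'. free_on {0..<n} E' \<Longrightarrow> deg_sum {0..<n} E' \<le> 2 * real X"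
      and neg: "\<not> 2 * real X \<le> deg_sum {0..<n} E"
    define V where "V = {0..<n}"
    have cV: "card V = n" by (simp add: V_def)
    have fr: "free_on V E" using ex by (simp add: q_extremal_def V_def)
    have V: "finite V" "sym_irrefl E" using fr by (auto simp: free_on_def)
    have n0: "real n > 0" using n by simp
    obtain l B x where B: "B \<subseteq> V" "card B \<le> r * K\<^sub>0" and lab: "\<And>v. v \<in> V \<Longrightarrow> l v < r"
      and sz: "\<And>i. i < r \<Longrightarrow> card (cls l V i) \<ge> (1 / r - \<kappa>) * n"
      and adj: "\<And>u w. u \<in> V \<Longrightarrow> w \<in> V \<Longrightarrow> u \<notin> B \<Longrightarrow> E u w \<longleftrightarrow> l u \<noteq> l w"
      and x: "sqnorm V x = 1" "qform V E x = qmax V E" "\<And>v. v \<in> V \<Longrightarrow> \<bar>sqrt n * x v - 1\<bar> \<le> \<kappa>"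
    proof -
      have "q_extremal V E" "phi V E \<ge> dens" "card V \<ge> n\<^sub>2" using ex p n cV by (simp_all add: V_def)
      from n\<^sub>2[OF this] show ?thesis unfolding near_complete_def cV by (elim exE conjE) (rule that, blast+)
    qed
    have fB: "finite B" using B V finite_subset by blast
    have bB: "real (card B) \<le> b" unfolding b_def using B(2) by (simp only: of_nat_le_iff)
    have r0: "r > 0" using r by simp
    let ?c = "\<lambda>i. real (card (cls l V i))"
    have csum: "(\<Sum>i<r. ?c i) = n" using sum_class_cards[of V l r] V lab cV by simp
    have big: "card (cls l V i) \<ge> card (verts F) + card B" "?c i > 0" if "i < r" for i
    proof -
      have "1 / (2 * R) * n \<le> (1 / r - \<kappa>) * n"
        using \<kappa>1 R n0 by (intro mult_right_mono) (auto simp: R_def field_simps)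
      moreover have "1 / (2 * R) * n \<ge> card (verts F) + b + 1" using n\<^sub>3[of n] n by simp
      ultimately have "?c i \<ge> real (card (verts F)) + b + 1" using sz[OF that] by linarith
      then show "card (cls l V i) \<ge> card (verts F) + card B" "?c i > 0" using bB b by linarith+
    qed
    have near: "\<bar>?c i - n / r\<bar> \<le> (R * \<kappa>) * n" if i: "i < r" for i
    proof -
      have "n = ?c i + (\<Sum>j\<in>{..<r} - {i}. ?c j)" using csum i by (subst (asm) sum.remove[of _ i]) auto
      moreover have "(\<Sum>j\<in>{..<r} - {i}. ?c j) \<ge> (\<Sum>j\<in>{..<r} - {i}. (1 / r - \<kappa>) * n)"
        using sz by (intro sum_mono) auto
      moreover have "(\<Sum>j\<in>{..<r} - {i}. (1 / r - \<kappa>) * n) = (R - 1) * ((1 / r - \<kappa>) * n)"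
        using i by (simp add: of_nat_diff R_def)
      moreover have "(R - 1) * ((1 / r - \<kappa>) * n) = n - n / r - (R * \<kappa>) * n + \<kappa> * n"
        using R by (simp add: R_def field_simps)
      ultimately have "?c i \<le> n / r + (R * \<kappa>) * n - \<kappa> * n" by linarith
      moreover have "\<kappa> * n \<ge> 0" using \<kappa> by simp
      moreover have "?c i \<ge> n / r - \<kappa> * n" using sz[OF i] by (simp add: algebra_simps)
      moreover have "1 * (\<kappa> * n) \<le> R * (\<kappa> * n)" using R \<kappa> by (intro mult_right_mono) auto
      ultimately show ?thesis by (simp add: abs_le_iff mult.assoc)
    qed
    define D where "D = imbalance r V l"
    define q\<^sub>1 where "q\<^sub>1 = 2 * (1 - 1 / R) * n - 2 * (1 - 2 / R) * (1 - s) * D / n"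
    have Deq: "D = (\<Sum>i<r. (?c i - n / r)^2)" by (simp add: D_def imbalance_def cV)
    have q1: "q\<^sub>1 \<ge> n" "(\<Sum>i<r. ?c i / (q\<^sub>1 - n + 2 * ?c i)) \<le> 1"
    proof -
      have "s \<le> 1" "real r * \<kappa> \<ge> 0" using s \<kappa> by auto
      note sb = secular_bound[where c = ?c, OF r n0 s(1) this R\<kappa>[unfolded R_def] csum near[unfolded R_def]]
      show "q\<^sub>1 \<ge> n" "(\<Sum>i<r. ?c i / (q\<^sub>1 - n + 2 * ?c i)) \<le> 1"
        unfolding q\<^sub>1_def Deq R_def using sb[unfolded R_def] by simp_all
    qed
    have "qform V (cross l) x \<le> q\<^sub>1 * sqnorm V x"
      by (rule qform_cross_le[OF V(1) lab]) (use big q1 cV in auto)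
    then have qK: "qform V (cross l) x \<le> q\<^sub>1" using x by simp
    define M where "M u w = of_bool (E u w) - (of_bool (cross l u w) :: real)" for u w
    have agree: "E u w = cross l u w" if uw: "u \<in> V" "w \<in> V" "\<not> (u \<in> B \<and> w \<in> B)" for u w
    proof (cases "u \<in> B")
      case True
      then have "E w u \<longleftrightarrow> l w \<noteq> l u" using uw adj by blast
      then show ?thesis using V by (auto simp: cross_def sym_irrefl_def)
    next
      case False
      then show ?thesis using uw adj by (auto simp: cross_def)
    qed
    define dE where "dE = deg_sum V E - deg_sum V (cross l)"
    have dE: "dE = (\<Sum>u\<in>B. \<Sum>w\<in>B. M u w)" unfolding dE_def M_def
      by (rule deg_sum_diff[OF V(1) B(1) agree])
    have "n * (qform V E x - qform V (cross l) x) = (\<Sum>u\<in>V. \<Sum>w\<in>V. M u w * (n * (x u + x w)^2)) / 2"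
    proof -
      have "M u w * (n * (x u + x w)^2) =
          n * (of_bool (E u w) * (x u + x w)^2) - n * (of_bool (cross l u w) * (x u + x w)^2)" for u w
        by (simp add: M_def algebra_simps)
      then show ?thesis
        by (simp only: qform_def sum_subtractf sum_distrib_left[symmetric]) (simp add: field_simps)
    qed
    also have "(\<Sum>u\<in>V. \<Sum>w\<in>V. M u w * (n * (x u + x w)^2)) = (\<Sum>u\<in>B. \<Sum>w\<in>B. M u w * (n * (x u + x w)^2))"
      by (rule sum_pairs_restrict[OF V(1) B(1)]) (use agree in \<open>auto simp: M_def\<close>)
    also have "\<dots> \<le> (\<Sum>u\<in>B. \<Sum>w\<in>B. 4 * M u w + 12 * \<kappa>)"
    proof (intro sum_mono)
      fix u w assume uw: "u \<in> B" "w \<in> B"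
      \<comment> \<open>The two scaled entries sum to 2 + e, so each pair inside B contributes 4
        times its change of adjacency, up to 12 \<kappa>.\<close>
      define e where "e = sqrt n * x u + sqrt n * x w - 2"
      have "u \<in> V" "w \<in> V" using uw B(1) by auto
      then have "\<bar>e\<bar> \<le> 2 * \<kappa>" using x(3)[of u] x(3)[of w] unfolding e_def by linarith
      have "n * (x u + x w)^2 = (2 + e)^2"
        by (simp add: e_def distrib_left[symmetric] power_mult_distrib)
      then have y: "n * (x u + x w)^2 - 4 = e * (4 + e)" by (simp add: power2_eq_square algebra_simps)
      have "\<bar>e * (4 + e)\<bar> \<le> (2 * \<kappa>) * 6"
        unfolding abs_mult using \<open>\<bar>e\<bar> \<le> 2 * \<kappa>\<close> \<kappa>1 \<kappa> by (intro mult_mono) auto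
      moreover have "M u w = 0 \<or> M u w = 1 \<or> M u w = -1" by (simp add: M_def)
      ultimately show "M u w * (n * (x u + x w)^2) \<le> 4 * M u w + 12 * \<kappa>"
        using y \<kappa> by auto
    qed
    also have "\<dots> = 4 * dE + 12 * \<kappa> * (real (card B))^2"
      by (simp add: dE sum.distrib sum_distrib_left power2_eq_square)
    also have "\<dots> \<le> 4 * dE + 12 * \<kappa> * b^2"
      using bB \<kappa> by (intro add_left_mono mult_left_mono power_mono) auto
    finally have "n * (qform V E x - qform V (cross l) x) \<le> 2 * dE + 1 / 10"
      using \<kappa>b by simp
    moreover have "n * qform V (cross l) x \<le> n * q\<^sub>1" using qK by (intro mult_left_mono) auto
    ultimately have "n * qmax V E \<le> n * q\<^sub>1 + 2 * dE + 1 / 10" using x(2) by (simp add: algebra_simps)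
    moreover define A where "A = (1 - 1 / R) * (real n)^2"
    have "n * q\<^sub>1 = 2 * A - 2 * \<beta> * D"
      using n0 by (simp add: q\<^sub>1_def A_def \<beta>_def power2_eq_square field_simps)
    ultimately have up: "2 * real X \<le> A - \<beta> * D + dE + 1 / 20" using X by (simp add: V_def)
    define D' where "D' = imbalance r {0..<n} (\<lambda>v. v mod r)"
    have D': "D' \<le> R / 4" using turan_imbalance_le[OF r0, of n] by (simp add: D'_def R_def)
    have turan: "deg_sum {0..<n} (cross (\<lambda>v. v mod r)) = A - D'"
      using deg_sum_cross[of "{0..<n}" "\<lambda>v. v mod r" r] r0 by (simp add: A_def D'_def R_def)
    obtain E' where E': "free_on {0..<n} E'" "deg_sum {0..<n} E' = A - D' + dE"
    proof (rule transplant[OF fr B(1) adj lab big(1)])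
      have "r * card B \<le> r * (r * K\<^sub>0)" using B(2) by (rule mult_left_mono) simp
      then show "r * card B \<le> n" using n by linarith
    qed (use that turan in \<open>auto simp: dE_def\<close>)
    have low: "A - D' + dE \<le> 2 * real X" using Xmax[OF E'(1)] E'(2) by simp
    have degK: "deg_sum V (cross l) = A - D"
      using deg_sum_cross[OF V(1) lab r0] by (simp add: A_def D_def R_def cV)
    have degE: "deg_sum V E = A - D + dE" using degK by (simp add: dE_def)
    have D0: "D \<ge> 0" by (simp add: D_def imbalance_nonneg)
    \<comment> \<open>Integrality enters here: A - D and A - D' are twice edge counts, so D > D'
      means D >= D' + 2.\<close>
    define k where "k = card (edge_set V (cross l))"
    define \<tau> where "\<tau> = card (edge_set {0..<n} (cross (\<lambda>v. v mod r)))"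
    define m where "m = card (edge_set V E)"
    have k: "A - D = 2 * real k" using edge_set_props(3)[OF V(1) sym_irrefl_cross[of l]] degK by (simp add: k_def)
    have \<tau>: "A - D' = 2 * real \<tau>"
      using edge_set_props(3)[OF _ sym_irrefl_cross, of "{0..<n}" "\<lambda>v. v mod r"] turan by (simp add: \<tau>_def)
    have m: "deg_sum V E = 2 * real m" using edge_set_props(3)[OF V] by (simp add: m_def)
    have "real X > real m" using neg m by (simp add: V_def)
    then have "m + 1 \<le> X" by simp
    then have "real X \<ge> real m + 1" by linarith
    then have Xge: "2 * real X \<ge> A - D + dE + 2" using m degE by linarith
    \<comment> \<open>If D >= D' + 2, the spectral upper bound and the transplanted lower bound on 2
      X give 2 \<beta> <= (1 - \<beta>) D' + 1/20 <= 45/80, against 2 \<beta> >= 59/90. Otherwise D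
      <= D' <= R/4, and a deficit of one edge gives 2 <= (1 - \<beta>) D + 1/20.\<close>
    show False
    proof (cases "k < \<tau>")
      case True
      then have "D \<ge> D' + 2" using k \<tau> by linarith
      then have "\<beta> * (D' + 2) \<le> \<beta> * D" using \<beta>(1) by (intro mult_left_mono) auto
      then have "2 * \<beta> \<le> (1 - \<beta>) * D' + 1 / 20" using up low by (simp add: algebra_simps)
      moreover have "(1 - \<beta>) * D' \<le> (1 - \<beta>) * (R / 4)" using \<beta>(2) D' by (intro mult_left_mono) auto
      ultimately show False using \<beta> by linarith
    next
      case False
      then have "D \<le> R / 4" using k \<tau> D' by linarith
      then have "(1 - \<beta>) * D \<le> (1 - \<beta>) * (R / 4)" using \<beta>(2) by (intro mult_left_mono) auto
      moreover have "2 \<le> (1 - \<beta>) * D + 1 / 20" using up Xge by (simp add: algebra_simps)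
      ultimately show False using \<beta> by linarith
    qed
  qed
qed

end

section \<open>Graphs and matrices\<close>

definition adj :: "nat graph \<Rightarrow> nat \<Rightarrow> nat \<Rightarrow> bool" where
  "adj G u w \<longleftrightarrow> {u, w} \<in> edges G"

definition mk_graph :: "nat \<Rightarrow> (nat \<Rightarrow> nat \<Rightarrow> bool) \<Rightarrow> nat graph" where
  "mk_graph n E = ({0..<n}, edge_set {0..<n} E)"

lemma sym_irrefl_adj: "simple_graph G \<Longrightarrow> sym_irrefl (adj G)"
  using simple_graph_edgeD(3)[of G u u for u] by (auto simp: sym_irrefl_def adj_def insert_commute)

lemma edges_eq_edge_set:
  assumes "simple_graph G"
  shows "edges G = edge_set (verts G) (adj G)"
proof (intro equalityI subsetI)
  fix e assume e: "e \<in> edges G"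
  then obtain u w where "e = {u, w}" using assms unfolding simple_graph_def by blast
  then show "e \<in> edge_set (verts G) (adj G)"
    using e simple_graph_edgeD[OF assms, of u w] by (auto simp: edge_set_def adj_def)
qed (auto simp: edge_set_def adj_def)

lemma simple_mk_graph: "sym_irrefl E \<Longrightarrow> simple_graph (mk_graph n E)"
  unfolding simple_graph_def mk_graph_def edge_set_def by (auto simp: sym_irrefl_def) metis

lemma adj_mk_graph:
  assumes "sym_irrefl E" "u < n" "w < n"
  shows "adj (mk_graph n E) u w \<longleftrightarrow> E u w"
  using assms by (auto simp: adj_def mk_graph_def edge_set_def doubleton_eq_iff sym_irrefl_def)

lemma verts_mk_graph: "verts (mk_graph n E) = {0..<n}"
  by (simp add: mk_graph_def)

lemma deg_sum_num_edges:
  assumes "simple_graph G"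
  shows "deg_sum (verts G) (adj G) = 2 * real (num_edges G)"
  using edge_set_props(3)[of "verts G" "adj G"] sym_irrefl_adj[OF assms] assms
  by (simp add: num_edges_def edges_eq_edge_set[OF assms, symmetric] simple_graph_def)

lemma deg_sum_cong: "(\<And>u w. u \<in> V \<Longrightarrow> w \<in> V \<Longrightarrow> E u w = E' u w) \<Longrightarrow> deg_sum V E = deg_sum V E'"
  unfolding deg_sum_def dg_def nbr_def by (intro sum.cong refl arg_cong[where f = real] arg_cong[where f = card]) auto

lemma qmax_cong: "(\<And>u w. u \<in> V \<Longrightarrow> w \<in> V \<Longrightarrow> E u w = E' u w) \<Longrightarrow> qmax V E = qmax V E'"
  unfolding qmax_def qform_def by (simp cong: sum.cong)

lemma embeds_cong:
  assumes "simple_graph F" "\<And>u w. u \<in> V \<Longrightarrow> w \<in> V \<Longrightarrow> E u w = E' u w"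
  shows "embeds F V E = embeds F V E'"
proof -
  have imp: "embeds F V E\<^sub>2"
    if e: "embeds F V E\<^sub>1" and eq: "\<And>u w. u \<in> V \<Longrightarrow> w \<in> V \<Longrightarrow> E\<^sub>1 u w = E\<^sub>2 u w" for E\<^sub>1 E\<^sub>2
  proof -
    obtain f where f: "inj_on f (verts F)" "f ` verts F \<subseteq> V" "\<And>a b. {a, b} \<in> edges F \<Longrightarrow> E\<^sub>1 (f a) (f b)"
      using e unfolding embeds_def by blast
    show ?thesis unfolding embeds_def
    proof (intro exI[of _ f] conjI allI impI f)
      fix a b assume ab: "{a, b} \<in> edges F"
      have "f a \<in> V" "f b \<in> V" using f(2) simple_graph_edgeD[OF assms(1) ab] by auto
      then show "E\<^sub>2 (f a) (f b)" using f(3)[OF ab] eq[of "f a" "f b"] by simp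
    qed
  qed
  show ?thesis using imp[of E E'] imp[of E' E] assms(2) by auto
qed

lemma graph_free_iff:
  assumes "simple_graph F" "simple_graph G"
  shows "graph_free F G \<longleftrightarrow> \<not> embeds F (verts G) (adj G)"
proof -
  have "embeds F (verts G) (adj G)" if H: "is_subgraph H G" "graph_iso F H" for H
  proof -
    obtain f where f: "bij_betw f (verts F) (verts H)" "(\<lambda>e. f ` e) ` edges F = edges H"
      using H(2) by (auto simp: graph_iso_def)
    have "adj G (f u) (f v)" if "{u, v} \<in> edges F" for u v
    proof -
      have "f ` {u, v} \<in> edges H" using f(2) that by blast
      then show ?thesis using H(1) by (auto simp: adj_def is_subgraph_def)
    qed
    then show ?thesis
      using f(1) H(1) unfolding embeds_def is_subgraph_def bij_betw_def by (intro exI[of _ f]) blast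
  qed
  moreover have "\<exists>H. is_subgraph H G \<and> graph_iso F H" if emb: "embeds F (verts G) (adj G)"
  proof -
    obtain f where f: "inj_on f (verts F)" "f ` verts F \<subseteq> verts G"
      "\<And>u v. {u, v} \<in> edges F \<Longrightarrow> adj G (f u) (f v)"
      using emb unfolding embeds_def by blast
    define H where "H = (f ` verts F, (\<lambda>e. f ` e) ` edges F)"
    have e: "\<exists>u v. e = {u, v}" if "e \<in> edges F" for e
      using that assms(1) unfolding simple_graph_def by blast
    have "edges H \<subseteq> {{u, v} | u v. u \<in> verts H \<and> v \<in> verts H \<and> u \<noteq> v}"
    proof
      fix e' assume "e' \<in> edges H"
      then obtain e where e': "e \<in> edges F" "e' = f ` e" by (auto simp: H_def)
      obtain u v where uv: "e = {u, v}" using e[OF e'(1)] by blast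
      have "u \<in> verts F" "v \<in> verts F" "u \<noteq> v" using simple_graph_edgeD[OF assms(1)] e' uv by auto
      then have "f u \<noteq> f v" using f(1) by (auto dest: inj_onD)
      then show "e' \<in> {{u, v} | u v. u \<in> verts H \<and> v \<in> verts H \<and> u \<noteq> v}"
        using \<open>u \<in> verts F\<close> \<open>v \<in> verts F\<close> e' uv by (auto simp: H_def)
    qed
    then have "simple_graph H" using assms(1) by (simp add: simple_graph_def H_def)
    moreover have "edges H \<subseteq> edges G"
    proof
      fix e' assume "e' \<in> edges H"
      then obtain e where e': "e \<in> edges F" "e' = f ` e" by (auto simp: H_def)
      obtain u v where uv: "e = {u, v}" using e[OF e'(1)] by blast
      then show "e' \<in> edges G" using f(3)[of u v] e' by (simp add: adj_def)
    qed
    ultimately have "is_subgraph H G" using f(2) by (simp add: is_subgraph_def H_def)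
    moreover have "graph_iso F H" unfolding graph_iso_def
      using f(1) by (intro exI[of _ f]) (simp add: H_def bij_betw_def)
    ultimately show ?thesis by blast
  qed
  ultimately show ?thesis unfolding graph_free_def by blast
qed

text \<open>Every eigenvalue is the Rayleigh quotient of its eigenvector, hence at most
  \<open>qmax\<close>; conversely \<open>qmax_eigen\<close> turns a maximiser into an
  eigenvector.\<close>

lemma q_radius_eq_qmax:
  assumes G: "simple_graph G" "verts G = {0..<n}" and n: "n > 0"
  shows "q_radius G = qmax {0..<n} (adj G)"
proof -
  let ?V = "{0..<n}" and ?E = "adj G" and ?A = "signless_laplacian G"
  have V: "finite ?V" "?V \<noteq> {}" "sym_irrefl ?E" using n sym_irrefl_adj[OF G(1)] by auto
  have A: "?A \<in> carrier_mat n n"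
    using G(2) by (simp add: signless_laplacian_def degree_mat_def adjacency_mat_def)
  have deg: "real (degree_of G i) = dg ?V ?E i" if "i < n" for i
    using edge_set_props(2)[OF V(1,3), of i] that edges_eq_edge_set[OF G(1)] G(2)
    by (simp add: degree_of_def dg_def)
  have mult: "(?A *\<^sub>v y) $ i = dg ?V ?E i * y $ i + (\<Sum>j\<in>nbr ?V ?E i. y $ j)"
    if y: "y \<in> carrier_vec n" and i: "i < n" for y i
  proof -
    have "(?A *\<^sub>v y) $ i = (\<Sum>j\<in>?V. ?A $$ (i, j) * y $ j)"
      using A y i by (simp add: scalar_prod_def)
    also have "\<dots> = (\<Sum>j\<in>?V. (if j = i then real (degree_of G i) * y $ i else 0) + of_bool (?E i j) * y $ j)"
    proof (rule sum.cong[OF refl])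
      fix j assume "j \<in> ?V"
      then show "?A $$ (i, j) * y $ j = (if j = i then real (degree_of G i) * y $ i else 0) + of_bool (?E i j) * y $ j"
        using i G(2) by (simp add: signless_laplacian_def degree_mat_def adjacency_mat_def adj_def algebra_simps)
    qed
    also have "\<dots> = real (degree_of G i) * y $ i + (\<Sum>j\<in>?V. of_bool (?E i j) * y $ j)"
      using i by (simp add: sum.distrib)
    finally show ?thesis using deg[OF i] by (simp add: sum_nbr[OF V(1)])
  qed
  have le: "k \<le> qmax ?V ?E" if k: "k \<in> spectrum ?A" for k
  proof -
    obtain y where y: "y \<in> carrier_vec n" "y \<noteq> 0\<^sub>v n" "?A *\<^sub>v y = k \<cdot>\<^sub>v y"
      using k A by (auto simp: spectrum_def eigenvalue_def eigenvector_def)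
    define x where "x = (\<lambda>i. y $ i)"
    have ev: "dg ?V ?E i * x i + (\<Sum>j\<in>nbr ?V ?E i. x j) = k * x i" if "i < n" for i
      using mult[OF y(1) that] y that by (simp add: x_def)
    have "qform ?V ?E x = (\<Sum>i\<in>?V. x i * (dg ?V ?E i * x i + (\<Sum>j\<in>nbr ?V ?E i. x j)))"
      by (simp add: qform_expand[OF V(1,3)] power2_eq_square algebra_simps)
    also have "\<dots> = (\<Sum>i\<in>?V. x i * (k * x i))" using ev by (intro sum.cong) auto
    also have "\<dots> = k * sqnorm ?V x" by (simp add: sqnorm_def sum_distrib_left power2_eq_square mult_ac)
    finally have "k * sqnorm ?V x \<le> qmax ?V ?E * sqnorm ?V x"
      using qform_le_qmax[OF V(1,3), of x] by simp
    moreover have "sqnorm ?V x > 0"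
    proof -
      obtain i where i: "i < n" "y $ i \<noteq> 0" using y(1,2) by (metis eq_vecI carrier_vecD index_zero_vec)
      have "(x i)^2 \<le> sqnorm ?V x" unfolding sqnorm_def by (rule member_le_sum) (use i in auto)
      moreover have "(x i)^2 > 0" using i by (simp add: x_def)
      ultimately show ?thesis by linarith
    qed
    ultimately show ?thesis by simp
  qed
  have mem: "qmax ?V ?E \<in> spectrum ?A"
  proof -
    obtain x where x: "sqnorm ?V x = 1" "qform ?V ?E x = qmax ?V ?E"
      using qmax_attained[OF V] by blast
    define y where "y = vec n x"
    have y: "y \<in> carrier_vec n" by (simp add: y_def)
    have "y \<noteq> 0\<^sub>v n"
    proof
      assume z: "y = 0\<^sub>v n"
      have "x i = 0" if "i < n" for i using arg_cong[OF z, of "\<lambda>v. v $ i"] that by (simp add: y_def)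
      then have "sqnorm ?V x = 0" by (simp add: sqnorm_def)
      then show False using x by simp
    qed
    moreover have "?A *\<^sub>v y = qmax ?V ?E \<cdot>\<^sub>v y"
    proof (rule eq_vecI)
      fix i assume "i < dim_vec (qmax ?V ?E \<cdot>\<^sub>v y)"
      then have i: "i < n" by (simp add: y_def)
      have "(\<Sum>j\<in>nbr ?V ?E i. y $ j) = (\<Sum>j\<in>nbr ?V ?E i. x j)"
        by (intro sum.cong) (auto simp: y_def nbr_def)
      then show "(?A *\<^sub>v y) $ i = (qmax ?V ?E \<cdot>\<^sub>v y) $ i"
        using mult[OF y i] qmax_eigen[OF V(1,3) x, of i] i by (simp add: y_def)
    qed (use A in \<open>simp add: y_def\<close>)
    ultimately show ?thesis using y A by (auto simp: spectrum_def eigenvalue_def eigenvector_def)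
  qed
  show ?thesis unfolding q_radius_def
    by (rule Max_eqI) (use card_finite_spectrum(1)[OF A] le mem in auto)
qed

section \<open>Extremal numbers as bounds on degree sums\<close>

lemma finite_free_graphs: "finite (free_graphs n F)"
proof -
  have "free_graphs n F \<subseteq> {{0..<n}} \<times> Pow (Pow {0..<n})"
    by (auto simp: free_graphs_def simple_graph_def)
  then show ?thesis by (rule finite_subset) auto
qed

lemma mk_graph_free:
  assumes "simple_graph F" "sym_irrefl E" "\<not> embeds F {0..<n} E"
  shows "mk_graph n E \<in> free_graphs n F"
    "deg_sum {0..<n} E = 2 * real (num_edges (mk_graph n E))"
    "n > 0 \<Longrightarrow> qmax {0..<n} E = q_radius (mk_graph n E)"
proof -
  let ?G = "mk_graph n E"
  have c: "adj ?G u w = E u w" if "u \<in> {0..<n}" "w \<in> {0..<n}" for u w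
    using adj_mk_graph[OF assms(2)] that by simp
  have s: "simple_graph ?G" by (rule simple_mk_graph[OF assms(2)])
  show "?G \<in> free_graphs n F"
    using assms(3) embeds_cong[OF assms(1), of "{0..<n}" "adj ?G" E] c graph_free_iff[OF assms(1) s] s
    by (simp add: free_graphs_def verts_mk_graph)
  show "deg_sum {0..<n} E = 2 * real (num_edges ?G)"
    using deg_sum_num_edges[OF s] deg_sum_cong[of "{0..<n}" "adj ?G" E] c by (simp add: verts_mk_graph)
  show "qmax {0..<n} E = q_radius ?G" if "n > 0"
    using q_radius_eq_qmax[OF s verts_mk_graph that] qmax_cong[of "{0..<n}" "adj ?G" E] c by simp
qed

text \<open>The edge bound is used on arbitrary finite sets of naturals, while \<open>ex_num\<close>
  refers to initial segments; a bijection carries the graph over.\<close>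

lemma deg_sum_le_ex_num:
  assumes "simple_graph F" "finite V" "sym_irrefl E" "\<not> embeds F V E"
  shows "deg_sum V E \<le> 2 * real (ex_num (card V) F)"
proof -
  let ?n = "card V"
  obtain h where h: "bij_betw h {0..<?n} V" using ex_bij_betw_nat_finite[OF assms(2)] by blast
  define E' where "E' i j = E (h i) (h j)" for i j
  have s: "sym_irrefl E'" using assms(3) by (auto simp: sym_irrefl_def E'_def)
  have "\<not> embeds F {0..<?n} E'"
  proof
    assume "embeds F {0..<?n} E'"
    then obtain f where f: "inj_on f (verts F)" "f ` verts F \<subseteq> {0..<?n}"
      "\<And>a b. {a, b} \<in> edges F \<Longrightarrow> E' (f a) (f b)" unfolding embeds_def by blast
    have "inj_on (h \<circ> f) (verts F)"
      using f(1,2) h by (intro comp_inj_on) (auto simp: bij_betw_def intro: inj_on_subset)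
    moreover have "(h \<circ> f) ` verts F \<subseteq> V" using f(2) h by (auto simp: bij_betw_def)
    ultimately have "embeds F V E" unfolding embeds_def using f(3)
      by (intro exI[of _ "h \<circ> f"]) (simp add: E'_def)
    with assms(4) show False ..
  qed
  note free = mk_graph_free[OF assms(1) s this]
  have "deg_sum {0..<?n} E' = deg_sum V E"
  proof -
    have "deg_sum {0..<?n} E' = (\<Sum>i\<in>{0..<?n}. \<Sum>j\<in>{0..<?n}. of_bool (E (h i) (h j)))"
      by (simp add: deg_sum_eq_pairs E'_def)
    also have "\<dots> = (\<Sum>i\<in>{0..<?n}. \<Sum>w\<in>V. of_bool (E (h i) w))"
      by (intro sum.cong refl sum.reindex_bij_betw[OF h])
    also have "\<dots> = (\<Sum>u\<in>V. \<Sum>w\<in>V. of_bool (E u w))"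
      by (rule sum.reindex_bij_betw[OF h])
    finally show ?thesis by (simp add: deg_sum_eq_pairs[OF assms(2)])
  qed
  moreover have "num_edges (mk_graph ?n E') \<le> ex_num ?n F"
    unfolding ex_num_def using free(1) by (intro Max_ge finite_imageI finite_free_graphs imageI)
  ultimately show ?thesis using free(2) by simp
qed

lemma turan_num_eq:
  assumes "r > 0"
  shows "2 * real (turan_num r n) = (1 - 1 / r) * (real n)^2 - imbalance r {0..<n} (\<lambda>v. v mod r)"
proof -
  have "turan_graph r n = ({0..<n}, edge_set {0..<n} (cross (\<lambda>v. v mod r)))"
    by (simp add: turan_graph_def edge_set_def cross_def)
  then have "turan_num r n = card (edge_set {0..<n} (cross (\<lambda>v. v mod r)))"
    by (simp add: turan_num_def num_edges_def)
  then have "2 * real (turan_num r n) = deg_sum {0..<n} (cross (\<lambda>v. v mod r))"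
    using edge_set_props(3)[OF _ sym_irrefl_cross, of "{0..<n}" "\<lambda>v. v mod r"] by simp
  also have "\<dots> = (1 - 1 / r) * (real n)^2 - imbalance r {0..<n} (\<lambda>v. v mod r)"
    using deg_sum_cross[of "{0..<n}" "\<lambda>v. v mod r" r] assms by simp
  finally show ?thesis .
qed

theorem theorem1p4:
  fixes r :: nat and F :: "'a graph"
  assumes "r \<ge> 3"
    and "simple_graph F"
    and "(\<lambda>n. real (ex_num n F) - real (turan_num r n)) \<in> O(\<lambda>_. 1)"
  shows "\<exists>n\<^sub>0. \<forall>n\<ge>n\<^sub>0. ex_ssp_graphs n F \<subseteq> ex_graphs n F"
proof -
  have r: "r > 0" using assms(1) by simp
  obtain c where c: "c > 0" "\<forall>\<^sub>F n in sequentially. norm (real (ex_num n F) - real (turan_num r n)) \<le> c * norm (1::real)"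
    using landau_o.bigE[OF assms(3)] by blast
  then obtain N where N: "\<And>n. n \<ge> N \<Longrightarrow> \<bar>real (ex_num n F) - real (turan_num r n)\<bar> \<le> c"
    by (auto simp: eventually_sequentially)
  have ex_le: "2 * real (ex_num n F) \<le> (1 - 1 / r) * (real n)^2 + 2 * c" if "n \<ge> N" for n
    using N[OF that] turan_num_eq[OF r, of n] imbalance_nonneg[of r "{0..<n}" "\<lambda>v. v mod r"] by linarith
  have ex_ge: "2 * real (ex_num n F) \<ge> (1 - 1 / r) * (real n)^2 - r / 4 - 2 * c" if "n \<ge> N" for n
    using N[OF that] turan_num_eq[OF r, of n] turan_imbalance_le[OF r, of n] by linarith
  \<comment> \<open>Degree sums count every edge twice, so the error c in the edge count becomes 2
    c.\<close>
  interpret extremal_bound r F "2 * c" N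
  proof
    show "deg_sum V E \<le> (1 - 1 / r) * (real (card V))^2 + 2 * c"
      if "finite V" "sym_irrefl E" "\<not> embeds F V E" "card V \<ge> N" for V E
      using deg_sum_le_ex_num[OF assms(2) that(1-3)] ex_le[OF that(4)] by linarith
  qed (use assms c in auto)
  obtain n\<^sub>1 where n\<^sub>1: "\<And>n E (X::nat). n \<ge> n\<^sub>1 \<Longrightarrow> q_extremal {0..<n} E \<Longrightarrow> phi {0..<n} E \<ge> dens \<Longrightarrow>
    real n * qmax {0..<n} E \<ge> 4 * real X \<Longrightarrow>
    (\<And>E'. free_on {0..<n} E' \<Longrightarrow> deg_sum {0..<n} E' \<le> 2 * real X) \<Longrightarrow> 2 * real X \<le> deg_sum {0..<n} E"
    by (rule extremal_edges) blast
  have "dens > 0" using dens_bounds by linarith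
  then obtain n\<^sub>2 :: nat where n\<^sub>2: "\<And>n::nat. n \<ge> n\<^sub>2 \<Longrightarrow> dens * n \<ge> r / 2 + 4 * c"
    using eventually_linear by metis
  show ?thesis
  proof (intro exI[of _ "n\<^sub>1 + n\<^sub>2 + N + 2"] allI impI subsetI)
    fix n G assume n: "n \<ge> n\<^sub>1 + n\<^sub>2 + N + 2" and G: "G \<in> ex_ssp_graphs n F"
    let ?V = "{0..<n}"
    have n0: "n > 0" using n by simp
    have Gf: "G \<in> free_graphs n F" and Gq: "q_radius G = ex_ssp n F" using G by (auto simp: ex_ssp_graphs_def)
    have Gs: "simple_graph G" "verts G = ?V" using Gf by (auto simp: free_graphs_def)
    have fr: "free_on ?V (adj G)"
      using Gf graph_free_iff[OF assms(2) Gs(1)] sym_irrefl_adj[OF Gs(1)] Gs(2)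
      by (simp add: free_on_def free_graphs_def)
    have qG: "qmax ?V (adj G) = ex_ssp n F" using q_radius_eq_qmax[OF Gs n0] Gq by simp
    have q_le: "q_radius H \<le> ex_ssp n F" if "H \<in> free_graphs n F" for H
      unfolding ex_ssp_def using that by (intro Max_ge finite_imageI finite_free_graphs imageI)
    have ext: "q_extremal ?V (adj G)" unfolding q_extremal_def
    proof (intro conjI allI impI fr)
      fix E' assume "free_on ?V E'"
      then have E': "sym_irrefl E'" "\<not> embeds F ?V E'" by (auto simp: free_on_def)
      show "qmax ?V E' \<le> qmax ?V (adj G)"
        using q_le[OF mk_graph_free(1)[OF assms(2) E']] mk_graph_free(3)[OF assms(2) E' n0] qG by simp
    qed
    define X where "X = ex_num n F"
    have "X \<in> num_edges ` free_graphs n F"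
      unfolding X_def ex_num_def using Gf by (intro Max_in finite_imageI finite_free_graphs) auto
    then obtain H where H: "H \<in> free_graphs n F" "num_edges H = X" by auto
    have Hs: "simple_graph H" "verts H = ?V" using H by (auto simp: free_graphs_def)
    have "2 * deg_sum ?V (adj H) / n \<le> qmax ?V (adj H)"
      using qmax_ge_deg_sum[of ?V "adj H"] sym_irrefl_adj[OF Hs(1)] n0 by simp
    also have "\<dots> \<le> qmax ?V (adj G)"
      using q_radius_eq_qmax[OF Hs n0] q_le[OF H(1)] qG by simp
    finally have "2 * deg_sum ?V (adj H) \<le> n * qmax ?V (adj G)"
      using n0 by (simp add: divide_le_eq mult.commute)
    moreover have dH: "deg_sum ?V (adj H) = 2 * real X" using deg_sum_num_edges[OF Hs(1)] H Hs by simp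
    ultimately have qX: "4 * real X \<le> n * qmax ?V (adj G)" by simp
    have phi: "phi ?V (adj G) \<ge> dens"
    proof -
      \<comment> \<open>The normalisation by n - 1 leaves a surplus of dens n, which absorbs the
        bounded difference between ex(n, F) and the edge number of a perfectly balanced
        graph.\<close>
      have "n * (dens * (n - 1)) = dens * (real n)^2 - dens * n"
        by (simp add: power2_eq_square algebra_simps of_nat_diff n0 Suc_leI)
      also have "\<dots> \<le> dens * (real n)^2 - (r / 2 + 4 * c)" using n\<^sub>2[of n] n by simp
      also have "\<dots> \<le> 4 * real X" using ex_ge[of n] n by (simp add: X_def dens_def algebra_simps)
      finally have "n * (dens * (n - 1)) \<le> n * qmax ?V (adj G)" using qX by linarith
      then have "dens * (real n - 1) \<le> qmax ?V (adj G)" using n0 by (simp add: of_nat_diff Suc_leI)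
      then show ?thesis using n by (simp add: phi_def pos_le_divide_eq)
    qed
    have "2 * real X \<le> deg_sum ?V (adj G)"
    proof (rule n\<^sub>1[OF _ ext phi qX])
      show "deg_sum ?V E' \<le> 2 * real X" if "free_on ?V E'" for E'
        using deg_sum_le_ex_num[OF assms(2), of ?V E'] that by (simp add: free_on_def X_def)
    qed (use n in simp)
    then have "X \<le> num_edges G" using deg_sum_num_edges[OF Gs(1)] Gs(2) by simp
    moreover have "num_edges G \<le> X"
      unfolding X_def ex_num_def using Gf by (intro Max_ge finite_imageI finite_free_graphs imageI)
    ultimately show "G \<in> ex_graphs n F" using Gf by (simp add: ex_graphs_def X_def)
  qed
qed

end
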